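(* Let $A$ be a Noetherian integral domain. If $A$ is not a Henselian local ring, then $A$ satisfies condition (C), i.e. the set $A\setminus\{0\}$ is positive-existential in $A$.
   Context: All rings are commutative with unit. For a ring $A$ and $r\in\mathbb{N}$, a subset $Z\subset A^r$ is called positive-existential (or $A$-positive-existential) if it is a finite (possibly empty) union of sets of the form $\{t\in A^r\mid \exists x\in A^n,\ F_1(t,x)=\cdots=F_s(t,x)=0\}$, where $n,s\in\mathbb{N}$ and the $F_j$ are polynomials in $r+n$ indeterminates with coefficients in $A$. Condition (C) for a ring $A$: the subset $A\setminus\{0\}$ of $A$ is positive-existential. A local ring $A$ is Henselian if every finite $A$-algebra (i.e. finitely generated as an $A$-module) is a product of local rings. *)

theory Defs
  imports "HOL-Algebra.Algebra"
begin

section \<open>Positive-existential sets\<close>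

text \<open>
  Points of \<open>A\<^sup>r\<close> are lists of length \<open>r\<close> over the carrier. A polynomial in \<open>k\<close> indeterminates over
  \<open>A\<close> is an element of the library's \<open>indexed_pset\<close> on the index set \<open>{..<k}\<close>: a function sending
  a monomial (a multiset of indices) to its coefficient, necessarily of finite support.
\<close>

definition tuples :: "('a, 'm) ring_scheme \<Rightarrow> nat \<Rightarrow> 'a list set"
  where "tuples A r = {t. length t = r \<and> set t \<subseteq> carrier A}"

definition mpolys :: "('a, 'm) ring_scheme \<Rightarrow> nat \<Rightarrow> (nat multiset \<Rightarrow> 'a) set"
  where "mpolys A k = ring.indexed_pset A {..<k} (carrier A)"

definition mpoly_eval :: "('a, 'm) ring_scheme \<Rightarrow> (nat multiset \<Rightarrow> 'a) \<Rightarrow> 'a list \<Rightarrow> 'a"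
  where "mpoly_eval A F t =
    (\<Oplus>\<^bsub>A\<^esub>m\<in>{m. F m \<noteq> \<zero>\<^bsub>A\<^esub>}. F m \<otimes>\<^bsub>A\<^esub> (\<Otimes>\<^bsub>A\<^esub>i\<in>{..<length t}. (t ! i) [^]\<^bsub>A\<^esub> count m i))"

definition pos_exist_basic ::
  "('a, 'm) ring_scheme \<Rightarrow> nat \<Rightarrow> nat \<Rightarrow> (nat multiset \<Rightarrow> 'a) list \<Rightarrow> 'a list set"
  where "pos_exist_basic A r n Fs =
    {t \<in> tuples A r. \<exists>x \<in> tuples A n. \<forall>F \<in> set Fs. mpoly_eval A F (t @ x) = \<zero>\<^bsub>A\<^esub>}"

definition positive_existential :: "('a, 'm) ring_scheme \<Rightarrow> nat \<Rightarrow> 'a list set \<Rightarrow> bool"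
  where "positive_existential A r Z \<longleftrightarrow>
    (\<exists>\<S>. finite \<S> \<and>
         (\<forall>S \<in> \<S>. \<exists>n Fs. set Fs \<subseteq> mpolys A (r + n) \<and> S = pos_exist_basic A r n Fs) \<and>
         Z = \<Union>\<S>)"

text \<open>The subset \<open>A - {0}\<close> of \<open>A\<close> is read as a subset of \<open>A\<^sup>1\<close>, whence the singleton lists.\<close>

definition condition_C :: "('a, 'm) ring_scheme \<Rightarrow> bool"
  where "condition_C A \<longleftrightarrow> positive_existential A 1 ((\<lambda>a. [a]) ` (carrier A - {\<zero>\<^bsub>A\<^esub>}))"


section \<open>Henselian local rings\<close>

definition local_ring :: "('a, 'm) ring_scheme \<Rightarrow> bool"
  where "local_ring A \<longleftrightarrow> cring A \<and> (\<exists>!I. maximalideal I A)"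

definition finite_algebra :: "('a, 'm) ring_scheme \<Rightarrow> ('a, 'b, 'n) module_scheme \<Rightarrow> bool"
  where "finite_algebra A B \<longleftrightarrow> algebra A B \<and>
    (\<exists>S. finite S \<and> S \<subseteq> carrier B \<and>
         (\<forall>b \<in> carrier B. \<exists>c \<in> S \<rightarrow> carrier A. b = (\<Oplus>\<^bsub>B\<^esub>s\<in>S. c s \<odot>\<^bsub>B\<^esub> s)))"

text \<open>
  The product may be empty, i.e. the zero ring. Taking the factors in the carrier type of \<open>B\<close> is
  no restriction: each factor of a product decomposition embeds in \<open>B\<close> as a set, by padding with
  zeros (see \<open>product_of_local_ringsI\<close> below).
\<close>

definition product_of_local_rings :: "('b, 'n) ring_scheme \<Rightarrow> bool"
  where "product_of_local_rings B \<longleftrightarrow>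
    (\<exists>Rs :: 'b ring list. (\<forall>R \<in> set Rs. local_ring R) \<and> B \<simeq> RDirProd_list Rs)"

text \<open>
  One cannot quantify over all carrier types inside a definition. The type \<open>'a list\<close> suffices: an
  algebra generated by \<open>n\<close> elements is a quotient of \<open>A\<^sup>n\<close>, so it has a copy whose elements are
  chosen coefficient lists of length \<open>n\<close>. The lemma \<open>henselian_finite_algebra\<close> below gives the
  property for finite algebras over every carrier type.
\<close>

definition henselian_local_ring :: "('a, 'm) ring_scheme \<Rightarrow> bool"
  where "henselian_local_ring A \<longleftrightarrow> local_ring A \<and>
    (\<forall>B :: ('a, 'a list) module. finite_algebra A B \<longrightarrow> product_of_local_rings B)"


subsection \<open>Independence of the choice of carrier types\<close>

lemma maximalideal_vimage:
  assumes R: "ring R" and S: "ring S" and h: "h \<in> ring_iso R S" and I: "maximalideal I S"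
  shows "maximalideal {r \<in> carrier R. h r \<in> I} R"
proof -
  interpret I: maximalideal I S by (rule I)
  define g where "g = inv_into (carrier R) h"
  have g: "g \<in> ring_iso S R"
    unfolding g_def by (rule ring_iso_set_sym[OF R h])
  have bij: "bij_betw h (carrier R) (carrier S)"
    using ring_iso_memE(5)[OF h] .
  have gh: "g (h r) = r" if "r \<in> carrier R" for r
    using that bij unfolding g_def by (simp add: bij_betw_def)
  have hg: "h (g s) = s" "g s \<in> carrier R" if "s \<in> carrier S" for s
    using that bij unfolding g_def
    by (auto simp add: bij_betw_inv_into_right bij_betw_def inv_into_into)
  interpret H: ring_hom_ring R S h
    by (rule ring_hom_ringI2[OF R S]) (use h in \<open>simp add: ring_iso_def\<close>)
  interpret G: ring_hom_ring S R g
    by (rule ring_hom_ringI2[OF S R]) (use g in \<open>simp add: ring_iso_def\<close>)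
  show ?thesis
  proof (rule maximalidealI)
    show "ideal {r \<in> carrier R. h r \<in> I} R"
      by (rule H.ideal_vimage[OF I.is_ideal])
    show "carrier R \<noteq> {r \<in> carrier R. h r \<in> I}"
    proof
      assume eq: "carrier R = {r \<in> carrier R. h r \<in> I}"
      have "carrier S \<subseteq> I"
      proof (intro subsetI)
        fix s assume s: "s \<in> carrier S"
        have "h (g s) \<in> I" using eq hg(2)[OF s] by blast
        then show "s \<in> I" using hg(1)[OF s] by simp
      qed
      then show False using I.I_notcarr I.a_subset by blast
    qed
    fix J assume J: "ideal J R" "{r \<in> carrier R. h r \<in> I} \<subseteq> J" "J \<subseteq> carrier R"
    have "ideal {s \<in> carrier S. g s \<in> J} S"
      by (rule G.ideal_vimage[OF J(1)])
    moreover have "I \<subseteq> {s \<in> carrier S. g s \<in> J}"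
      using J(2) hg I.a_subset by auto
    ultimately consider "{s \<in> carrier S. g s \<in> J} = I" | "{s \<in> carrier S. g s \<in> J} = carrier S"
      using I.I_maximal by blast
    then show "J = {r \<in> carrier R. h r \<in> I} \<or> J = carrier R"
    proof cases
      case 1
      then have "J = {r \<in> carrier R. h r \<in> I}"
      proof (intro equalityI subsetI)
        fix r assume r: "r \<in> J"
        then have "r \<in> carrier R" using J(3) by blast
        moreover from this have "h r \<in> {s \<in> carrier S. g s \<in> J}"
          using r gh H.hom_closed by simp
        ultimately show "r \<in> {r \<in> carrier R. h r \<in> I}"
          using 1 by blast
      next
        fix r assume "r \<in> {r \<in> carrier R. h r \<in> I}"
        then show "r \<in> J" using J(2) by blast
      qed
      then show ?thesis ..
    next
      case 2
      then have "carrier R \<subseteq> J"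
      proof (intro subsetI)
        fix r assume r: "r \<in> carrier R"
        then have "h r \<in> {s \<in> carrier S. g s \<in> J}"
          using 2 H.hom_closed by blast
        then show "r \<in> J" using gh[OF r] by simp
      qed
      then show ?thesis using J(3) by blast
    qed
  qed
qed

lemma cring_image_ring:
  assumes "cring R" and "inj_on f (carrier R)"
  shows "cring (image_ring f R)"
  using cring.ring_iso_imp_img_cring[OF assms(1) inj_imp_image_ring_iso[OF assms(2)]]
  by (simp add: image_ring_def image_group_def monoid.defs)

lemma local_ring_image_ring:
  assumes R: "local_ring R" and f: "inj_on f (carrier R)"
  shows "local_ring (image_ring f R)"
proof -
  let ?S = "image_ring f R"
  have cR: "cring R" using R by (simp add: local_ring_def)
  have cS: "cring ?S" by (rule cring_image_ring[OF cR f])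
  have rR: "ring R" and rS: "ring ?S" using cR cS by (auto simp add: cring_def)
  have h: "f \<in> ring_iso R ?S" by (rule inj_imp_image_ring_iso[OF f])
  let ?g = "inv_into (carrier R) f"
  have g: "?g \<in> ring_iso ?S R" by (rule ring_iso_set_sym[OF rR h])
  obtain M where M: "maximalideal M R" and uniq: "\<And>I. maximalideal I R \<Longrightarrow> I = M"
    using R unfolding local_ring_def by blast
  have "I = {s \<in> carrier ?S. ?g s \<in> M}" if I: "maximalideal I ?S" for I
  proof -
    have eq: "{r \<in> carrier R. f r \<in> I} = M"
      by (rule uniq[OF maximalideal_vimage[OF rR rS h I]])
    have "I \<subseteq> carrier ?S"
      using I by (meson additive_subgroup.a_subset ideal.axioms(1) maximalideal.axioms(1))
    then show ?thesis
      unfolding eq[symmetric] image_ring_carrier using f by (auto simp add: f_inv_into_f inv_into_into)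
  qed
  then show ?thesis
    unfolding local_ring_def using cS maximalideal_vimage[OF rS rR g M] by blast
qed

lemma RDirProd_list_image_ring:
  assumes "\<And>R. R \<in> set Rs \<Longrightarrow> inj_on (f R) (carrier R)"
  shows "RDirProd_list Rs \<simeq> RDirProd_list (map (\<lambda>R. image_ring (f R) R) Rs)"
  using assms
proof (induction Rs)
  case Nil
  have "(\<lambda>_. []) \<in> ring_iso nil_ring nil_ring"
    by (rule ring_iso_memI) (auto simp add: monoid.defs bij_betw_def)
  then show ?case
    unfolding is_ring_iso_def by auto
next
  case (Cons R Rs)
  let ?S = "image_ring (f R) R" and ?Ss = "map (\<lambda>R. image_ring (f R) R) Rs"
  have hd: "f R \<in> ring_iso R ?S"
    by (rule inj_imp_image_ring_iso) (use Cons.prems in simp)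
  obtain h where tl: "h \<in> ring_iso (RDirProd_list Rs) (RDirProd_list ?Ss)"
    using Cons unfolding is_ring_iso_def by auto
  have 1: "RDirProd_list (R # Rs) \<simeq> RDirProd R (RDirProd_list Rs)"
    using RDirProd_list_iso2 unfolding is_ring_iso_def by blast
  have 2: "RDirProd R (RDirProd_list Rs) \<simeq> RDirProd ?S (RDirProd_list ?Ss)"
    using RDirProd_iso6[OF hd tl] unfolding is_ring_iso_def by blast
  have 3: "RDirProd ?S (RDirProd_list ?Ss) \<simeq> RDirProd_list (?S # ?Ss)"
    using RDirProd_list_iso1 unfolding is_ring_iso_def by blast
  show ?case
    unfolding list.map by (rule ring_iso_trans[OF 1 ring_iso_trans[OF 2 3]])
qed

lemma product_of_local_ringsI:
  fixes B :: "('b, 'n) ring_scheme" and Rs :: "'c ring list"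
  assumes B: "ring B" and loc: "\<And>R. R \<in> set Rs \<Longrightarrow> local_ring R" and iso: "B \<simeq> RDirProd_list Rs"
  shows "product_of_local_rings B"
proof -
  have ring: "ring R" if "R \<in> set Rs" for R
    using loc[OF that] by (simp add: local_ring_def cring_def)
  obtain h where h: "h \<in> ring_iso B (RDirProd_list Rs)"
    using iso unfolding is_ring_iso_def by blast
  let ?g = "inv_into (carrier B) h"
  have "?g \<in> ring_iso (RDirProd_list Rs) B"
    by (rule ring_iso_set_sym[OF B h])
  then have g: "inj_on ?g (carrier (RDirProd_list Rs))"
    unfolding ring_iso_def bij_betw_def by blast
  have "\<exists>f :: 'c \<Rightarrow> 'b. inj_on f (carrier R)" if R: "R \<in> set Rs" for R
  proof -
    obtain i where i: "i < length Rs" "Rs ! i = R"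
      using R by (auto simp add: in_set_conv_nth)
    let ?e = "\<lambda>x. (map ring.zero Rs)[i := x]"
    have mem: "?e x \<in> carrier (RDirProd_list Rs)" if "x \<in> carrier R" for x
    proof (rule RDirProd_list_carrier_memI)
      fix j assume j: "j < length Rs"
      then have "\<zero>\<^bsub>Rs ! j\<^esub> \<in> carrier (Rs ! j)"
        by (intro ring.ring_simprules(2) ring) simp
      then show "?e x ! j \<in> carrier (Rs ! j)"
        using i that j by (cases "j = i") auto
    qed simp
    have "inj_on (\<lambda>x. ?g (?e x)) (carrier R)"
    proof (rule inj_onI)
      fix x y assume xy: "x \<in> carrier R" "y \<in> carrier R" "?g (?e x) = ?g (?e y)"
      then have "?e x = ?e y"
        using inj_onD[OF g xy(3)] mem by blast
      then show "x = y"
        using i by (metis length_map nth_list_update_eq)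
    qed
    then show ?thesis by blast
  qed
  then obtain f :: "'c ring \<Rightarrow> 'c \<Rightarrow> 'b" where f: "\<And>R. R \<in> set Rs \<Longrightarrow> inj_on (f R) (carrier R)"
    by metis
  have "B \<simeq> RDirProd_list (map (\<lambda>R. image_ring (f R) R) Rs)"
    by (rule ring_iso_trans[OF iso RDirProd_list_image_ring]) (rule f)
  moreover have "\<forall>S \<in> set (map (\<lambda>R. image_ring (f R) R) Rs). local_ring S"
    using local_ring_image_ring[OF loc f] by auto
  ultimately show ?thesis
    unfolding product_of_local_rings_def by blast
qed

definition image_algebra ::
  "('b \<Rightarrow> 'c) \<Rightarrow> ('a, 'b, 'n) module_scheme \<Rightarrow> ('a, 'c) module"
  where "image_algebra f B =
    ring.extend (image_ring f B) \<lparr> smult = (\<lambda>a x. f (a \<odot>\<^bsub>B\<^esub> inv_into (carrier B) f x)) \<rparr>"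

lemma image_algebra_simps [simp]:
  "carrier (image_algebra f B) = f ` carrier B"
  "monoid.mult (image_algebra f B) = monoid.mult (image_ring f B)"
  "ring.add (image_algebra f B) = ring.add (image_ring f B)"
  "\<zero>\<^bsub>image_algebra f B\<^esub> = f \<zero>\<^bsub>B\<^esub>"
  "\<one>\<^bsub>image_algebra f B\<^esub> = f \<one>\<^bsub>B\<^esub>"
  "module.smult (image_algebra f B) = (\<lambda>a x. f (a \<odot>\<^bsub>B\<^esub> inv_into (carrier B) f x))"
  by (simp_all add: image_algebra_def image_ring_def image_group_def ring.defs monoid.defs)

lemma image_algebra_iso:
  assumes "inj_on f (carrier B)"
  shows "f \<in> ring_iso B (image_algebra f B)"
  using inj_imp_image_ring_iso[OF assms]
  by (simp add: ring_iso_def ring_hom_def image_ring_carrier image_ring_one)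

lemma finite_algebra_image_algebra:
  fixes A :: "('a, 'm) ring_scheme" and B :: "('a, 'b, 'n) module_scheme" and f :: "'b \<Rightarrow> 'c"
  assumes B: "finite_algebra A B" and f: "inj_on f (carrier B)"
  shows "finite_algebra A (image_algebra f B)"
proof -
  let ?C = "image_algebra f B"
  interpret B: algebra A B using B by (simp add: finite_algebra_def)
  have iso: "f \<in> ring_iso B ?C" by (rule image_algebra_iso[OF f])
  have cC: "cring ?C"
    using cring.ring_iso_imp_img_cring[OF B.M_cring iso]
    by (simp add: image_algebra_def image_ring_def image_group_def ring.defs monoid.defs)
  have f_hom: "f x \<oplus>\<^bsub>?C\<^esub> f y = f (x \<oplus>\<^bsub>B\<^esub> y)" "f x \<otimes>\<^bsub>?C\<^esub> f y = f (x \<otimes>\<^bsub>B\<^esub> y)"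
    if "x \<in> carrier B" "y \<in> carrier B" for x y
    using ring_iso_memE(2,3)[OF iso that] by simp_all
  have f_smult: "a \<odot>\<^bsub>?C\<^esub> f x = f (a \<odot>\<^bsub>B\<^esub> x)" if "x \<in> carrier B" for a x
    using f that by simp
  have C_cases: "\<exists>y \<in> carrier B. x = f y" if "x \<in> carrier ?C" for x
    using that by auto
  have alg: "algebra A ?C"
  proof (rule algebraI[OF B.R_cring cC])
    fix a x assume "a \<in> carrier A" "x \<in> carrier ?C"
    then show "a \<odot>\<^bsub>?C\<^esub> x \<in> carrier ?C"
      using C_cases[of x] f_smult by auto
  next
    fix a b x assume ab: "a \<in> carrier A" "b \<in> carrier A" and x: "x \<in> carrier ?C"
    obtain y where y: "y \<in> carrier B" "x = f y" using C_cases[OF x] by blast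
    show "(a \<oplus>\<^bsub>A\<^esub> b) \<odot>\<^bsub>?C\<^esub> x = (a \<odot>\<^bsub>?C\<^esub> x) \<oplus>\<^bsub>?C\<^esub> (b \<odot>\<^bsub>?C\<^esub> x)"
      unfolding y(2) f_smult[OF y(1)] using ab y(1) by (subst f_hom) (simp_all add: B.smult_l_distr)
    show "(a \<otimes>\<^bsub>A\<^esub> b) \<odot>\<^bsub>?C\<^esub> x = a \<odot>\<^bsub>?C\<^esub> (b \<odot>\<^bsub>?C\<^esub> x)"
      unfolding y(2) f_smult[OF y(1)] using ab y(1)
      by (subst f_smult) (simp_all add: B.smult_assoc1)
  next
    fix a x z assume a: "a \<in> carrier A" and x: "x \<in> carrier ?C" and z: "z \<in> carrier ?C"
    obtain y where y: "y \<in> carrier B" "x = f y" using C_cases[OF x] by blast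
    obtain w where w: "w \<in> carrier B" "z = f w" using C_cases[OF z] by blast
    show "a \<odot>\<^bsub>?C\<^esub> (x \<oplus>\<^bsub>?C\<^esub> z) = (a \<odot>\<^bsub>?C\<^esub> x) \<oplus>\<^bsub>?C\<^esub> (a \<odot>\<^bsub>?C\<^esub> z)"
      unfolding y(2) w(2) f_smult[OF y(1)] f_smult[OF w(1)] f_hom(1)[OF y(1) w(1)]
      using a y(1) w(1) by (subst f_smult, simp, subst f_hom) (simp_all add: B.smult_r_distr)
    show "(a \<odot>\<^bsub>?C\<^esub> x) \<otimes>\<^bsub>?C\<^esub> z = a \<odot>\<^bsub>?C\<^esub> (x \<otimes>\<^bsub>?C\<^esub> z)"
      unfolding y(2) w(2) f_smult[OF y(1)] f_hom(2)[OF y(1) w(1)]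
      using a y(1) w(1) by (subst f_smult, simp, subst f_hom) (simp_all add: B.smult_assoc2)
  next
    fix x assume "x \<in> carrier ?C"
    then show "\<one>\<^bsub>A\<^esub> \<odot>\<^bsub>?C\<^esub> x = x"
      using C_cases[of x] f_smult by auto
  qed
  interpret C: algebra A ?C by (rule alg)
  interpret F: ring_hom_cring B ?C f
    by (rule ring_hom_cringI[OF B.M_cring cC]) (use iso in \<open>simp only: ring_iso_def mem_Collect_eq\<close>)
  obtain S where S: "finite S" "S \<subseteq> carrier B"
    "\<forall>b \<in> carrier B. \<exists>c \<in> S \<rightarrow> carrier A. b = (\<Oplus>\<^bsub>B\<^esub>s\<in>S. c s \<odot>\<^bsub>B\<^esub> s)"
    using B unfolding finite_algebra_def by blast
  have injS: "inj_on f S" using f S(2) by (rule inj_on_subset)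
  have "\<exists>c \<in> f ` S \<rightarrow> carrier A. x = (\<Oplus>\<^bsub>?C\<^esub>s\<in>f ` S. c s \<odot>\<^bsub>?C\<^esub> s)" if x: "x \<in> carrier ?C" for x
  proof -
    obtain y where y: "y \<in> carrier B" "x = f y" using C_cases[OF x] by blast
    obtain c where c: "c \<in> S \<rightarrow> carrier A" "y = (\<Oplus>\<^bsub>B\<^esub>s\<in>S. c s \<odot>\<^bsub>B\<^esub> s)"
      using S(3) y(1) by blast
    let ?d = "\<lambda>t. c (inv_into (carrier B) f t)"
    have inv: "inv_into (carrier B) f (f s) = s" if "s \<in> S" for s
      using f S(2) that by (auto intro: inv_into_f_f)
    have d: "?d \<in> f ` S \<rightarrow> carrier A"
      using c(1) inv by auto
    have dS: "?d (f s) \<odot>\<^bsub>?C\<^esub> f s = f (c s \<odot>\<^bsub>B\<^esub> s)" if "s \<in> S" for s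
      using inv[OF that] by simp
    have term_B: "(\<lambda>s. c s \<odot>\<^bsub>B\<^esub> s) \<in> S \<rightarrow> carrier B"
      using c(1) S(2) by auto
    have "x = (\<Oplus>\<^bsub>?C\<^esub>s\<in>S. f (c s \<odot>\<^bsub>B\<^esub> s))"
      using F.hom_finsum[OF term_B] unfolding y(2) c(2) by (simp add: comp_def del: image_algebra_simps)
    also have "\<dots> = (\<Oplus>\<^bsub>?C\<^esub>s\<in>S. ?d (f s) \<odot>\<^bsub>?C\<^esub> f s)"
      using term_B dS by (intro C.M.finsum_cong') (auto simp del: image_algebra_simps(6))
    also have "\<dots> = (\<Oplus>\<^bsub>?C\<^esub>t\<in>f ` S. ?d t \<odot>\<^bsub>?C\<^esub> t)"
    proof (rule C.M.finsum_reindex[symmetric, OF _ injS])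
      show "(\<lambda>t. ?d t \<odot>\<^bsub>?C\<^esub> t) \<in> f ` S \<rightarrow> carrier ?C"
        using d S(2) by (intro Pi_I C.smult_closed) auto
    qed
    finally show ?thesis using d by (intro bexI[of _ ?d])
  qed
  then have "\<forall>x \<in> carrier ?C. \<exists>c \<in> f ` S \<rightarrow> carrier A. x = (\<Oplus>\<^bsub>?C\<^esub>s\<in>f ` S. c s \<odot>\<^bsub>?C\<^esub> s)"
    by blast
  moreover have "finite (f ` S)" "f ` S \<subseteq> carrier ?C"
    using S by auto
  ultimately show ?thesis
    unfolding finite_algebra_def using alg by blast
qed

lemma finite_algebra_inj:
  fixes A :: "('a, 'm) ring_scheme" and B :: "('a, 'b, 'n) module_scheme"
  assumes "finite_algebra A B"
  shows "\<exists>f :: 'b \<Rightarrow> 'a list. inj_on f (carrier B)"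
proof -
  obtain S where S: "finite S" "S \<subseteq> carrier B"
    "\<forall>b \<in> carrier B. \<exists>c \<in> S \<rightarrow> carrier A. b = (\<Oplus>\<^bsub>B\<^esub>s\<in>S. c s \<odot>\<^bsub>B\<^esub> s)"
    using assms unfolding finite_algebra_def by blast
  interpret B: algebra A B using assms by (simp add: finite_algebra_def)
  obtain c where c: "\<And>b. b \<in> carrier B \<Longrightarrow> c b \<in> S \<rightarrow> carrier A"
    "\<And>b. b \<in> carrier B \<Longrightarrow> b = (\<Oplus>\<^bsub>B\<^esub>s\<in>S. c b s \<odot>\<^bsub>B\<^esub> s)"
    using S(3) by metis
  obtain xs where xs: "set xs = S" using finite_list[OF S(1)] by blast
  have "inj_on (\<lambda>b. map (c b) xs) (carrier B)"
  proof (rule inj_onI)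
    fix x y assume xy: "x \<in> carrier B" "y \<in> carrier B" "map (c x) xs = map (c y) xs"
    have "(\<Oplus>\<^bsub>B\<^esub>s\<in>S. c x s \<odot>\<^bsub>B\<^esub> s) = (\<Oplus>\<^bsub>B\<^esub>s\<in>S. c y s \<odot>\<^bsub>B\<^esub> s)"
    proof (rule B.M.finsum_cong')
      show "(\<lambda>s. c y s \<odot>\<^bsub>B\<^esub> s) \<in> S \<rightarrow> carrier B"
        using c(1)[OF xy(2)] S(2) by auto
    qed (use xy(3) xs in auto)
    then show "x = y" using c(2)[OF xy(1)] c(2)[OF xy(2)] by simp
  qed
  then show ?thesis by blast
qed

lemma henselian_finite_algebra:
  fixes A :: "('a, 'm) ring_scheme" and B :: "('a, 'b, 'n) module_scheme"
  assumes A: "henselian_local_ring A" and B: "finite_algebra A B"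
  shows "product_of_local_rings B"
proof -
  interpret B: algebra A B using B by (simp add: finite_algebra_def)
  obtain f :: "'b \<Rightarrow> 'a list" where f: "inj_on f (carrier B)"
    using finite_algebra_inj[OF B] by blast
  have "product_of_local_rings (image_algebra f B)"
    using A finite_algebra_image_algebra[OF B f] unfolding henselian_local_ring_def by blast
  then obtain Rs :: "'a list ring list"
    where Rs: "\<forall>R \<in> set Rs. local_ring R" "image_algebra f B \<simeq> RDirProd_list Rs"
    unfolding product_of_local_rings_def by blast
  have "B \<simeq> RDirProd_list Rs"
    using image_algebra_iso[OF f] Rs(2) ring_iso_trans unfolding is_ring_iso_def by blast
  then show ?thesis
    using product_of_local_ringsI[OF cring.axioms(1)[OF B.M_cring]] Rs(1) by blast
qed

end

theory Submission
  imports Defs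
begin

text \<open>
  Call a prime \<open>Q\<close> of \<open>A\<close> definable if its complement is positive-existential; the claim is that
  \<open>0\<close> is definable.

  A definable prime \<open>Q\<close> that is not maximal exists. If \<open>A\<close> has two maximal ideals \<open>M\<^sub>1\<close>, \<open>M\<^sub>2\<close>, call
  an ideal good if it contains some \<open>x y\<close> with \<open>x \<in> 1 + M\<^sub>1\<close> and \<open>y \<in> 1 + M\<^sub>2\<close>. If \<open>A\<close> is local with
  maximal ideal \<open>M\<close> and \<open>B\<close> is a finite algebra that is not a product of local rings, some idempotent
  \<open>e\<close> of \<open>B/MB\<close> does not lift to \<open>B\<close>; call \<open>I\<close> good if \<open>IB\<close> contains some \<open>x y\<close> with \<open>x\<close>, \<open>y\<close>
  lifting \<open>e\<close>, \<open>1 - e\<close>. In both cases \<open>0\<close> is not good, products of good ideals are good, and every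
  maximal ideal is good, so an ideal maximal among those that are not good is a definable prime
  that is not maximal.

  Now let \<open>J\<close> be maximal among the primes below \<open>Q\<close> that are not definable. In the domain \<open>D = A/J\<close>
  let \<open>P\<close> be a minimal prime over some nonzero element of \<open>Q/J\<close>; it is definable. Choose \<open>p\<close> outside
  \<open>P\<close> in a proper ideal and \<open>q \<noteq> 0\<close> in \<open>P\<close> such that \<open>q\<close> divides \<open>p\<close> at a minimal prime \<open>P'\<close> over
  \<open>p\<close>. For large \<open>N\<close> the form \<open>X^(N+1) - p X^N Z + q Z^(N+1)\<close> has no nontrivial zero in \<open>D\<close>, by a
  length computation at \<open>P'\<close>, while Hensel's iteration yields values in \<open>q^e D\<close> for all \<open>e\<close> with
  \<open>X\<close>, \<open>Z\<close> outside \<open>P\<close>. By Krull's principal ideal theorem, \<open>t \<noteq> 0\<close> divides such a value up to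
  a factor outside \<open>P\<close>. This defines \<open>t \<noteq> 0\<close> in \<open>D\<close>, so \<open>J\<close> is definable, a contradiction.
\<close>

section \<open>Polynomial functions and existential predicates\<close>

text \<open>Positive-existential sets admit conjunction and projection but no negation, so
  \<open>t \<noteq> 0\<close> needs a positive certificate: \<open>t\<close> must divide, up to
  harmless factors, something visibly nonzero. Values of a form without nontrivial zeros qualify,
  but every nonzero \<open>t\<close> has to divide one of them, so the form needs approximate zeros
  of every order and no exact one. Two primes share this work. Dehomogenised, the form is
  \<open>T^(N+1) - p T^N + q\<close>. Modulo \<open>P\<close> it has the root \<open>p\<close>,
  simple because the derivative there is \<open>p^N\<close>; this gives the approximations. At
  \<open>P'\<close> all lower coefficients are multiples of \<open>q\<close>, and a root would
  behave like that of an Eisenstein polynomial, more ramified than the length of \<open>D/q\<close>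
  permits. Since \<open>D\<close> need not be normal, lengths take the place of valuations. The
  element \<open>p\<close> is a nonunit outside \<open>P\<close>, so \<open>P\<close> must not be
  maximal; a nonmaximal definable prime is what the failure of Henselianity provides. The conditions
  "outside \<open>P\<close>" can enter a formula only if \<open>P\<close> is itself definable, which
  forces the descent along primes.\<close>

lemma nth_tuples [simp]: "t \<in> tuples A k \<Longrightarrow> i < k \<Longrightarrow> t ! i \<in> carrier A"
  by (auto simp: tuples_def)

lemma tuples_append: "t \<in> tuples A k \<Longrightarrow> x \<in> tuples A n \<Longrightarrow> t @ x \<in> tuples A (k + n)"
  by (auto simp: tuples_def)

lemma tuples_append_cases:
  assumes "x \<in> tuples A (m + n)"
  obtains y z where "y \<in> tuples A m" "z \<in> tuples A n" "x = y @ z"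
proof
  show "take m x \<in> tuples A m" "drop m x \<in> tuples A n" "x = take m x @ drop m x"
    using assms by (auto simp: tuples_def dest: in_set_takeD in_set_dropD)
qed

lemma bex_tuples_append:
  "(\<exists>z\<in>tuples A (m + n). P z) \<longleftrightarrow> (\<exists>x\<in>tuples A m. \<exists>y\<in>tuples A n. P (x @ y))"
proof
  assume "\<exists>z\<in>tuples A (m + n). P z"
  then obtain z where "z \<in> tuples A (m + n)" "P z" by blast
  then show "\<exists>x\<in>tuples A m. \<exists>y\<in>tuples A n. P (x @ y)"
    by (elim tuples_append_cases) blast
qed (use tuples_append in blast)

section \<open>Evaluation of polynomials, monomial by monomial\<close>

context cring
begin

definition monom_eval :: "'a list \<Rightarrow> nat multiset \<Rightarrow> 'a"
  where "monom_eval t m = (\<Otimes>i\<in>{..<length t}. (t ! i) [^] count m i)"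

lemma monom_eval_closed [simp]: "set t \<subseteq> carrier R \<Longrightarrow> monom_eval t m \<in> carrier R"
  unfolding monom_eval_def by (intro finprod_closed Pi_I nat_pow_closed) auto

lemma monom_eval_empty: "monom_eval t {#} = \<one>"
  unfolding monom_eval_def by (simp add: finprod_one_eqI)

lemma monom_eval_add_mset:
  assumes t: "set t \<subseteq> carrier R" and i: "i < length t"
  shows "monom_eval t (add_mset i m) = t ! i \<otimes> monom_eval t m"
proof -
  have ti: "t ! j \<in> carrier R" if "j < length t" for j
    using t that by auto
  have "monom_eval t (add_mset i m)
      = (\<Otimes>j\<in>{..<length t}. (if i = j then t ! j else \<one>) \<otimes> (t ! j) [^] count m j)"
    unfolding monom_eval_def
    by (rule finprod_cong') (use ti in \<open>auto simp: m_comm\<close>)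
  also have "\<dots> = (\<Otimes>j\<in>{..<length t}. if i = j then t ! j else \<one>) \<otimes> monom_eval t m"
    unfolding monom_eval_def by (rule finprod_multf) (use ti in auto)
  also have "(\<Otimes>j\<in>{..<length t}. if i = j then t ! j else \<one>) = t ! i"
    by (rule finprod_singleton) (use i ti in auto)
  finally show ?thesis .
qed

lemma mpolys_carrier: "F \<in> mpolys R k \<Longrightarrow> F m \<in> carrier R"
  unfolding mpolys_def by (rule carrier_coeffE[OF indexed_pset_in_carrier[OF subset_refl]])

lemma mpolys_finite_support: "F \<in> mpolys R k \<Longrightarrow> finite {m. F m \<noteq> \<zero>}"
  unfolding mpolys_def
proof (induction rule: indexed_pset.induct)
  case (indexed_const k)
  show ?case by (rule finite_subset[of _ "{{#}}"]) (auto simp: indexed_const_def)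
next
  case (indexed_padd P Q)
  show ?case
    by (rule finite_subset[of _ "{m. P m \<noteq> \<zero>} \<union> {m. Q m \<noteq> \<zero>}"])
      (use indexed_padd.IH in \<open>auto simp: indexed_padd_def\<close>)
next
  case (indexed_pmult P i)
  show ?case
  proof (rule finite_subset)
    show "{m. (P \<Otimes> i) m \<noteq> \<zero>} \<subseteq> add_mset i ` {m. P m \<noteq> \<zero>}"
    proof
      fix m assume "m \<in> {m. (P \<Otimes> i) m \<noteq> \<zero>}"
      then have "i \<in># m" "P (m - {#i#}) \<noteq> \<zero>"
        by (auto simp: indexed_pmult_def split: if_splits)
      then show "m \<in> add_mset i ` {m. P m \<noteq> \<zero>}"
        by (intro image_eqI[of _ _ "m - {#i#}"]) auto
    qed
  qed (use indexed_pmult.IH in auto)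
qed

text \<open>Terms outside the support vanish. Summing over a larger finite set allows two
  polynomials with different supports to be compared term by term.\<close>

lemma mpoly_eval_superset:
  assumes "F \<in> mpolys R k" "t \<in> tuples R n" "finite M" "{m. F m \<noteq> \<zero>} \<subseteq> M"
  shows "mpoly_eval R F t = (\<Oplus>m\<in>M. F m \<otimes> monom_eval t m)"
proof -
  have t: "set t \<subseteq> carrier R"
    using assms(2) by (simp add: tuples_def)
  show ?thesis
    unfolding mpoly_eval_def monom_eval_def[symmetric]
    by (rule add.finprod_mono_neutral_cong_left)
      (use assms(3,4) t mpolys_carrier[OF assms(1)] in auto)
qed

lemma mpoly_eval_closed:
  assumes "F \<in> mpolys R k" "t \<in> tuples R n"
  shows "mpoly_eval R F t \<in> carrier R"
proof -
  have t: "set t \<subseteq> carrier R"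
    using assms(2) by (simp add: tuples_def)
  show ?thesis
    unfolding mpoly_eval_def monom_eval_def[symmetric]
    using t mpolys_carrier[OF assms(1)] by (intro finsum_closed) auto
qed

lemma mpoly_eval_const:
  assumes "c \<in> carrier R" "t \<in> tuples R n"
  shows "mpoly_eval R (indexed_const c) t = c"
proof -
  have "indexed_const c \<in> mpolys R 0"
    unfolding mpolys_def using assms(1) by (rule indexed_pset.indexed_const)
  then have "mpoly_eval R (indexed_const c) t = (\<Oplus>m\<in>{{#}}. indexed_const c m \<otimes> monom_eval t m)"
    by (rule mpoly_eval_superset[OF _ assms(2)]) (auto simp: indexed_const_def)
  also have "\<dots> = c"
    using assms by (simp add: monom_eval_empty indexed_const_def)
  finally show ?thesis .
qed

lemma mpoly_eval_padd:
  assumes "F \<in> mpolys R k" "G \<in> mpolys R k" "t \<in> tuples R n"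
  shows "mpoly_eval R (indexed_padd F G) t = mpoly_eval R F t \<oplus> mpoly_eval R G t"
proof -
  let ?M = "{m. F m \<noteq> \<zero>} \<union> {m. G m \<noteq> \<zero>}"
  have fin: "finite ?M"
    using assms(1,2) mpolys_finite_support by blast
  have FG: "indexed_padd F G \<in> mpolys R k"
    using assms(1,2) unfolding mpolys_def by (rule indexed_pset.indexed_padd)
  have t: "set t \<subseteq> carrier R"
    using assms(3) by (simp add: tuples_def)
  note c = mpolys_carrier[OF assms(1)] mpolys_carrier[OF assms(2)] monom_eval_closed[OF t]
  have "mpoly_eval R (indexed_padd F G) t = (\<Oplus>m\<in>?M. indexed_padd F G m \<otimes> monom_eval t m)"
    by (rule mpoly_eval_superset[OF FG assms(3) fin]) (auto simp: indexed_padd_def)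
  also have "\<dots> = (\<Oplus>m\<in>?M. F m \<otimes> monom_eval t m \<oplus> G m \<otimes> monom_eval t m)"
    by (rule finsum_cong') (use c in \<open>auto simp: indexed_padd_def l_distr\<close>)
  also have "\<dots> = (\<Oplus>m\<in>?M. F m \<otimes> monom_eval t m) \<oplus> (\<Oplus>m\<in>?M. G m \<otimes> monom_eval t m)"
    by (rule finsum_addf) (use c in auto)
  also have "\<dots> = mpoly_eval R F t \<oplus> mpoly_eval R G t"
    using mpoly_eval_superset[OF assms(1,3) fin] mpoly_eval_superset[OF assms(2,3) fin] by auto
  finally show ?thesis .
qed

text \<open>Multiplication by the variable \<open>i\<close> moves the coefficient at
  \<open>m\<close> to \<open>add_mset i m\<close>, so the sum is reindexed along this injective
  map.\<close>

lemma mpoly_eval_pmult: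
  assumes "F \<in> mpolys R k" "i < k" "t \<in> tuples R k"
  shows "mpoly_eval R (indexed_pmult F i) t = t ! i \<otimes> mpoly_eval R F t"
proof -
  let ?M = "{m. F m \<noteq> \<zero>}"
  have fin: "finite ?M"
    using assms(1) by (rule mpolys_finite_support)
  have Fi: "indexed_pmult F i \<in> mpolys R k"
    using assms(1,2) unfolding mpolys_def by (intro indexed_pset.indexed_pmult) auto
  have t: "set t \<subseteq> carrier R" and i: "i < length t"
    using assms(2,3) by (auto simp add: tuples_def)
  note c = mpolys_carrier[OF assms(1)] monom_eval_closed[OF t] nth_tuples[OF assms(3,2)]
  have "mpoly_eval R (indexed_pmult F i) t
      = (\<Oplus>m\<in>add_mset i ` ?M. indexed_pmult F i m \<otimes> monom_eval t m)"
  proof (rule mpoly_eval_superset[OF Fi assms(3)])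
    show "{m. (F \<Otimes> i) m \<noteq> \<zero>} \<subseteq> add_mset i ` ?M"
    proof
      fix m assume "m \<in> {m. (F \<Otimes> i) m \<noteq> \<zero>}"
      then have "i \<in># m" "F (m - {#i#}) \<noteq> \<zero>"
        by (auto simp: indexed_pmult_def split: if_splits)
      then show "m \<in> add_mset i ` ?M"
        by (intro image_eqI[of _ _ "m - {#i#}"]) auto
    qed
  qed (use fin in auto)
  also have "\<dots> = (\<Oplus>m\<in>?M. indexed_pmult F i (add_mset i m) \<otimes> monom_eval t (add_mset i m))"
    by (rule add.finprod_reindex) (use c in \<open>auto simp: indexed_pmult_def inj_on_def\<close>)
  also have "\<dots> = (\<Oplus>m\<in>?M. t ! i \<otimes> (F m \<otimes> monom_eval t m))"
    by (rule finsum_cong')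
      (use c in \<open>auto simp: indexed_pmult_def monom_eval_add_mset[OF t i] m_lcomm\<close>)
  also have "\<dots> = t ! i \<otimes> (\<Oplus>m\<in>?M. F m \<otimes> monom_eval t m)"
    by (rule finsum_rdistr[symmetric]) (use c fin in auto)
  also have "\<dots> = t ! i \<otimes> mpoly_eval R F t"
    using mpoly_eval_superset[OF assms(1,3) fin] by simp
  finally show ?thesis .
qed

section \<open>Polynomial functions and their closure properties\<close>

definition polyfun :: "nat \<Rightarrow> ('a list \<Rightarrow> 'a) \<Rightarrow> bool"
  where "polyfun k \<phi> \<longleftrightarrow> (\<exists>F \<in> mpolys R k. \<forall>t \<in> tuples R k. \<phi> t = mpoly_eval R F t)"

lemma polyfun_mpoly: "F \<in> mpolys R k \<Longrightarrow> polyfun k (mpoly_eval R F)"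
  unfolding polyfun_def by blast

lemma polyfun_closed: "polyfun k \<phi> \<Longrightarrow> t \<in> tuples R k \<Longrightarrow> \<phi> t \<in> carrier R"
  unfolding polyfun_def using mpoly_eval_closed by auto

lemma polyfun_cong:
  "polyfun k \<phi> \<Longrightarrow> (\<And>t. t \<in> tuples R k \<Longrightarrow> \<psi> t = \<phi> t) \<Longrightarrow> polyfun k \<psi>"
  unfolding polyfun_def by auto

lemma polyfun_const: "c \<in> carrier R \<Longrightarrow> polyfun k (\<lambda>_. c)"
  unfolding polyfun_def
  by (rule bexI[of _ "indexed_const c"])
    (auto simp: mpoly_eval_const mpolys_def intro: indexed_pset.indexed_const)

lemma polyfun_add:
  assumes "polyfun k \<phi>" "polyfun k \<psi>"
  shows "polyfun k (\<lambda>t. \<phi> t \<oplus> \<psi> t)"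
proof -
  obtain F G where "F \<in> mpolys R k" "G \<in> mpolys R k"
    "\<forall>t \<in> tuples R k. \<phi> t = mpoly_eval R F t" "\<forall>t \<in> tuples R k. \<psi> t = mpoly_eval R G t"
    using assms unfolding polyfun_def by blast
  then show ?thesis
    unfolding polyfun_def
    by (intro bexI[of _ "indexed_padd F G"])
      (auto simp: mpoly_eval_padd, auto simp: mpolys_def intro: indexed_pset.indexed_padd)
qed

lemma polyfun_nth_mult:
  assumes "polyfun k \<phi>" "i < k"
  shows "polyfun k (\<lambda>t. t ! i \<otimes> \<phi> t)"
proof -
  obtain F where "F \<in> mpolys R k" "\<forall>t \<in> tuples R k. \<phi> t = mpoly_eval R F t"
    using assms unfolding polyfun_def by blast
  then show ?thesis
    unfolding polyfun_def using assms(2)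
    by (intro bexI[of _ "indexed_pmult F i"])
      (auto simp: mpoly_eval_pmult, auto simp: mpolys_def intro: indexed_pset.indexed_pmult)
qed

lemma polyfun_nth:
  assumes "i < k"
  shows "polyfun k (\<lambda>t. t ! i)"
  by (rule polyfun_cong[OF polyfun_nth_mult[OF polyfun_const[OF one_closed] assms]])
    (use assms in simp)

text \<open>The induction principle of \<open>indexed_pset\<close>, transported from polynomials to
  functions. The case \<open>cong\<close> is there because the values of a polynomial function are
  prescribed on \<open>tuples R k\<close> only.\<close>

lemma polyfun_induct [consumes 1, case_names cong const add nth_mult]:
  assumes "polyfun k \<phi>"
    and cong: "\<And>\<phi> \<psi>. P \<phi> \<Longrightarrow> (\<And>t. t \<in> tuples R k \<Longrightarrow> \<psi> t = \<phi> t) \<Longrightarrow> P \<psi>"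
    and const: "\<And>c. c \<in> carrier R \<Longrightarrow> P (\<lambda>_. c)"
    and add: "\<And>\<phi> \<psi>. polyfun k \<phi> \<Longrightarrow> polyfun k \<psi> \<Longrightarrow> P \<phi> \<Longrightarrow> P \<psi> \<Longrightarrow> P (\<lambda>t. \<phi> t \<oplus> \<psi> t)"
    and nth_mult: "\<And>\<phi> i. polyfun k \<phi> \<Longrightarrow> P \<phi> \<Longrightarrow> i < k \<Longrightarrow> P (\<lambda>t. t ! i \<otimes> \<phi> t)"
  shows "P \<phi>"
proof -
  have "P (mpoly_eval R F)" if "F \<in> mpolys R k" for F
    using that unfolding mpolys_def
  proof (induction rule: indexed_pset.induct)
    case (indexed_const c)
    show ?case
      by (rule cong[OF const[OF indexed_const(1)]]) (rule mpoly_eval_const[OF indexed_const(1)])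
  next
    case (indexed_padd F G)
    then have FG: "F \<in> mpolys R k" "G \<in> mpolys R k"
      by (auto simp: mpolys_def)
    show ?case
      by (rule cong[OF add[OF FG[THEN polyfun_mpoly] indexed_padd.IH]]) (rule mpoly_eval_padd[OF FG])
  next
    case (indexed_pmult F i)
    then have F: "F \<in> mpolys R k" "i < k"
      by (auto simp: mpolys_def)
    show ?case
      by (rule cong[OF nth_mult[OF F(1)[THEN polyfun_mpoly] indexed_pmult.IH F(2)]])
        (rule mpoly_eval_pmult[OF F])
  qed
  moreover obtain F where F: "F \<in> mpolys R k" "\<And>t. t \<in> tuples R k \<Longrightarrow> \<phi> t = mpoly_eval R F t"
    using assms(1) unfolding polyfun_def by auto
  ultimately show ?thesis
    using cong[of "mpoly_eval R F" \<phi>] by simp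
qed

text \<open>The constructors only multiply by single variables. A general product is reached by two
  inductions: one on the second factor for a constant first factor, and one on the first
  factor.\<close>

lemma polyfun_mult:
  assumes "polyfun k \<phi>" "polyfun k \<psi>"
  shows "polyfun k (\<lambda>t. \<phi> t \<otimes> \<psi> t)"
proof -
  have smult: "polyfun k (\<lambda>t. c \<otimes> \<chi> t)" if "polyfun k \<chi>" "c \<in> carrier R" for c \<chi>
    using that(1)
  proof (induction rule: polyfun_induct)
    case (cong \<phi> \<psi>)
    show ?case by (rule polyfun_cong[OF cong.IH]) (use cong.hyps in auto)
  next
    case (const d)
    then show ?case using that(2) by (auto intro: polyfun_const)
  next
    case (add \<phi> \<psi>)
    show ?case
      by (rule polyfun_cong[OF polyfun_add[OF add.IH]])
        (use that(2) add.hyps in \<open>auto simp: r_distr polyfun_closed\<close>)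
  next
    case (nth_mult \<phi> i)
    show ?case
      by (rule polyfun_cong[OF polyfun_nth_mult[OF nth_mult.IH nth_mult.hyps(2)]])
        (use that(2) nth_mult.hyps in \<open>auto simp: m_lcomm polyfun_closed\<close>)
  qed
  show ?thesis
    using assms(1)
  proof (induction rule: polyfun_induct)
    case (cong \<phi> \<psi>)
    show ?case by (rule polyfun_cong[OF cong.IH]) (use cong.hyps in auto)
  next
    case (const c)
    then show ?case by (rule smult[OF assms(2)])
  next
    case (add \<phi> \<phi>')
    show ?case
      by (rule polyfun_cong[OF polyfun_add[OF add.IH]])
        (use assms(2) add.hyps in \<open>auto simp: l_distr polyfun_closed\<close>)
  next
    case (nth_mult \<phi> i)
    show ?case
      by (rule polyfun_cong[OF polyfun_nth_mult[OF nth_mult.IH nth_mult.hyps(2)]])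
        (use assms(2) nth_mult.hyps in \<open>auto simp: m_assoc polyfun_closed\<close>)
  qed
qed

lemma polyfun_minus:
  assumes "polyfun k \<phi>" "polyfun k \<psi>"
  shows "polyfun k (\<lambda>t. \<phi> t \<ominus> \<psi> t)"
  by (rule polyfun_cong[OF polyfun_add[OF assms(1) polyfun_mult[OF polyfun_const[of "\<ominus> \<one>"] assms(2)]]])
    (use assms in \<open>auto simp: polyfun_closed a_minus_def l_minus\<close>)

lemma polyfun_nat_pow:
  fixes n :: nat
  assumes "polyfun k \<phi>"
  shows "polyfun k (\<lambda>t. \<phi> t [^] n)"
  by (induction n) (auto intro: polyfun_mult polyfun_const assms)

lemma polyfun_subst:
  assumes "polyfun k \<phi>" "length \<psi>s = k" "\<And>\<psi>. \<psi> \<in> set \<psi>s \<Longrightarrow> polyfun r \<psi>"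
  shows "polyfun r (\<lambda>t. \<phi> (map (\<lambda>\<psi>. \<psi> t) \<psi>s))"
  using assms(1)
proof (induction rule: polyfun_induct)
  case (cong \<phi> \<phi>')
  have "map (\<lambda>\<psi>. \<psi> t) \<psi>s \<in> tuples R k" if "t \<in> tuples R r" for t
    using assms(2,3) that polyfun_closed by (auto simp: tuples_def)
  then show ?case by (intro polyfun_cong[OF cong.IH]) (use cong.hyps in auto)
next
  case (const c)
  then show ?case by (rule polyfun_const)
next
  case (add \<phi> \<phi>')
  show ?case by (rule polyfun_add[OF add.IH])
next
  case (nth_mult \<phi> i)
  show ?case
    by (rule polyfun_cong[OF polyfun_mult[OF assms(3)[of "\<psi>s ! i"] nth_mult.IH]])
      (use nth_mult.hyps assms(2) in auto)
qed

section \<open>Predicates cut out by a single projected system of equations\<close>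

definition pe :: "nat \<Rightarrow> ('a list \<Rightarrow> bool) \<Rightarrow> bool"
  where "pe r P \<longleftrightarrow> (\<exists>n \<Phi>. finite \<Phi> \<and> (\<forall>\<phi>\<in>\<Phi>. polyfun (r + n) \<phi>) \<and>
    (\<forall>t \<in> tuples R r. P t \<longleftrightarrow> (\<exists>x \<in> tuples R n. \<forall>\<phi>\<in>\<Phi>. \<phi> (t @ x) = \<zero>)))"

lemma peE:
  assumes "pe r P"
  obtains n \<Phi> where "finite \<Phi>" "\<And>\<phi>. \<phi> \<in> \<Phi> \<Longrightarrow> polyfun (r + n) \<phi>"
    "\<And>t. t \<in> tuples R r \<Longrightarrow> P t \<longleftrightarrow> (\<exists>x \<in> tuples R n. \<forall>\<phi>\<in>\<Phi>. \<phi> (t @ x) = \<zero>)"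
  using assms unfolding pe_def by (elim exE conjE) (rule that, auto)

lemma pe_cong: "pe r P \<Longrightarrow> (\<And>t. t \<in> tuples R r \<Longrightarrow> Q t \<longleftrightarrow> P t) \<Longrightarrow> pe r Q"
  unfolding pe_def by auto

lemma pe_eq:
  assumes "polyfun r \<phi>" "polyfun r \<psi>"
  shows "pe r (\<lambda>t. \<phi> t = \<psi> t)"
  unfolding pe_def
proof (intro exI[of _ 0] exI[of _ "{\<lambda>t. \<phi> t \<ominus> \<psi> t}"] conjI ballI)
  show "polyfun (r + 0) \<chi>" if "\<chi> \<in> {\<lambda>t. \<phi> t \<ominus> \<psi> t}" for \<chi>
    using that assms polyfun_minus by auto
qed (use assms in \<open>auto simp: tuples_def polyfun_closed r_right_minus_eq\<close>)

text \<open>The witnesses travel along as additional coordinates: \<open>?ts\<close> consists of the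
  given functions, read from the first \<open>r\<close> entries, followed by the projections to the
  last \<open>n\<close> entries.\<close>

lemma pe_subst:
  assumes "pe k P" "length \<psi>s = k" "\<And>\<psi>. \<psi> \<in> set \<psi>s \<Longrightarrow> polyfun r \<psi>"
  shows "pe r (\<lambda>t. P (map (\<lambda>\<psi>. \<psi> t) \<psi>s))"
proof -
  obtain n \<Phi> where \<Phi>: "finite \<Phi>" "\<And>\<phi>. \<phi> \<in> \<Phi> \<Longrightarrow> polyfun (k + n) \<phi>"
    "\<And>t. t \<in> tuples R k \<Longrightarrow> P t \<longleftrightarrow> (\<exists>x \<in> tuples R n. \<forall>\<phi>\<in>\<Phi>. \<phi> (t @ x) = \<zero>)"
    using peE[OF assms(1)] by metis
  let ?ts = "map (\<lambda>\<psi> t. \<psi> (take r t)) \<psi>s @ map (\<lambda>i t. t ! i) [r..<r + n]"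
  have take: "polyfun (r + n) (\<lambda>t. \<psi> (take r t))" if "polyfun r \<psi>" for \<psi>
  proof (rule polyfun_cong[OF polyfun_subst[OF that, of "map (\<lambda>i t. t ! i) [0..<r]" "r + n"]])
    show "polyfun (r + n) \<chi>" if "\<chi> \<in> set (map (\<lambda>i t. t ! i) [0..<r])" for \<chi>
      using that by (auto intro: polyfun_nth)
    show "\<psi> (take r t) = \<psi> (map (\<lambda>\<psi>. \<psi> t) (map (\<lambda>i t. t ! i) [0..<r]))"
      if "t \<in> tuples R (r + n)" for t
      using that by (intro arg_cong[of _ _ \<psi>] nth_equalityI) (auto simp: tuples_def)
  qed simp
  have ev: "map (\<lambda>\<psi>. \<psi> (t @ x)) ?ts = map (\<lambda>\<psi>. \<psi> t) \<psi>s @ x"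
    if "t \<in> tuples R r" "x \<in> tuples R n" for t x
    using that by (intro nth_equalityI) (auto simp: tuples_def nth_append)
  have mem: "map (\<lambda>\<psi>. \<psi> t) \<psi>s \<in> tuples R k" if "t \<in> tuples R r" for t
    using assms(2,3) that polyfun_closed by (auto simp: tuples_def)
  show ?thesis
    unfolding pe_def
  proof (intro exI[of _ n] exI[of _ "(\<lambda>\<phi> t. \<phi> (map (\<lambda>\<psi>. \<psi> t) ?ts)) ` \<Phi>"] conjI ballI)
    fix \<chi> assume "\<chi> \<in> (\<lambda>\<phi> t. \<phi> (map (\<lambda>\<psi>. \<psi> t) ?ts)) ` \<Phi>"
    then obtain \<phi> where \<phi>: "\<phi> \<in> \<Phi>" "\<chi> = (\<lambda>t. \<phi> (map (\<lambda>\<psi>. \<psi> t) ?ts))" by blast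
    show "polyfun (r + n) \<chi>"
      unfolding \<phi>(2)
      by (rule polyfun_subst[OF \<Phi>(2)[OF \<phi>(1)]])
        (use assms(2,3) take in \<open>auto intro: polyfun_nth\<close>)
  next
    fix t assume t: "t \<in> tuples R r"
    show "P (map (\<lambda>\<psi>. \<psi> t) \<psi>s) =
      (\<exists>x\<in>tuples R n. \<forall>\<phi>\<in>(\<lambda>\<phi> t. \<phi> (map (\<lambda>\<psi>. \<psi> t) ?ts)) ` \<Phi>. \<phi> (t @ x) = \<zero>)"
      unfolding \<Phi>(3)[OF mem[OF t]] by (intro bex_cong refl) (simp only: ball_simps ev[OF t])
  qed (use \<Phi>(1) in simp)
qed

lemma pe_reindex:
  assumes "pe k P" "length is = k" "set is \<subseteq> {..<r}"
  shows "pe r (\<lambda>t. P (map ((!) t) is))"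
proof -
  have "polyfun r \<psi>" if "\<psi> \<in> set (map (\<lambda>i t. t ! i) is)" for \<psi>
    using that assms(3) by (auto intro: polyfun_nth)
  then show ?thesis
    using pe_subst[OF assms(1), of "map (\<lambda>i t. t ! i) is" r] assms(2) by (simp add: comp_def)
qed

text \<open>The two predicates need independent witnesses, so both are stored in one tuple
  \<open>t @ x @ y\<close>; the index lists \<open>?is\<close> and \<open>?js\<close> recover
  \<open>t @ x\<close> and \<open>t @ y\<close>.\<close>

lemma pe_conj:
  assumes "pe r P" "pe r Q"
  shows "pe r (\<lambda>t. P t \<and> Q t)"
proof -
  obtain m \<Phi> where \<Phi>: "finite \<Phi>" "\<And>\<phi>. \<phi> \<in> \<Phi> \<Longrightarrow> polyfun (r + m) \<phi>"
    "\<And>t. t \<in> tuples R r \<Longrightarrow> P t \<longleftrightarrow> (\<exists>x \<in> tuples R m. \<forall>\<phi>\<in>\<Phi>. \<phi> (t @ x) = \<zero>)"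
    using peE[OF assms(1)] by metis
  obtain n \<Psi> where \<Psi>: "finite \<Psi>" "\<And>\<phi>. \<phi> \<in> \<Psi> \<Longrightarrow> polyfun (r + n) \<phi>"
    "\<And>t. t \<in> tuples R r \<Longrightarrow> Q t \<longleftrightarrow> (\<exists>x \<in> tuples R n. \<forall>\<phi>\<in>\<Psi>. \<phi> (t @ x) = \<zero>)"
    using peE[OF assms(2)] by metis
  let ?is = "[0..<r + m]" and ?js = "[0..<r] @ [r + m..<r + (m + n)]"
  have pf: "polyfun (r + (m + n)) (\<lambda>t. \<phi> (map ((!) t) is))"
    if "polyfun l \<phi>" "length is = l" "set is \<subseteq> {..<r + (m + n)}" for \<phi> "is" l
  proof -
    have "polyfun (r + (m + n)) \<psi>" if "\<psi> \<in> set (map (\<lambda>i t. t ! i) is)" for \<psi>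
      using that \<open>set is \<subseteq> _\<close> by (auto intro: polyfun_nth)
    then show ?thesis
      using polyfun_subst[OF that(1), of "map (\<lambda>i t. t ! i) is" "r + (m + n)"] that(2)
      by (simp add: comp_def)
  qed
  have ev: "map ((!) (t @ x @ y)) ?is = t @ x" "map ((!) (t @ x @ y)) ?js = t @ y"
    if "t \<in> tuples R r" "x \<in> tuples R m" "y \<in> tuples R n" for t x y
    using that by (auto intro!: nth_equalityI simp: tuples_def nth_append)
  let ?\<Xi> = "(\<lambda>\<phi> t. \<phi> (map ((!) t) ?is)) ` \<Phi> \<union> (\<lambda>\<phi> t. \<phi> (map ((!) t) ?js)) ` \<Psi>"
  show ?thesis
    unfolding pe_def
  proof (intro exI[of _ "m + n"] exI[of _ ?\<Xi>] conjI ballI)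
    have "set ?is \<subseteq> {..<r + (m + n)}" "set ?js \<subseteq> {..<r + (m + n)}" "length ?is = r + m" "length ?js = r + n"
      by auto
    then show "polyfun (r + (m + n)) \<chi>" if "\<chi> \<in> ?\<Xi>" for \<chi>
      using that pf[OF \<Phi>(2), of _ ?is] pf[OF \<Psi>(2), of _ ?js] by blast
  next
    fix t assume t: "t \<in> tuples R r"
    have "(\<exists>z\<in>tuples R (m + n). \<forall>\<chi>\<in>?\<Xi>. \<chi> (t @ z) = \<zero>) \<longleftrightarrow>
      (\<exists>x\<in>tuples R m. \<exists>y\<in>tuples R n. \<forall>\<chi>\<in>?\<Xi>. \<chi> (t @ x @ y) = \<zero>)"
      by (rule bex_tuples_append)
    also have "\<dots> \<longleftrightarrow> (\<exists>x\<in>tuples R m. \<exists>y\<in>tuples R n.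
      (\<forall>\<phi>\<in>\<Phi>. \<phi> (t @ x) = \<zero>) \<and> (\<forall>\<phi>\<in>\<Psi>. \<phi> (t @ y) = \<zero>))"
      by (intro bex_cong refl) (simp only: ball_Un ball_simps ev[OF t])
    also have "\<dots> \<longleftrightarrow> P t \<and> Q t"
      unfolding \<Phi>(3)[OF t] \<Psi>(3)[OF t] by (simp only: bex_simps)
    finally show "(P t \<and> Q t) = (\<exists>z\<in>tuples R (m + n). \<forall>\<chi>\<in>?\<Xi>. \<chi> (t @ z) = \<zero>)" ..
  qed (use \<Phi>(1) \<Psi>(1) in simp)
qed

lemma pe_ex:
  assumes "pe (r + n) P"
  shows "pe r (\<lambda>t. \<exists>x\<in>tuples R n. P (t @ x))"
proof -
  obtain m \<Phi> where \<Phi>: "finite \<Phi>" "\<And>\<phi>. \<phi> \<in> \<Phi> \<Longrightarrow> polyfun (r + n + m) \<phi>"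
    "\<And>t. t \<in> tuples R (r + n) \<Longrightarrow> P t \<longleftrightarrow> (\<exists>x \<in> tuples R m. \<forall>\<phi>\<in>\<Phi>. \<phi> (t @ x) = \<zero>)"
    using peE[OF assms] by metis
  show ?thesis
    unfolding pe_def
  proof (intro exI[of _ "n + m"] exI[of _ \<Phi>] conjI ballI)
    fix t assume t: "t \<in> tuples R r"
    have "(\<exists>x\<in>tuples R n. P (t @ x)) \<longleftrightarrow>
      (\<exists>x\<in>tuples R n. \<exists>y \<in> tuples R m. \<forall>\<phi>\<in>\<Phi>. \<phi> (t @ x @ y) = \<zero>)"
      by (intro bex_cong refl) (simp only: \<Phi>(3)[OF tuples_append[OF t]] append_assoc)
    also have "\<dots> \<longleftrightarrow> (\<exists>z\<in>tuples R (n + m). \<forall>\<phi>\<in>\<Phi>. \<phi> (t @ z) = \<zero>)"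
      by (rule bex_tuples_append[symmetric])
    finally show "(\<exists>x\<in>tuples R n. P (t @ x)) \<longleftrightarrow> (\<exists>z\<in>tuples R (n + m). \<forall>\<phi>\<in>\<Phi>. \<phi> (t @ z) = \<zero>)" .
  qed (use \<Phi> in \<open>auto simp: add.assoc\<close>)
qed

lemma pe_True: "pe r (\<lambda>t. True)"
  unfolding pe_def by (intro exI[of _ 0] exI[of _ "{}"]) (auto simp: tuples_def)

lemma pe_imp_condition_C:
  assumes "pe 1 (\<lambda>t. t ! 0 \<noteq> \<zero>)"
  shows "condition_C R"
proof -
  obtain n \<Phi> where \<Phi>: "finite \<Phi>" "\<And>\<phi>. \<phi> \<in> \<Phi> \<Longrightarrow> polyfun (1 + n) \<phi>"
    "\<And>t. t \<in> tuples R 1 \<Longrightarrow> t ! 0 \<noteq> \<zero> \<longleftrightarrow> (\<exists>x \<in> tuples R n. \<forall>\<phi>\<in>\<Phi>. \<phi> (t @ x) = \<zero>)"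
    using peE[OF assms] by metis
  obtain F where F: "\<And>\<phi>. \<phi> \<in> \<Phi> \<Longrightarrow> F \<phi> \<in> mpolys R (1 + n)"
    "\<And>\<phi> t. \<phi> \<in> \<Phi> \<Longrightarrow> t \<in> tuples R (1 + n) \<Longrightarrow> \<phi> t = mpoly_eval R (F \<phi>) t"
    using \<Phi>(2) unfolding polyfun_def by metis
  obtain Fs where Fs: "set Fs = F ` \<Phi>"
    using finite_list[of "F ` \<Phi>"] \<Phi>(1) by auto
  have "(\<lambda>a. [a]) ` (carrier R - {\<zero>}) = {t \<in> tuples R 1. t ! 0 \<noteq> \<zero>}"
    by (force simp: tuples_def image_iff length_Suc_conv)
  also have "\<dots> = pos_exist_basic R 1 n Fs"
    unfolding pos_exist_basic_def
  proof (rule Collect_cong, rule conj_cong[OF refl])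
    fix t assume t: "t \<in> tuples R 1"
    have "(\<forall>\<phi>\<in>\<Phi>. \<phi> (t @ x) = \<zero>) \<longleftrightarrow> (\<forall>\<phi>\<in>\<Phi>. mpoly_eval R (F \<phi>) (t @ x) = \<zero>)"
      if "x \<in> tuples R n" for x
      using F(2)[OF _ tuples_append[OF t that]] by (intro ball_cong refl) simp
    then show "t ! 0 \<noteq> \<zero> \<longleftrightarrow> (\<exists>x\<in>tuples R n. \<forall>F\<in>set Fs. mpoly_eval R F (t @ x) = \<zero>)"
      unfolding \<Phi>(3)[OF t] Fs by (intro bex_cong refl) (simp only: ball_simps)
  qed
  finally have "(\<lambda>a. [a]) ` (carrier R - {\<zero>}) = \<Union>{pos_exist_basic R 1 n Fs}"
    by simp
  moreover have "set Fs \<subseteq> mpolys R (1 + n)"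
    using Fs F(1) by auto
  ultimately show ?thesis
    unfolding condition_C_def positive_existential_def by blast
qed

end


section \<open>Ideals in Noetherian rings\<close>

context cring
begin

lemma ideal_of_closed:
  assumes "I \<subseteq> carrier R" "\<zero> \<in> I" "\<And>a b. a \<in> I \<Longrightarrow> b \<in> I \<Longrightarrow> a \<oplus> b \<in> I"
    "\<And>a x. a \<in> I \<Longrightarrow> x \<in> carrier R \<Longrightarrow> x \<otimes> a \<in> I"
  shows "ideal I R"
proof (rule idealI[OF ring_axioms])
  have "\<ominus> a \<in> I" if "a \<in> I" for a
    using assms(4)[OF that, of "\<ominus> \<one>"] that assms(1) by (auto simp: l_minus subset_iff)
  then show "subgroup I (add_monoid R)"
    using assms by (auto intro!: add.subgroupI)
  show "a \<otimes> x \<in> I" if "a \<in> I" "x \<in> carrier R" for a x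
    using assms(4)[OF that] assms(1) that m_comm by (metis subsetD)
qed (rule assms(4))

lemma ideal_memD:
  assumes "ideal I R"
  shows "I \<subseteq> carrier R" "\<zero> \<in> I" "\<And>a b. a \<in> I \<Longrightarrow> b \<in> I \<Longrightarrow> a \<oplus> b \<in> I"
    "\<And>a b. a \<in> I \<Longrightarrow> b \<in> I \<Longrightarrow> a \<ominus> b \<in> I"
    "\<And>a x. a \<in> I \<Longrightarrow> x \<in> carrier R \<Longrightarrow> x \<otimes> a \<in> I"
    "\<And>a x. a \<in> I \<Longrightarrow> x \<in> carrier R \<Longrightarrow> a \<otimes> x \<in> I"
    "\<And>a. a \<in> I \<Longrightarrow> a \<in> carrier R"
proof -
  interpret ideal I R by (rule assms)
  show "I \<subseteq> carrier R" by (rule a_subset)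
  show "\<zero> \<in> I" by (rule zero_closed)
  show "\<And>a b. a \<in> I \<Longrightarrow> b \<in> I \<Longrightarrow> a \<oplus> b \<in> I" by (rule a_closed)
  show "\<And>a b. a \<in> I \<Longrightarrow> b \<in> I \<Longrightarrow> a \<ominus> b \<in> I"
    unfolding a_minus_def by (intro a_closed a_inv_closed)
  show "\<And>a x. a \<in> I \<Longrightarrow> x \<in> carrier R \<Longrightarrow> x \<otimes> a \<in> I" by (rule I_l_closed)
  show "\<And>a x. a \<in> I \<Longrightarrow> x \<in> carrier R \<Longrightarrow> a \<otimes> x \<in> I" by (rule I_r_closed)
  show "\<And>a. a \<in> I \<Longrightarrow> a \<in> carrier R" using a_subset by (rule subsetD)
qed

lemma PIdl_iff: "x \<in> PIdl a \<longleftrightarrow> (\<exists>r\<in>carrier R. x = r \<otimes> a)"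
  by (auto simp: cgenideal_def)

lemma ideal_sum_iff: "x \<in> I <+>\<^bsub>R\<^esub> J \<longleftrightarrow> (\<exists>a\<in>I. \<exists>b\<in>J. x = a \<oplus> b)"
  by (auto simp: set_add_def')

lemma ideal_sum_upper:
  assumes "ideal I R" "ideal J R"
  shows "I \<subseteq> I <+>\<^bsub>R\<^esub> J" "J \<subseteq> I <+>\<^bsub>R\<^esub> J"
  using ideal_memD(2,7)[OF assms(1)] ideal_memD(2,7)[OF assms(2)] ideal_sum_iff
  by (metis l_zero r_zero subsetI)+

lemma ideal_sum_PIdl_iff:
  "x \<in> I <+>\<^bsub>R\<^esub> PIdl a \<longleftrightarrow> (\<exists>y\<in>I. \<exists>r\<in>carrier R. x = y \<oplus> r \<otimes> a)"
  unfolding ideal_sum_iff using PIdl_iff by metis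

lemma ideal_colon:
  assumes "ideal I R" "c \<in> carrier R"
  shows "ideal {x \<in> carrier R. c \<otimes> x \<in> I} R"
  using ideal_memD[OF assms(1)] assms(2)
  by (intro ideal_of_closed) (auto simp: r_distr m_lcomm)

lemma proper_ideal_one: "ideal I R \<Longrightarrow> \<one> \<in> I \<longleftrightarrow> I = carrier R"
  using ideal.one_imp_carrier by blast

lemma primeideal_compl:
  assumes "primeideal P R"
  shows "\<one> \<in> carrier R - P" "\<And>s t. s \<in> carrier R - P \<Longrightarrow> t \<in> carrier R - P \<Longrightarrow> s \<otimes> t \<in> carrier R - P"
    "\<And>s (n::nat). s \<in> carrier R - P \<Longrightarrow> s [^] n \<in> carrier R - P"
proof -
  interpret primeideal P R by (rule assms)
  show 1: "\<one> \<in> carrier R - P"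
    using I_notcarr one_imp_carrier by auto
  show 2: "\<And>s t. s \<in> carrier R - P \<Longrightarrow> t \<in> carrier R - P \<Longrightarrow> s \<otimes> t \<in> carrier R - P"
    using I_prime by auto
  show "s \<in> carrier R - P \<Longrightarrow> s [^] n \<in> carrier R - P" for s and n :: nat
    using 1 2 by (induction n) auto
qed

text \<open>The intersection of a chain of primes is prime. Passing to complements turns
  intersections into unions, so that Zorn's lemma for increasing chains applies and a maximal
  complement is a minimal prime.\<close>

lemma exists_minimal_prime:
  assumes "primeideal P R" "I \<subseteq> P"
  shows "\<exists>P'. primeideal P' R \<and> I \<subseteq> P' \<and> P' \<subseteq> P \<and>
    (\<forall>Q. primeideal Q R \<longrightarrow> I \<subseteq> Q \<longrightarrow> Q \<subseteq> P' \<longrightarrow> Q = P')"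
proof -
  let ?F = "(\<lambda>Q. carrier R - Q) ` {Q. primeideal Q R \<and> I \<subseteq> Q \<and> Q \<subseteq> P}"
  have sub: "Q \<subseteq> carrier R" if "primeideal Q R" for Q
    using ideal_memD(1)[OF primeideal.axioms(1)[OF that]] .
  have "\<exists>M\<in>?F. \<forall>Y\<in>?F. M \<subseteq> Y \<longrightarrow> Y = M"
  proof (rule subset_Zorn_nonempty)
    show "?F \<noteq> {}" using assms by auto
  next
    fix \<C> assume C: "\<C> \<noteq> {}" "subset.chain ?F \<C>"
    define Q where "Q = carrier R - \<Union>\<C>"
    have mem: "\<exists>Q. primeideal Q R \<and> I \<subseteq> Q \<and> Q \<subseteq> P \<and> c = carrier R - Q" if "c \<in> \<C>" for c
    proof -
      have "c \<in> ?F" using C(2) that unfolding subset.chain_def by (simp add: subset_iff)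
      then show ?thesis by (elim imageE) auto
    qed
    have tot: "c \<subseteq> d \<or> d \<subseteq> c" if "c \<in> \<C>" "d \<in> \<C>" for c d
      using C(2) that unfolding subset_chain_def by simp
    have Q_iff: "x \<in> Q \<longleftrightarrow> x \<in> carrier R \<and> (\<forall>c\<in>\<C>. x \<notin> c)" for x
      unfolding Q_def by auto
    have "ideal Q R"
    proof (rule ideal_of_closed)
      show "Q \<subseteq> carrier R" unfolding Q_def by blast
      show "\<zero> \<in> Q"
        unfolding Q_iff
      proof (intro conjI ballI zero_closed)
        fix c assume "c \<in> \<C>"
        then obtain Q' where "primeideal Q' R" "c = carrier R - Q'" using mem by blast
        then show "\<zero> \<notin> c" using ideal_memD(2)[OF primeideal.axioms(1)] by blast
      qed
      show "a \<oplus> b \<in> Q" if ab: "a \<in> Q" "b \<in> Q" for a b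
        unfolding Q_iff
      proof (intro conjI ballI)
        show "a \<oplus> b \<in> carrier R" using ab Q_iff by simp
        fix c assume c: "c \<in> \<C>"
        then obtain Q' where Q': "primeideal Q' R" "c = carrier R - Q'" using mem by blast
        have "a \<in> Q'" "b \<in> Q'" using ab c Q'(2) Q_iff by auto
        then show "a \<oplus> b \<notin> c" using ideal_memD(3)[OF primeideal.axioms(1)[OF Q'(1)]] Q'(2) by blast
      qed
      show "x \<otimes> a \<in> Q" if ax: "a \<in> Q" "x \<in> carrier R" for a x
        unfolding Q_iff
      proof (intro conjI ballI)
        show "x \<otimes> a \<in> carrier R" using ax Q_iff by simp
        fix c assume c: "c \<in> \<C>"
        then obtain Q' where Q': "primeideal Q' R" "c = carrier R - Q'" using mem by blast
        have "a \<in> Q'" using ax c Q'(2) Q_iff by auto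
        then show "x \<otimes> a \<notin> c" using ideal_memD(5)[OF primeideal.axioms(1)[OF Q'(1)]] ax(2) Q'(2) by blast
      qed
    qed
    moreover have "carrier R \<noteq> Q"
    proof
      assume eq: "carrier R = Q"
      obtain c where c: "c \<in> \<C>" using C(1) by blast
      then obtain Q' where Q': "primeideal Q' R" "c = carrier R - Q'" using mem by blast
      have "\<one> \<in> c" using primeideal_compl(1)[OF Q'(1)] Q'(2) by blast
      then show False using eq c Q_iff by blast
    qed
    moreover have "a \<in> Q \<or> b \<in> Q" if ab: "a \<in> carrier R" "b \<in> carrier R" "a \<otimes> b \<in> Q" for a b
    proof (rule ccontr)
      assume "\<not> (a \<in> Q \<or> b \<in> Q)"
      then obtain c d where cd: "c \<in> \<C>" "d \<in> \<C>" "a \<in> c" "b \<in> d"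
        using ab(1,2) Q_iff by blast
      then obtain e where e: "e \<in> \<C>" "a \<in> e" "b \<in> e"
        using tot[of c d] by blast
      then obtain Q' where Q': "primeideal Q' R" "e = carrier R - Q'" using mem by blast
      have "a \<otimes> b \<in> e" using e primeideal_compl(2)[OF Q'(1)] Q'(2) by blast
      then show False using ab(3) e(1) Q_iff by blast
    qed
    ultimately have "primeideal Q R"
      by (intro primeidealI is_cring)
    moreover have "I \<subseteq> Q"
    proof
      fix x assume x: "x \<in> I"
      have "x \<notin> c" if "c \<in> \<C>" for c using mem[OF that] x by blast
      moreover have "x \<in> carrier R" using x assms sub by blast
      ultimately show "x \<in> Q" using Q_iff by blast
    qed
    moreover have "Q \<subseteq> P"
    proof
      fix x assume x: "x \<in> Q"
      obtain c where c: "c \<in> \<C>" using C(1) by blast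
      then obtain Q' where Q': "Q' \<subseteq> P" "c = carrier R - Q'" using mem by blast
      then show "x \<in> P" using x c Q_iff by blast
    qed
    moreover have "\<Union>\<C> = carrier R - Q"
    proof -
      have "\<Union>\<C> \<subseteq> carrier R" using mem by blast
      then show ?thesis unfolding Q_def by blast
    qed
    ultimately show "\<Union>\<C> \<in> ?F"
      by (intro image_eqI[of _ _ Q]) simp_all
  qed
  then obtain M where M: "M \<in> ?F" "\<forall>Y\<in>?F. M \<subseteq> Y \<longrightarrow> Y = M" ..
  from M(1) obtain P' where "P' \<in> {Q. primeideal Q R \<and> I \<subseteq> Q \<and> Q \<subseteq> P}" and MP': "M = carrier R - P'"
    by (elim imageE)
  then have P': "primeideal P' R" "I \<subseteq> P'" "P' \<subseteq> P"
    by simp_all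
  show ?thesis
  proof (intro exI[of _ P'] conjI allI impI P'(1-3))
    fix Q assume Q: "primeideal Q R" "I \<subseteq> Q" "Q \<subseteq> P'"
    have "carrier R - Q \<in> ?F"
      by (intro imageI) (use Q P'(3) in simp)
    then have "carrier R - Q = carrier R - P'"
      using M(2) Q(3) MP' by (metis Diff_mono subset_refl)
    then show "Q = P'"
      using sub[OF Q(1)] sub[OF P'(1)] by blast
  qed
qed

end

section \<open>Consequences of the ascending chain condition\<close>

lemma (in noetherian_ring) exists_maximal_ideal_in:
  assumes "\<I> \<noteq> {}" "\<And>I. I \<in> \<I> \<Longrightarrow> ideal I R"
  obtains M where "M \<in> \<I>" "\<And>I. I \<in> \<I> \<Longrightarrow> M \<subseteq> I \<Longrightarrow> I = M"
proof -
  have "\<exists>M\<in>\<I>. \<forall>Y\<in>\<I>. M \<subseteq> Y \<longrightarrow> Y = M"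
  proof (rule subset_Zorn_nonempty[OF assms(1)])
    fix \<C> assume C: "\<C> \<noteq> {}" "subset.chain \<I> \<C>"
    have "\<C> \<subseteq> \<I>" using C(2) unfolding subset.chain_def by blast
    moreover have "subset.chain {I. ideal I R} \<C>"
      using C(2) assms(2) unfolding subset.chain_def by blast
    ultimately show "\<Union>\<C> \<in> \<I>"
      using ideal_chain_is_trivial[OF C(1)] by blast
  qed
  then show thesis using that by blast
qed

lemma (in noetherian_ring) ascending_ideals_stable:
  assumes "\<And>n. ideal (I n) R" "\<And>n. I n \<subseteq> I (Suc n)"
  obtains n where "\<And>m. m \<ge> n \<Longrightarrow> I m = I n"
proof -
  obtain M where M: "M \<in> range I" "\<And>J. J \<in> range I \<Longrightarrow> M \<subseteq> J \<Longrightarrow> J = M"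
  proof (rule exists_maximal_ideal_in[of "range I"])
    show "ideal J R" if "J \<in> range I" for J using that assms(1) by (elim rangeE) simp
  qed simp_all
  from M(1) obtain n where n: "M = I n" by (elim rangeE)
  have "I n \<subseteq> I m" if "m \<ge> n" for m
    using that by (induction rule: dec_induct) (use assms(2) in auto)
  then have "I m = I n" if "m \<ge> n" for m
    using M(2)[of "I m"] n that by simp
  then show thesis
    by (rule that)
qed

locale noetherian_cring = noetherian_ring + cring

sublocale noetherian_domain \<subseteq> noetherian_cring ..

text \<open>Existence of an associated prime of \<open>R/I\<close>: a largest ideal
  \<open>(I : a)\<close> with \<open>a\<close> outside \<open>I\<close> is prime, because it is
  contained in \<open>(I : a x)\<close> and therefore equal to it whenever \<open>a x\<close> is
  outside \<open>I\<close>.\<close>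

lemma (in noetherian_cring) exists_prime_colon:
  assumes I: "ideal I R" "I \<noteq> carrier R"
  obtains a where "a \<in> carrier R" "a \<notin> I" "primeideal {r \<in> carrier R. a \<otimes> r \<in> I} R"
proof -
  let ?Q = "\<lambda>a. {r \<in> carrier R. a \<otimes> r \<in> I}"
  have "?Q ` (carrier R - I) \<noteq> {}"
    using I ideal_memD(1) by blast
  then obtain M where M: "M \<in> ?Q ` (carrier R - I)"
    "\<And>J. J \<in> ?Q ` (carrier R - I) \<Longrightarrow> M \<subseteq> J \<Longrightarrow> J = M"
    by (rule exists_maximal_ideal_in[of "?Q ` (carrier R - I)"]) (use ideal_colon[OF I(1)] in auto)
  then obtain a where a: "a \<in> carrier R" "a \<notin> I" "M = ?Q a" by blast
  note I' = ideal_memD[OF I(1)]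
  have "primeideal (?Q a) R"
  proof (rule primeidealI[OF ideal_colon[OF I(1) a(1)] is_cring])
    show "carrier R \<noteq> ?Q a"
    proof
      assume "carrier R = ?Q a"
      then have "a \<otimes> \<one> \<in> I" using one_closed by blast
      then show False using a by simp
    qed
  next
    fix x y assume xy: "x \<in> carrier R" "y \<in> carrier R" "x \<otimes> y \<in> ?Q a"
    show "x \<in> ?Q a \<or> y \<in> ?Q a"
    proof (rule ccontr)
      assume "\<not> (x \<in> ?Q a \<or> y \<in> ?Q a)"
      then have nx: "a \<otimes> x \<notin> I" and ny: "a \<otimes> y \<notin> I" using xy by auto
      have "?Q a \<subseteq> ?Q (a \<otimes> x)"
      proof
        fix r assume "r \<in> ?Q a"
        then have r: "r \<in> carrier R" "a \<otimes> r \<in> I" by auto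
        have "a \<otimes> x \<otimes> r = x \<otimes> (a \<otimes> r)" using r(1) xy(1) a(1) by algebra
        then show "r \<in> ?Q (a \<otimes> x)" using r I'(5)[OF r(2) xy(1)] by simp
      qed
      then have "?Q (a \<otimes> x) = ?Q a"
        using M(2)[of "?Q (a \<otimes> x)"] a xy(1) nx by auto
      moreover have "y \<in> ?Q (a \<otimes> x)"
        using xy a(1) by (simp add: m_assoc)
      ultimately show False using ny by blast
    qed
  qed
  then show thesis using that a by blast
qed

section \<open>Lengths of chains of ideals at a prime\<close>

locale noetherian_prime = noetherian_cring +
  fixes P
  assumes prime: "primeideal P R"
begin

abbreviation S where "S \<equiv> carrier R - P"

text \<open>Inclusion of the ideals generated in the localisation at \<open>P\<close>.\<close>

definition loc_le :: "'a set \<Rightarrow> 'a set \<Rightarrow> bool" (infix \<open>\<preceq>\<close> 50)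
  where "I \<preceq> J \<longleftrightarrow> (\<forall>a\<in>I. \<exists>s\<in>S. s \<otimes> a \<in> J)"

lemmas S_one = primeideal_compl(1)[OF prime]
  and S_mult = primeideal_compl(2)[OF prime]
  and S_pow = primeideal_compl(3)[OF prime]

lemma P_ideal: "ideal P R"
  using prime by (rule primeideal.axioms(1))

lemma loc_le_trans:
  assumes "I \<preceq> J" "J \<preceq> K" "I \<subseteq> carrier R"
  shows "I \<preceq> K"
  unfolding loc_le_def
proof
  fix a assume a: "a \<in> I"
  obtain s where s: "s \<in> S" "s \<otimes> a \<in> J" using assms(1) a unfolding loc_le_def by blast
  obtain t where t: "t \<in> S" "t \<otimes> (s \<otimes> a) \<in> K" using assms(2) s unfolding loc_le_def by blast
  then show "\<exists>s\<in>S. s \<otimes> a \<in> K"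
    using S_mult[OF t(1) s(1)] s(1) a assms(3)
    by (intro bexI[of _ "t \<otimes> s"]) (auto simp: m_assoc subset_iff)
qed

lemma loc_le_subset: "I \<subseteq> J \<Longrightarrow> J \<subseteq> carrier R \<Longrightarrow> I \<preceq> J"
  unfolding loc_le_def using S_one by (metis l_one subsetD)

text \<open>Working with ideals of the ring itself and comparing them by \<open>\<preceq>\<close>
  avoids constructing the localisation. The lower bound is a local condition too, since the chain in
  \<open>no_root\<close> contains it only up to a factor outside \<open>P\<close>.\<close>

definition descending :: "'a set \<Rightarrow> 'a set \<Rightarrow> (nat \<Rightarrow> 'a set) \<Rightarrow> nat \<Rightarrow> bool"
  where "descending I J f k \<longleftrightarrow> (\<forall>i\<le>k. ideal (f i) R \<and> f i \<subseteq> I \<and> J \<preceq> f i) \<and> (\<forall>i<k. f (Suc i) \<subseteq> f i)"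

text \<open>The length of \<open>I/J\<close> localised at \<open>P\<close> is at most \<open>n\<close>.\<close>

definition length_le :: "'a set \<Rightarrow> 'a set \<Rightarrow> nat \<Rightarrow> bool"
  where "length_le I J n \<longleftrightarrow>
    (\<forall>f k. descending I J f k \<longrightarrow> card {i. i < k \<and> \<not> f i \<preceq> f (Suc i)} \<le> n)"

lemma length_leI:
  "(\<And>f k. descending I J f k \<Longrightarrow> card {i. i < k \<and> \<not> f i \<preceq> f (Suc i)} \<le> n) \<Longrightarrow> length_le I J n"
  unfolding length_le_def by blast

lemma length_le_mono: "length_le I J m \<Longrightarrow> m \<le> n \<Longrightarrow> length_le I J n"
  unfolding length_le_def using le_trans by blast

text \<open>A chain \<open>f i\<close> is split into \<open>f i + J\<close> and
  \<open>f i \<inter> J\<close>. By the modular law a step that is an equality at \<open>P\<close>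
  in both chains is one in \<open>f\<close>, so the numbers of strict steps add up.\<close>

lemma length_le_trans:
  assumes I: "ideal I R" and J: "ideal J R" and sub: "J \<subseteq> I" "K \<subseteq> J"
    and len: "length_le I J m" "length_le J K n"
  shows "length_le I K (m + n)"
proof (rule length_leI)
  fix f k assume f: "descending I K f k"
  have fi: "ideal (f i) R" "f i \<subseteq> I" "K \<preceq> f i" if "i \<le> k" for i
    using f that unfolding descending_def by auto
  have dec: "f (Suc i) \<subseteq> f i" if "i < k" for i
    using f that unfolding descending_def by auto
  let ?g = "\<lambda>i. f i <+>\<^bsub>R\<^esub> J" and ?h = "\<lambda>i. f i \<inter> J"
  note I' = ideal_memD[OF I] and J' = ideal_memD[OF J]
  have "descending I J ?g k"
    unfolding descending_def
  proof (intro conjI allI impI)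
    fix i assume i: "i \<le> k"
    show "ideal (?g i) R" by (rule add_ideals[OF fi(1)[OF i] J])
    show "?g i \<subseteq> I"
      using fi(2)[OF i] sub(1) I'(3) by (force simp: ideal_sum_iff)
    show "J \<preceq> ?g i"
      by (rule loc_le_subset[OF ideal_sum_upper(2)[OF fi(1)[OF i] J]])
        (rule ideal_memD(1)[OF add_ideals[OF fi(1)[OF i] J]])
  next
    fix i assume i: "i < k"
    show "?g (Suc i) \<subseteq> ?g i"
      using dec[OF i] by (force simp: ideal_sum_iff)
  qed
  then have cg: "card {i. i < k \<and> \<not> ?g i \<preceq> ?g (Suc i)} \<le> m"
    using len(1) unfolding length_le_def by blast
  have "descending J K ?h k"
    unfolding descending_def
  proof (intro conjI allI impI)
    fix i assume i: "i \<le> k"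
    show "ideal (?h i) R" by (rule i_intersect[OF fi(1)[OF i] J])
    show "K \<preceq> ?h i"
      unfolding loc_le_def
    proof
      fix a assume a: "a \<in> K"
      then obtain s where "s \<in> S" "s \<otimes> a \<in> f i" using fi(3)[OF i] unfolding loc_le_def by blast
      then show "\<exists>s\<in>S. s \<otimes> a \<in> f i \<inter> J" using J'(5)[of a s] a sub(2) by blast
    qed
  qed (use dec in auto)
  then have ch: "card {i. i < k \<and> \<not> ?h i \<preceq> ?h (Suc i)} \<le> n"
    using len(2) unfolding length_le_def by blast
  have "f i \<preceq> f (Suc i)" if i: "i < k" and g: "?g i \<preceq> ?g (Suc i)" and h: "?h i \<preceq> ?h (Suc i)" for i
    unfolding loc_le_def
  proof
    have ik: "i \<le> k" "Suc i \<le> k" using i by auto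
    note F = ideal_memD[OF fi(1)[OF ik(1)]] and F' = ideal_memD[OF fi(1)[OF ik(2)]]
    fix a assume a: "a \<in> f i"
    have "a \<in> ?g i" using a ideal_sum_upper(1)[OF fi(1)[OF ik(1)] J] by blast
    then obtain s where s1: "s \<in> S" "s \<otimes> a \<in> ?g (Suc i)"
      using g unfolding loc_le_def by blast
    from s1(2) obtain b j where "b \<in> f (Suc i)" "j \<in> J" "s \<otimes> a = b \<oplus> j"
      unfolding ideal_sum_iff by blast
    with s1(1) have s: "s \<in> S" "b \<in> f (Suc i)" "j \<in> J" "s \<otimes> a = b \<oplus> j" by simp_all
    have c: "s \<in> carrier R" "a \<in> carrier R" "b \<in> carrier R" "j \<in> carrier R"
      using s a F(7) F'(7) J'(7) by auto
    have "j = s \<otimes> a \<ominus> b" unfolding s(4) using c by algebra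
    moreover have "s \<otimes> a \<ominus> b \<in> f i" using F(4)[OF F(5)[OF a c(1)]] dec[OF i] s(2) by blast
    ultimately have "j \<in> ?h i" using s(3) by simp
    then obtain t where t: "t \<in> S" "t \<otimes> j \<in> f (Suc i)"
      using h unfolding loc_le_def by blast
    have tc: "t \<in> carrier R" using t by blast
    have "t \<otimes> s \<otimes> a = t \<otimes> (s \<otimes> a)" using c tc by algebra
    also have "\<dots> = t \<otimes> b \<oplus> t \<otimes> j" unfolding s(4) using c tc by algebra
    also have "\<dots> \<in> f (Suc i)" using F'(3)[OF F'(5)[OF s(2) tc] t(2)] .
    finally show "\<exists>s\<in>S. s \<otimes> a \<in> f (Suc i)" using S_mult[OF t(1) s(1)] by blast
  qed
  then have "{i. i < k \<and> \<not> f i \<preceq> f (Suc i)} \<subseteq>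
      {i. i < k \<and> \<not> ?g i \<preceq> ?g (Suc i)} \<union> {i. i < k \<and> \<not> ?h i \<preceq> ?h (Suc i)}"
    by blast
  then have "card {i. i < k \<and> \<not> f i \<preceq> f (Suc i)} \<le>
      card ({i. i < k \<and> \<not> ?g i \<preceq> ?g (Suc i)} \<union> {i. i < k \<and> \<not> ?h i \<preceq> ?h (Suc i)})"
    by (intro card_mono) auto
  also have "\<dots> \<le> m + n"
    using card_Un_le cg ch by (meson add_mono le_trans)
  finally show "card {i. i < k \<and> \<not> f i \<preceq> f (Suc i)} \<le> m + n" .
qed

lemma length_le_0:
  assumes "I \<preceq> J" "I \<subseteq> carrier R"
  shows "length_le I J 0"
proof (rule length_leI)
  fix f k assume f: "descending I J f k"
  have "f i \<preceq> f (Suc i)" if "i < k" for i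
  proof -
    have fi: "f i \<subseteq> I" "J \<preceq> f (Suc i)" using f that unfolding descending_def by auto
    have "f i \<preceq> I" by (rule loc_le_subset[OF fi(1) assms(2)])
    then have "f i \<preceq> J" by (rule loc_le_trans[OF _ assms(1)]) (use fi assms in blast)
    then show ?thesis by (rule loc_le_trans[OF _ fi(2)]) (use fi assms in blast)
  qed
  then have "{i. i < k \<and> \<not> f i \<preceq> f (Suc i)} = {}" by blast
  then show "card {i. i < k \<and> \<not> f i \<preceq> f (Suc i)} \<le> 0" by simp
qed

text \<open>The quotient is cyclic with annihilator \<open>P\<close>, hence a one-dimensional vector
  space over the residue field at \<open>P\<close>. Accordingly each member of a chain is, at
  \<open>P\<close>, either the bottom or the top (\<open>dich\<close>), and only one step can be
  strict.\<close>

lemma length_le_1: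
  assumes J: "ideal J R" and a: "a \<in> carrier R" and colon: "{r \<in> carrier R. a \<otimes> r \<in> J} = P"
  shows "length_le (J <+>\<^bsub>R\<^esub> PIdl a) J 1"
proof (rule length_leI)
  let ?I = "J <+>\<^bsub>R\<^esub> PIdl a"
  have I: "ideal ?I R" by (rule add_ideals[OF J cgenideal_ideal[OF a]])
  note J' = ideal_memD[OF J] and I' = ideal_memD[OF I]
  fix f k assume f: "descending ?I J f k"
  have fi: "ideal (f i) R" "f i \<subseteq> ?I" "J \<preceq> f i" if "i \<le> k" for i
    using f that unfolding descending_def by auto
  have dec: "f (Suc i) \<subseteq> f i" if "i < k" for i
    using f that unfolding descending_def by auto
  have dich: "f i \<preceq> J \<or> ?I \<preceq> f i" if i: "i \<le> k" for i
  proof (cases "\<forall>x\<in>f i. x \<in> J")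
    case True
    then show ?thesis using loc_le_subset[of "f i" J] J'(1) by blast
  next
    case False
    note F = ideal_memD[OF fi(1)[OF i]]
    from False obtain x where x: "x \<in> f i" "x \<notin> J" by blast
    then have "x \<in> ?I" using fi(2)[OF i] by blast
    then obtain y r where yr: "y \<in> J" "r \<in> carrier R" "x = y \<oplus> r \<otimes> a"
      using ideal_sum_PIdl_iff by blast
    \<comment> \<open>By the colon hypothesis the coefficient of \<open>a\<close> in an element
      outside \<open>J\<close> is outside \<open>P\<close>, so this element gives back
      \<open>a\<close> at \<open>P\<close>.\<close>
    have rS: "r \<in> S"
    proof -
      have "a \<otimes> r \<notin> J"
        using x(2) yr J'(3)[OF yr(1)] a by (auto simp: m_comm)
      then show ?thesis using colon yr(2) by blast
    qed
    obtain t where t: "t \<in> S" "t \<otimes> y \<in> f i" using fi(3)[OF i] yr(1) unfolding loc_le_def by blast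
    have c: "t \<in> carrier R" "y \<in> carrier R" "x \<in> carrier R" using t yr J'(7) x F(7) by auto
    have "t \<otimes> r \<otimes> a = t \<otimes> (y \<oplus> r \<otimes> a) \<ominus> t \<otimes> y" using c yr(2) a by algebra
    also have "\<dots> = t \<otimes> x \<ominus> t \<otimes> y" using yr(3) by simp
    also have "\<dots> \<in> f i" by (rule F(4)[OF F(5)[OF x(1) c(1)] t(2)])
    finally have tra: "t \<otimes> r \<otimes> a \<in> f i" .
    have "?I \<preceq> f i"
      unfolding loc_le_def
    proof
      fix z assume "z \<in> ?I"
      then obtain w v where wv: "w \<in> J" "v \<in> carrier R" "z = w \<oplus> v \<otimes> a"
        using ideal_sum_PIdl_iff by blast
      obtain u where u: "u \<in> S" "u \<otimes> w \<in> f i" using fi(3)[OF i] wv(1) unfolding loc_le_def by blast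
      have d: "u \<in> carrier R" "w \<in> carrier R" using u wv J'(7) by auto
      have "(u \<otimes> (t \<otimes> r)) \<otimes> z = (t \<otimes> r) \<otimes> (u \<otimes> w) \<oplus> (u \<otimes> v) \<otimes> (t \<otimes> r \<otimes> a)"
        unfolding wv(3) using c d yr(2) wv(2) a by algebra
      also have "\<dots> \<in> f i"
        by (rule F(3)[OF F(5)[OF u(2)] F(5)[OF tra]]) (use c d yr(2) wv(2) in auto)
      finally show "\<exists>s\<in>S. s \<otimes> z \<in> f i"
        using S_mult[OF u(1) S_mult[OF t(1) rS]] by blast
    qed
    then show ?thesis ..
  qed
  have desc: "f j \<subseteq> f i" if "i \<le> j" "j \<le> k" for i j
    using that
  proof (induction rule: dec_induct)
    case (step n)
    then have "f (Suc n) \<subseteq> f n" "f n \<subseteq> f i" using dec[of n] by simp_all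
    then show ?case by blast
  qed simp
  have strict: "f (Suc i) \<preceq> J \<and> \<not> f i \<preceq> J" if i: "i < k" "\<not> f i \<preceq> f (Suc i)" for i
  proof
    have ik: "i \<le> k" "Suc i \<le> k" using i by auto
    have sub: "f i \<subseteq> carrier R" "f (Suc i) \<subseteq> carrier R" using ideal_memD(1) fi(1) ik by auto
    show "f (Suc i) \<preceq> J"
    proof (rule ccontr)
      assume "\<not> ?thesis"
      then have "?I \<preceq> f (Suc i)" using dich[OF ik(2)] by blast
      then have "f i \<preceq> f (Suc i)"
        using fi(2)[OF ik(1)] loc_le_trans[OF loc_le_subset[of "f i" ?I]] I'(1) sub by blast
      then show False using i by blast
    qed
    show "\<not> f i \<preceq> J"
      using i(2) loc_le_trans[OF _ fi(3)[OF ik(2)] sub(1)] by blast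
  qed
  have "i = j" if ij: "i < k" "\<not> f i \<preceq> f (Suc i)" "j < k" "\<not> f j \<preceq> f (Suc j)" for i j
  proof -
    have aux: False if "i < j" "i < k" "\<not> f i \<preceq> f (Suc i)" "j < k" "\<not> f j \<preceq> f (Suc j)" for i j
    proof -
      have "f j \<subseteq> f (Suc i)" using desc[of "Suc i" j] that by auto
      then have "f j \<preceq> J" using strict[of i] that unfolding loc_le_def by blast
      then show False using strict[of j] that by blast
    qed
    show ?thesis using aux[of i j] aux[of j i] ij by (cases i j rule: linorder_cases) auto
  qed
  then show "card {i. i < k \<and> \<not> f i \<preceq> f (Suc i)} \<le> 1"
    by (simp add: card_le_Suc0_iff_eq)
qed

text \<open>Noetherian induction: let \<open>M\<close> be maximal among the ideals above
  \<open>I\<close> without a bound. An associated prime \<open>?Q\<close> of \<open>R/M\<close>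
  yields \<open>a\<close> such that \<open>(M + (a))/M\<close> is a copy of \<open>R/?Q\<close>. At
  \<open>P\<close> this has length 1 if \<open>?Q = P\<close> and length 0 if \<open>?Q\<close> is
  not inside \<open>P\<close>; minimality of \<open>P\<close> leaves no other case. Hence the bound
  for \<open>M + (a)\<close> gives one for \<open>M\<close>.\<close>

lemma exists_length_le:
  assumes I: "ideal I R" and min: "\<And>Q. primeideal Q R \<Longrightarrow> I \<subseteq> Q \<Longrightarrow> Q \<subseteq> P \<Longrightarrow> Q = P"
  shows "\<exists>n. length_le (carrier R) I n"
proof (rule ccontr)
  assume no: "\<not> ?thesis"
  let ?F = "{J. ideal J R \<and> I \<subseteq> J \<and> \<not> (\<exists>n. length_le (carrier R) J n)}"
  have "?F \<noteq> {}" using no I by blast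
  then obtain M where M: "M \<in> ?F" "\<And>J. J \<in> ?F \<Longrightarrow> M \<subseteq> J \<Longrightarrow> J = M"
    by (rule exists_maximal_ideal_in[of ?F]) auto
  have Mi: "ideal M R" "I \<subseteq> M" using M(1) by auto
  have "M \<noteq> carrier R"
  proof
    assume "M = carrier R"
    then have "length_le (carrier R) M 0" by (auto intro!: length_le_0 loc_le_subset)
    then show False using M(1) by blast
  qed
  then obtain a where a: "a \<in> carrier R" "a \<notin> M" "primeideal {r \<in> carrier R. a \<otimes> r \<in> M} R"
    using exists_prime_colon[OF Mi(1)] by blast
  let ?Q = "{r \<in> carrier R. a \<otimes> r \<in> M}" and ?N = "M <+>\<^bsub>R\<^esub> PIdl a"
  have N: "ideal ?N R" by (rule add_ideals[OF Mi(1) cgenideal_ideal[OF a(1)]])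
  note M' = ideal_memD[OF Mi(1)]
  have MQ: "M \<subseteq> ?Q" using M'(5,7) a(1) by blast
  have len: "length_le ?N M 1"
  proof (cases "?Q \<subseteq> P")
    case True
    then have "?Q = P" by (intro min[OF a(3)]) (use MQ Mi(2) in auto)
    then show ?thesis by (rule length_le_1[OF Mi(1) a(1)])
  next
    case False
    then obtain s where s: "s \<in> S" "a \<otimes> s \<in> M" by blast
    have "?N \<preceq> M"
      unfolding loc_le_def
    proof
      fix z assume "z \<in> ?N"
      then obtain w v where wv: "w \<in> M" "v \<in> carrier R" "z = w \<oplus> v \<otimes> a"
        using ideal_sum_PIdl_iff by blast
      have c: "s \<in> carrier R" "w \<in> carrier R" using s(1) wv(1) M'(7) by auto
      have "s \<otimes> z = s \<otimes> w \<oplus> v \<otimes> (a \<otimes> s)" unfolding wv(3) using c wv(2) a(1) by algebra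
      also have "\<dots> \<in> M" using M'(3)[OF M'(5)[OF wv(1) c(1)] M'(5)[OF s(2) wv(2)]] .
      finally show "\<exists>s\<in>S. s \<otimes> z \<in> M" using s(1) by blast
    qed
    then show ?thesis
      using length_le_mono[OF length_le_0[of ?N M]] ideal_memD(1)[OF N] by simp
  qed
  have MN: "M \<subseteq> ?N" and aN: "a \<in> ?N"
    using ideal_sum_upper[OF Mi(1) cgenideal_ideal[OF a(1)]] cgenideal_self[OF a(1)] by auto
  have "\<exists>n. length_le (carrier R) ?N n"
  proof (rule ccontr)
    assume "\<not> ?thesis"
    then have "?N \<in> ?F" using N Mi(2) MN by simp
    then have "?N = M" using MN by (rule M(2))
    then show False using aN a(2) by simp
  qed
  then obtain n where "length_le (carrier R) ?N n" ..
  then have "length_le (carrier R) M (n + 1)"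
    by (rule length_le_trans[OF oneideal N ideal_memD(1)[OF N] MN _ len])
  then show False using M(1) by auto
qed

text \<open>A chain between \<open>c J\<close> and \<open>(c)\<close> is pulled back along
  multiplication by \<open>c\<close> to a chain between \<open>J\<close> and the ring. Every strict
  step stays strict.\<close>

lemma length_le_mult:
  assumes J: "ideal J R" and c: "c \<in> carrier R" and len: "length_le (carrier R) J n"
  shows "length_le (PIdl c) ((\<lambda>x. c \<otimes> x) ` J) n"
proof (rule length_leI)
  fix f k assume f: "descending (PIdl c) ((\<lambda>x. c \<otimes> x) ` J) f k"
  have fi: "ideal (f i) R" "f i \<subseteq> PIdl c" "(\<lambda>x. c \<otimes> x) ` J \<preceq> f i" if "i \<le> k" for i
    using f that unfolding descending_def by auto
  have dec: "f (Suc i) \<subseteq> f i" if "i < k" for i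
    using f that unfolding descending_def by auto
  note J' = ideal_memD[OF J]
  let ?g = "\<lambda>i. {x \<in> carrier R. c \<otimes> x \<in> f i}"
  have "descending (carrier R) J ?g k"
    unfolding descending_def
  proof (intro conjI allI impI)
    fix i assume i: "i \<le> k"
    show "ideal (?g i) R" by (rule ideal_colon[OF fi(1)[OF i] c])
    show "J \<preceq> ?g i"
      unfolding loc_le_def
    proof
      fix y assume y: "y \<in> J"
      then obtain s where s: "s \<in> S" "s \<otimes> (c \<otimes> y) \<in> f i"
        using fi(3)[OF i] unfolding loc_le_def by blast
      then have "s \<otimes> y \<in> ?g i" using y J'(7) c by (simp add: m_lcomm)
      then show "\<exists>s\<in>S. s \<otimes> y \<in> ?g i" using s(1) by blast
    qed
  qed (use dec in auto)
  then have "card {i. i < k \<and> \<not> ?g i \<preceq> ?g (Suc i)} \<le> n"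
    using len unfolding length_le_def by blast
  moreover have "f i \<preceq> f (Suc i)" if i: "i < k" "?g i \<preceq> ?g (Suc i)" for i
    unfolding loc_le_def
  proof
    fix y assume y: "y \<in> f i"
    then have "y \<in> PIdl c"
      using fi(2)[of i] i(1) by auto
    then obtain x where x: "x \<in> carrier R" "y = x \<otimes> c"
      unfolding PIdl_iff by blast
    then have "x \<in> ?g i" using y c by (simp add: m_comm)
    then obtain s where s: "s \<in> S" "s \<otimes> x \<in> ?g (Suc i)" using i(2) unfolding loc_le_def by blast
    then have "s \<otimes> y \<in> f (Suc i)" using x c by (simp add: m_comm m_lcomm)
    then show "\<exists>s\<in>S. s \<otimes> y \<in> f (Suc i)" using s(1) by blast
  qed
  then have "card {i. i < k \<and> \<not> f i \<preceq> f (Suc i)} \<le> card {i. i < k \<and> \<not> ?g i \<preceq> ?g (Suc i)}"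
    by (intro card_mono) auto
  ultimately show "card {i. i < k \<and> \<not> f i \<preceq> f (Suc i)} \<le> n" by linarith
qed

text \<open>In the filtration by powers of \<open>a\<close>, each quotient
  \<open>(a^n)/(a^(n+1))\<close> is an image of \<open>R/(a)\<close>.\<close>

lemma length_le_power:
  assumes a: "a \<in> carrier R" and len: "length_le (carrier R) (PIdl a) l"
  shows "length_le (carrier R) (PIdl (a [^] n)) (n * l)"
proof (induction n)
  case 0
  have "PIdl \<one> = carrier R"
    by (simp add: cgenideal_eq_genideal genideal_one)
  then show ?case
    using length_le_0[OF loc_le_subset, of "carrier R" "carrier R"] by simp
next
  case (Suc n)
  let ?c = "a [^] n"
  have c: "?c \<in> carrier R" using a by simp
  have eq: "(\<lambda>x. ?c \<otimes> x) ` (PIdl a) = PIdl (a [^] Suc n)"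
  proof
    show "(\<lambda>x. ?c \<otimes> x) ` (PIdl a) \<subseteq> PIdl (a [^] Suc n)"
    proof
      fix x assume "x \<in> (\<lambda>x. ?c \<otimes> x) ` (PIdl a)"
      then obtain r where r: "r \<in> carrier R" "x = ?c \<otimes> (r \<otimes> a)"
        by (elim imageE) (auto simp: PIdl_iff)
      have "x = r \<otimes> (?c \<otimes> a)" unfolding r(2) using r(1) c a by algebra
      then show "x \<in> PIdl (a [^] Suc n)" unfolding PIdl_iff using r(1) by auto
    qed
    show "PIdl (a [^] Suc n) \<subseteq> (\<lambda>x. ?c \<otimes> x) ` (PIdl a)"
    proof
      fix x assume "x \<in> PIdl (a [^] Suc n)"
      then obtain r where r: "r \<in> carrier R" "x = r \<otimes> (?c \<otimes> a)" by (auto simp: PIdl_iff)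
      have "x = ?c \<otimes> (r \<otimes> a)" unfolding r(2) using r(1) c a by algebra
      moreover have "r \<otimes> a \<in> PIdl a" unfolding PIdl_iff using r(1) by blast
      ultimately show "x \<in> (\<lambda>x. ?c \<otimes> x) ` (PIdl a)" by (rule image_eqI)
    qed
  qed
  have len': "length_le (PIdl ?c) (PIdl (a [^] Suc n)) l"
    using length_le_mult[OF cgenideal_ideal[OF a] c len] unfolding eq .
  have sub: "PIdl (a [^] Suc n) \<subseteq> PIdl ?c"
  proof
    fix x assume "x \<in> PIdl (a [^] Suc n)"
    then obtain r where r: "r \<in> carrier R" "x = r \<otimes> (?c \<otimes> a)" by (auto simp: PIdl_iff)
    have "x = (r \<otimes> a) \<otimes> ?c" unfolding r(2) using r(1) c a by algebra
    then show "x \<in> PIdl ?c" unfolding PIdl_iff using r(1) a by blast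
  qed
  have "length_le (carrier R) (PIdl (a [^] Suc n)) (n * l + l)"
    by (rule length_le_trans[OF oneideal cgenideal_ideal[OF c] _ sub Suc.IH len'])
      (rule ideal_memD(1)[OF cgenideal_ideal[OF c]])
  then show ?case by (simp add: add.commute)
qed

end


section \<open>Krull's principal ideal theorem\<close>

text \<open>Serves two purposes below: the gain of a factor in Hensel's iteration, and the inversion
  of \<open>1 - b\<close> for \<open>b\<close> nilpotent.\<close>

lemma (in cring) nat_pow_diff_factor:
  assumes "u \<in> carrier R" "v \<in> carrier R"
  shows "\<exists>w\<in>carrier R. u [^] (n::nat) \<ominus> v [^] n = (u \<ominus> v) \<otimes> w"
proof (induction n)
  case 0
  show ?case using assms by (intro bexI[of _ \<zero>]) (simp_all add: r_right_minus_eq)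
next
  case (Suc n)
  then obtain w where w: "w \<in> carrier R" "u [^] n \<ominus> v [^] n = (u \<ominus> v) \<otimes> w" ..
  have id: "a \<otimes> u \<ominus> b \<otimes> v = (a \<ominus> b) \<otimes> u \<oplus> (u \<ominus> v) \<otimes> b"
    if "a \<in> carrier R" "b \<in> carrier R" for a b
    using that assms by algebra
  have "u [^] Suc n \<ominus> v [^] Suc n = ((u \<ominus> v) \<otimes> w) \<otimes> u \<oplus> (u \<ominus> v) \<otimes> v [^] n"
    using id[of "u [^] n" "v [^] n"] assms w by simp
  also have "\<dots> = (u \<ominus> v) \<otimes> (w \<otimes> u \<oplus> v [^] n)"
    using assms w(1) by (simp add: r_distr m_assoc)
  finally show ?case using assms w(1) by (intro bexI[of _ "w \<otimes> u \<oplus> v [^] n"]) auto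
qed

lemma (in cring) ideal_sum3_iff:
  "x \<in> (PIdl a <+>\<^bsub>R\<^esub> PIdl b) <+>\<^bsub>R\<^esub> PIdl c \<longleftrightarrow>
    (\<exists>u\<in>carrier R. \<exists>v\<in>carrier R. \<exists>w\<in>carrier R. x = u \<otimes> a \<oplus> v \<otimes> b \<oplus> w \<otimes> c)"
  by (simp only: ideal_sum_iff PIdl_iff Bex_def) blast

locale noetherian_domain_prime = noetherian_prime + domain
begin

text \<open>The principal ideal theorem in the form needed here: at \<open>P\<close> the quotient by
  \<open>d\<close> is killed by a power of \<open>a\<close>. If it were not, \<open>a\<close> and
  \<open>d\<close> would behave like parameters of a ring of dimension two: the products
  \<open>d^j a^k\<close> give a number of strict steps above \<open>(a^n)\<close> that is quadratic
  in the size of the exponents, whereas the length of \<open>R/(a^n)\<close> is at most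
  \<open>n l\<close>.\<close>

lemma exists_power_multiple:
  assumes a: "a \<in> P" and len: "length_le (carrier R) (PIdl a) l" and d: "d \<in> carrier R" "d \<noteq> \<zero>"
  shows "\<exists>e::nat. \<exists>s\<in>S. \<exists>w\<in>carrier R. s \<otimes> a [^] e = w \<otimes> d"
proof (rule ccontr)
  assume "\<not> ?thesis"
  then have no: False if "s \<in> S" "w \<in> carrier R" "s \<otimes> a [^] e = w \<otimes> d" for e :: nat and s w
    using that by blast
  have ac: "a \<in> carrier R" using a ideal_memD(7)[OF P_ideal] by blast
  have ap: "a [^] n \<in> carrier R" and dp: "d [^] n \<in> carrier R" for n :: nat
    using ac d by simp_all
  define D where "D e = {x \<in> carrier R. a [^] e \<otimes> x \<in> PIdl d}" for e :: nat
  have D_iff: "x \<in> D e \<longleftrightarrow> x \<in> carrier R \<and> (\<exists>w\<in>carrier R. a [^] e \<otimes> x = w \<otimes> d)" for x e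
    unfolding D_def PIdl_iff by blast
  have "\<exists>e0. \<forall>m\<ge>e0. D m = D e0"
  proof (rule ascending_ideals_stable[of D])
    show "ideal (D n) R" for n
      unfolding D_def by (rule ideal_colon[OF cgenideal_ideal[OF d(1)] ap])
    show "D n \<subseteq> D (Suc n)" for n
    proof
      fix x assume "x \<in> D n"
      then obtain w where w: "x \<in> carrier R" "w \<in> carrier R" "a [^] n \<otimes> x = w \<otimes> d"
        unfolding D_iff by blast
      have "a [^] Suc n \<otimes> x = a \<otimes> (a [^] n \<otimes> x)" using w(1) ac by (simp add: m_ac)
      also have "\<dots> = (a \<otimes> w) \<otimes> d" using w ac d by (simp add: m_assoc)
      finally show "x \<in> D (Suc n)" unfolding D_iff using w(1,2) ac by blast
    qed
    show "\<exists>e0. \<forall>m\<ge>e0. D m = D e0" if "\<And>m. m \<ge> n \<Longrightarrow> D m = D n" for n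
      using that by blast
  qed
  then obtain e0 where e0: "\<And>m. m \<ge> e0 \<Longrightarrow> D m = D e0" by blast
  \<comment> \<open>An Artin-Rees statement for \<open>(d)\<close>: cancelling one factor
    \<open>d\<close> costs at most the fixed power \<open>e0\<close> of \<open>a\<close>.\<close>
  have claim1: "\<exists>w\<in>carrier R. x = a [^] (n - e0) \<otimes> w"
    if xy: "x \<in> carrier R" "y \<in> carrier R" "d \<otimes> x = a [^] n \<otimes> y" "n \<ge> e0" for x y n
  proof -
    have "a [^] n \<otimes> y = x \<otimes> d" using xy d by (simp add: m_comm)
    then have "y \<in> D n" unfolding D_iff using xy(1,2) by blast
    then have "y \<in> D e0" using e0[OF xy(4)] by simp
    then obtain w where w: "w \<in> carrier R" "a [^] e0 \<otimes> y = w \<otimes> d"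
      unfolding D_iff by blast
    have "a [^] n = a [^] (n - e0) \<otimes> a [^] e0"
      using xy(4) ac by (simp add: nat_pow_mult)
    then have "d \<otimes> x = a [^] (n - e0) \<otimes> (a [^] e0 \<otimes> y)"
      using xy(2,3) ap by (simp add: m_assoc)
    also have "\<dots> = d \<otimes> (a [^] (n - e0) \<otimes> w)"
      unfolding w(2) using w(1) ap d by (simp add: m_ac)
    finally have "x = a [^] (n - e0) \<otimes> w"
      using m_lcancel[OF d(2,1) xy(1)] w(1) ap by simp
    then show ?thesis using w(1) by blast
  qed
  have claim2: "\<exists>w\<in>carrier R. x = a [^] (n - j * e0) \<otimes> w"
    if "x \<in> carrier R" "y \<in> carrier R" "d [^] j \<otimes> x = a [^] n \<otimes> y" "n \<ge> j * e0" for x y n j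
    using that
  proof (induction j arbitrary: n y)
    case 0
    then show ?case by auto
  next
    case (Suc j)
    have "d \<otimes> (d [^] j \<otimes> x) = a [^] n \<otimes> y"
      using Suc.prems d dp by (simp add: m_ac)
    then obtain w where w: "w \<in> carrier R" "d [^] j \<otimes> x = a [^] (n - e0) \<otimes> w"
      using claim1[of "d [^] j \<otimes> x" y n] Suc.prems dp by auto
    have "j * e0 \<le> n - e0" using Suc.prems(4) by simp
    then obtain w' where "w' \<in> carrier R" "x = a [^] (n - e0 - j * e0) \<otimes> w'"
      using Suc.IH[OF Suc.prems(1) w] by blast
    then show ?case by (intro bexI[of _ w']) (simp_all add: diff_diff_left)
  qed
  \<comment> \<open>With \<open>n = J e0 + K\<close> and \<open>J = l + 1\<close>, the inequality
    \<open>J K \<le> n l\<close> reduces to \<open>K \<le> l J e0\<close>, which the choice of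
    \<open>K\<close> violates. The part \<open>J e0\<close> of \<open>n\<close> absorbs the losses
    in \<open>claim2\<close> for all \<open>j < J\<close>.\<close>
  define J where "J = l + 1"
  define K where "K = l * J * e0 + 1"
  define n where "n = J * e0 + K"
  \<comment> \<open>The ideal \<open>(d^j a^k, d^(j+1), a^n)\<close>. Ordered lexicographically in
    \<open>(j, k)\<close>, these ideals descend, and each step drops the generator
    \<open>d^j a^k\<close>.\<close>
  define E where "E j k = (PIdl (d [^] j \<otimes> a [^] k) <+>\<^bsub>R\<^esub> PIdl (d [^] Suc j)) <+>\<^bsub>R\<^esub> PIdl (a [^] n)"
    for j k :: nat
  have E_iff: "x \<in> E j k \<longleftrightarrow> (\<exists>u\<in>carrier R. \<exists>v\<in>carrier R. \<exists>w\<in>carrier R.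
    x = u \<otimes> (d [^] j \<otimes> a [^] k) \<oplus> v \<otimes> (d [^] j \<otimes> d) \<oplus> w \<otimes> a [^] n)" for x j k
    unfolding E_def ideal_sum3_iff nat_pow_Suc ..
  have E_ideal: "ideal (E j k) R" for j k
    unfolding E_def by (intro add_ideals cgenideal_ideal m_closed ap dp)
  have sub1: "E j (Suc k) \<subseteq> E j k" for j k
  proof
    fix x assume "x \<in> E j (Suc k)"
    then obtain u v w where u: "u \<in> carrier R" "v \<in> carrier R" "w \<in> carrier R"
      "x = u \<otimes> (d [^] j \<otimes> a [^] Suc k) \<oplus> v \<otimes> (d [^] j \<otimes> d) \<oplus> w \<otimes> a [^] n"
      unfolding E_iff by blast
    have "x = (u \<otimes> a) \<otimes> (d [^] j \<otimes> a [^] k) \<oplus> v \<otimes> (d [^] j \<otimes> d) \<oplus> w \<otimes> a [^] n"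
      unfolding u(4) using u(1) ac ap[of k] dp[of j] by (simp add: m_ac)
    then show "x \<in> E j k" unfolding E_iff using u(1-3) ac by blast
  qed
  have sub2: "E (Suc j) 0 \<subseteq> E j k" for j k
  proof
    fix x assume "x \<in> E (Suc j) 0"
    then obtain u v w where u: "u \<in> carrier R" "v \<in> carrier R" "w \<in> carrier R"
      "x = u \<otimes> (d [^] Suc j \<otimes> a [^] (0::nat)) \<oplus> v \<otimes> (d [^] Suc j \<otimes> d) \<oplus> w \<otimes> a [^] n"
      unfolding E_iff by blast
    have id: "u \<otimes> (dj \<otimes> d \<otimes> \<one>) \<oplus> v \<otimes> (dj \<otimes> d \<otimes> d) \<oplus> w \<otimes> an =
      \<zero> \<otimes> (dj \<otimes> ak) \<oplus> (u \<oplus> v \<otimes> d) \<otimes> (dj \<otimes> d) \<oplus> w \<otimes> an"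
      if "dj \<in> carrier R" "an \<in> carrier R" "ak \<in> carrier R" for dj an ak
      using that u(1-3) d(1) by algebra
    have "x = \<zero> \<otimes> (d [^] j \<otimes> a [^] k) \<oplus> (u \<oplus> v \<otimes> d) \<otimes> (d [^] j \<otimes> d) \<oplus> w \<otimes> a [^] n"
      unfolding u(4) nat_pow_Suc nat_pow_0 by (rule id[OF dp ap ap])
    moreover have "u \<oplus> v \<otimes> d \<in> carrier R" using u(1,2) d(1) by simp
    ultimately show "x \<in> E j k" unfolding E_iff using u(3) zero_closed by blast
  qed
  \<comment> \<open>Moving the terms with \<open>d^j\<close> to one side shows that
    \<open>d^j x\<close> is a multiple of \<open>a^n\<close>, so \<open>x\<close> is a multiple of
    \<open>a^(n - j e0)\<close> and in particular of \<open>a^(k+1)\<close>. This leaves a relation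
    \<open>t a^k = v d\<close> with \<open>t\<close> outside \<open>P\<close>, which was assumed
    impossible.\<close>
  have claim3: False if jk: "j < J" "k < K" and s: "s \<in> S" "s \<otimes> (d [^] j \<otimes> a [^] k) \<in> E j (Suc k)" for j k s
  proof -
    have sc: "s \<in> carrier R" using s(1) by blast
    obtain u v w where u: "u \<in> carrier R" "v \<in> carrier R" "w \<in> carrier R"
      "s \<otimes> (d [^] j \<otimes> a [^] k) = u \<otimes> (d [^] j \<otimes> (a [^] k \<otimes> a)) \<oplus> v \<otimes> (d [^] j \<otimes> d) \<oplus> w \<otimes> a [^] n"
      using s(2) unfolding E_iff nat_pow_Suc by blast
    define x where "x = s \<otimes> a [^] k \<ominus> u \<otimes> (a [^] k \<otimes> a) \<ominus> v \<otimes> d"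
    have xc: "x \<in> carrier R" unfolding x_def using sc u ac ap[of k] d by simp
    have id: "dj \<otimes> (s \<otimes> ak \<ominus> u \<otimes> (ak \<otimes> a) \<ominus> v \<otimes> d) =
       s \<otimes> (dj \<otimes> ak) \<ominus> (u \<otimes> (dj \<otimes> (ak \<otimes> a)) \<oplus> v \<otimes> (dj \<otimes> d))"
      if "dj \<in> carrier R" "ak \<in> carrier R" for dj ak
      using that u(1-3) d(1) ac sc by algebra
    have id2: "A \<oplus> B \<ominus> A = B" if "A \<in> carrier R" "B \<in> carrier R" for A B
      using that by (simp add: a_minus_def a_comm[of A B] a_assoc r_neg)
    have "d [^] j \<otimes> x = s \<otimes> (d [^] j \<otimes> a [^] k) \<ominus> (u \<otimes> (d [^] j \<otimes> (a [^] k \<otimes> a)) \<oplus> v \<otimes> (d [^] j \<otimes> d))"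
      unfolding x_def by (rule id[OF dp ap])
    also have "\<dots> = w \<otimes> a [^] n"
      unfolding u(4) by (rule id2) (use u(1-3) ap[of k] ap[of n] dp[of j] ac d in simp_all)
    also have "\<dots> = a [^] n \<otimes> w" using u(3) ap by (simp add: m_comm)
    finally have dx: "d [^] j \<otimes> x = a [^] n \<otimes> w" .
    have "j * e0 \<le> J * e0" using jk by simp
    then have nj: "j * e0 \<le> n" "n - j * e0 = k + Suc (n - j * e0 - Suc k)"
      using jk unfolding n_def by linarith+
    obtain w' where w': "w' \<in> carrier R" "x = a [^] (n - j * e0) \<otimes> w'"
      using claim2[OF xc u(3) dx nj(1)] by blast
    define r where "r = a [^] (n - j * e0 - Suc k) \<otimes> w'"
    have rc: "r \<in> carrier R" unfolding r_def using w'(1) ap by simp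
    have "a [^] (n - j * e0) = a [^] k \<otimes> (a [^] (n - j * e0 - Suc k) \<otimes> a)"
      by (subst nj(2)) (simp only: nat_pow_mult[OF ac, symmetric] nat_pow_Suc)
    then have xr: "x = a [^] k \<otimes> a \<otimes> r"
      unfolding w'(2) r_def using w'(1) ac ap by (simp add: m_ac)
    \<comment> \<open>As \<open>a\<close> lies in \<open>P\<close> and \<open>s\<close> does not,
      subtracting a multiple of \<open>a\<close> from \<open>s\<close> keeps it outside
      \<open>P\<close>.\<close>
    define t where "t = s \<ominus> (u \<oplus> r) \<otimes> a"
    have uraP: "(u \<oplus> r) \<otimes> a \<in> P" using ideal_memD(5)[OF P_ideal a] u(1) rc by simp
    have id3: "(s \<ominus> b) \<oplus> b = s" if "b \<in> carrier R" for b
      using that sc by algebra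
    have "t \<notin> P"
    proof
      assume "t \<in> P"
      then have "t \<oplus> (u \<oplus> r) \<otimes> a \<in> P" using ideal_memD(3)[OF P_ideal _ uraP] by blast
      then show False unfolding t_def using id3[of "(u \<oplus> r) \<otimes> a"] uraP ideal_memD(7)[OF P_ideal] s(1) by simp
    qed
    then have tS: "t \<in> S" unfolding t_def using sc u(1) rc ac by simp
    have id4: "(s \<ominus> (u \<oplus> r) \<otimes> a) \<otimes> ak = v \<otimes> d"
      if "ak \<in> carrier R" "s \<otimes> ak \<ominus> u \<otimes> (ak \<otimes> a) \<ominus> v \<otimes> d = ak \<otimes> a \<otimes> r" for ak
    proof -
      have "(s \<ominus> (u \<oplus> r) \<otimes> a) \<otimes> ak = (s \<otimes> ak \<ominus> u \<otimes> (ak \<otimes> a) \<ominus> v \<otimes> d) \<oplus> v \<otimes> d \<ominus> ak \<otimes> a \<otimes> r"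
        using that(1) sc u(1,2) d(1) rc ac by algebra
      also have "\<dots> = v \<otimes> d"
        unfolding that(2) using that(1) u(2) d(1) rc ac by algebra
      finally show ?thesis .
    qed
    have "t \<otimes> a [^] k = v \<otimes> d"
      unfolding t_def by (rule id4[OF ap]) (use xr in \<open>simp only: x_def\<close>)
    then show False using no[OF tS u(2)] by blast
  qed
  \<comment> \<open>The pair \<open>(j, k)\<close> is encoded as \<open>i = j K + k\<close>. At the
    end of a row the next ideal is \<open>E (Suc j) 0\<close>, which \<open>sub2\<close> places
    inside \<open>E j k\<close> for every \<open>k\<close>.\<close>
  let ?f = "\<lambda>i. E (i div K) (i mod K)"
  have Kpos: "K > 0" unfolding K_def by simp
  have next_sub: "?f (Suc i) \<subseteq> E (i div K) (Suc (i mod K))" for i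
  proof (cases "Suc (i mod K) = K")
    case True
    then have "Suc i div K = Suc (i div K)" "Suc i mod K = 0"
      by (simp_all add: div_Suc mod_Suc)
    then show ?thesis using sub2[of "i div K" "Suc (i mod K)"] by simp
  next
    case False
    then have "Suc i div K = i div K" "Suc i mod K = Suc (i mod K)"
      by (simp_all add: div_Suc mod_Suc)
    then show ?thesis by simp
  qed
  have "descending (carrier R) (PIdl (a [^] n)) ?f (J * K)"
    unfolding descending_def
  proof (intro conjI allI impI)
    fix i
    show "ideal (?f i) R" by (rule E_ideal)
    show "?f i \<subseteq> carrier R" by (rule ideal_memD(1)[OF E_ideal])
    have "PIdl (a [^] n) \<subseteq> ?f i"
      unfolding E_def
      by (intro ideal_sum_upper(2) add_ideals cgenideal_ideal m_closed ap dp)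
    then show "PIdl (a [^] n) \<preceq> ?f i"
      by (rule loc_le_subset) (rule ideal_memD(1)[OF E_ideal])
    show "?f (Suc i) \<subseteq> ?f i"
      using next_sub sub1 by (rule subset_trans)
  qed
  then have card: "card {i. i < J * K \<and> \<not> ?f i \<preceq> ?f (Suc i)} \<le> n * l"
    using length_le_power[OF ac len, of n] unfolding length_le_def by blast
  have "\<not> ?f i \<preceq> ?f (Suc i)" if i: "i < J * K" for i
  proof
    assume le: "?f i \<preceq> ?f (Suc i)"
    let ?x = "d [^] (i div K) \<otimes> a [^] (i mod K)"
    have "?x = \<one> \<otimes> ?x \<oplus> \<zero> \<otimes> (d [^] (i div K) \<otimes> d) \<oplus> \<zero> \<otimes> a [^] n"
      using ap dp d(1) by simp
    then have "?x \<in> ?f i" unfolding E_iff using one_closed zero_closed by blast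
    then obtain s where "s \<in> S" "s \<otimes> ?x \<in> ?f (Suc i)" using le unfolding loc_le_def by blast
    then have "s \<in> S" "s \<otimes> ?x \<in> E (i div K) (Suc (i mod K))" using next_sub by auto
    then show False using claim3[of "i div K" "i mod K" s] i Kpos
      by (simp add: less_mult_imp_div_less)
  qed
  then have "{i. i < J * K \<and> \<not> ?f i \<preceq> ?f (Suc i)} = {..<J * K}" by auto
  then have "J * K \<le> n * l" using card by simp
  then have "K \<le> l * J * e0"
    unfolding n_def J_def by (simp add: algebra_simps)
  then show False unfolding K_def by simp
qed

text \<open>
  If \<open>c \<noteq> 0\<close>, put \<open>x = b/c\<close>, which is integral over \<open>R\<close>. Then \<open>x^i M\<close>, for the conductor \<open>M\<close> of
  \<open>R[x]\<close>, is a strictly descending sequence at \<open>P\<close> in which \<open>N\<close> steps cost only one factor \<open>q\<close>,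
  so that \<open>R/q\<close> has length at least \<open>N\<close> at \<open>P\<close>.
\<close>

lemma no_root:
  fixes N :: nat
  assumes q: "q \<in> P" "q \<noteq> \<zero>" and len: "length_le (carrier R) (PIdl q) l" and N: "l < N"
    and p: "p \<in> carrier R" and s0: "s0 \<in> S" "r \<in> carrier R" "s0 \<otimes> p = r \<otimes> q"
    and b: "b \<in> carrier R" and c: "c \<in> carrier R"
    and eq: "b [^] Suc N \<oplus> q \<otimes> c [^] Suc N = p \<otimes> b [^] N \<otimes> c"
  shows "c = \<zero>"
proof (rule ccontr)
  assume c0: "c \<noteq> \<zero>"
  have qc: "q \<in> carrier R" using q ideal_memD(7)[OF P_ideal] by blast
  have s0c: "s0 \<in> carrier R" using s0 by blast
  have bp: "b [^] n \<in> carrier R" and cp: "c [^] n \<in> carrier R" and qp: "q [^] n \<in> carrier R" for n :: nat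
    using b c qc by simp_all
  have pow0: "x [^] n \<noteq> \<zero>" if "x \<in> carrier R" "x \<noteq> \<zero>" for x and n :: nat
    using that by (induction n) (simp_all add: integral_iff)
  have b0: "b \<noteq> \<zero>"
  proof
    assume "b = \<zero>"
    then have "q \<otimes> c [^] Suc N = p \<otimes> b [^] N \<otimes> c" using eq qc cp[of N] c by simp
    moreover have "p \<otimes> b [^] N \<otimes> c = \<zero>"
      using \<open>b = \<zero>\<close> N p c by (simp add: nat_pow_zero)
    ultimately show False
      using q(2) qc pow0[OF c c0, of "Suc N"] cp[of "Suc N"] integral_iff by metis
  qed
  have lcancel: "x = y" if "z \<otimes> x = z \<otimes> y" "z \<in> carrier R" "z \<noteq> \<zero>" "x \<in> carrier R" "y \<in> carrier R" for x y z
    using m_lcancel[OF that(3,2,4,5)] that(1) by simp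
  \<comment> \<open>Fractions are avoided: the condition says that \<open>x^i a\<close> lies in
    \<open>R\<close> for every \<open>i\<close>, where \<open>x = b/c\<close>. In this reading
    \<open>stab\<close> is \<open>x M \<subseteq> M\<close>.\<close>
  define M where "M = {a \<in> carrier R. \<forall>i::nat. \<exists>y\<in>carrier R. b [^] i \<otimes> a = c [^] i \<otimes> y}"
  have Mc: "a \<in> carrier R" if "a \<in> M" for a using that unfolding M_def by blast
  have M_D: "\<exists>y\<in>carrier R. b [^] i \<otimes> a = c [^] i \<otimes> y" if "a \<in> M" for a and i :: nat
    using that unfolding M_def by blast
  have M_I: "a \<in> M" if "a \<in> carrier R" "\<And>i::nat. \<exists>y\<in>carrier R. b [^] i \<otimes> a = c [^] i \<otimes> y" for a
    using that unfolding M_def by blast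
  have M0: "\<zero> \<in> M"
    by (rule M_I) (use bp cp in \<open>auto intro!: bexI[of _ \<zero>]\<close>)
  have Madd: "a \<oplus> a' \<in> M" if aa: "a \<in> M" "a' \<in> M" for a a'
  proof (rule M_I)
    fix i :: nat
    obtain y y' where "y \<in> carrier R" "b [^] i \<otimes> a = c [^] i \<otimes> y" "y' \<in> carrier R" "b [^] i \<otimes> a' = c [^] i \<otimes> y'"
      using M_D[OF aa(1), of i] M_D[OF aa(2), of i] by blast
    then show "\<exists>y\<in>carrier R. b [^] i \<otimes> (a \<oplus> a') = c [^] i \<otimes> y"
      using Mc aa bp cp by (intro bexI[of _ "y \<oplus> y'"]) (simp_all add: r_distr)
  qed (use Mc aa in simp)
  have Mmult: "x \<otimes> a \<in> M" if xa: "x \<in> carrier R" "a \<in> M" for x a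
  proof (rule M_I)
    fix i :: nat
    obtain y where y: "y \<in> carrier R" "b [^] i \<otimes> a = c [^] i \<otimes> y"
      using M_D[OF xa(2), of i] by blast
    have "b [^] i \<otimes> (x \<otimes> a) = x \<otimes> (b [^] i \<otimes> a)" using xa Mc bp by (simp add: m_lcomm)
    also have "\<dots> = c [^] i \<otimes> (x \<otimes> y)" unfolding y(2) using xa y(1) cp by (simp add: m_lcomm)
    finally show "\<exists>y\<in>carrier R. b [^] i \<otimes> (x \<otimes> a) = c [^] i \<otimes> y" using xa(1) y(1) by blast
  qed (use Mc xa in simp)
  have Mdiff: "a \<ominus> a' \<in> M" if "a \<in> M" "a' \<in> M" for a a'
  proof -
    have "a \<ominus> a' = a \<oplus> (\<ominus> \<one>) \<otimes> a'" using Mc that by (simp add: a_minus_def l_minus)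
    then show ?thesis using Madd[OF that(1) Mmult[of "\<ominus> \<one>", OF _ that(2)]] by simp
  qed
  have stab: "\<exists>a'\<in>M. b \<otimes> a = c \<otimes> a'" if a: "a \<in> M" for a
  proof -
    obtain y where y: "y \<in> carrier R" "b \<otimes> a = c \<otimes> y"
      using M_D[OF a, of "Suc 0"] b c by auto
    have "y \<in> M"
    proof (rule M_I[OF y(1)])
      fix i :: nat
      obtain z where z: "z \<in> carrier R" "b [^] Suc i \<otimes> a = c [^] Suc i \<otimes> z"
        using M_D[OF a, of "Suc i"] by blast
      have "c \<otimes> (b [^] i \<otimes> y) = b [^] i \<otimes> (b \<otimes> a)" unfolding y(2) using y(1) bp c by (simp add: m_lcomm)
      also have "\<dots> = c \<otimes> (c [^] i \<otimes> z)" using z bp cp c b Mc[OF a] by (simp add: m_ac)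
      finally show "\<exists>z\<in>carrier R. b [^] i \<otimes> y = c [^] i \<otimes> z"
        using lcancel[OF _ c c0, of "b [^] i \<otimes> y" "c [^] i \<otimes> z"] bp cp y(1) z(1) by auto
    qed
    then show ?thesis using y(2) by blast
  qed
  have stab_pow: "\<exists>a'\<in>M. b [^] k \<otimes> a = c [^] k \<otimes> a'" if a: "a \<in> M" for a and k :: nat
  proof (induction k)
    case 0
    then show ?case using a Mc by auto
  next
    case (Suc k)
    then obtain a' where a': "a' \<in> M" "b [^] k \<otimes> a = c [^] k \<otimes> a'" ..
    obtain a'' where a'': "a'' \<in> M" "b \<otimes> a' = c \<otimes> a''" using stab[OF a'(1)] ..
    have "b [^] Suc k \<otimes> a = b \<otimes> (b [^] k \<otimes> a)" using bp b Mc a by (simp add: m_ac)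
    also have "\<dots> = c [^] k \<otimes> (b \<otimes> a')" unfolding a'(2) using cp b Mc a' by (simp add: m_lcomm)
    also have "\<dots> = c [^] Suc k \<otimes> a''" unfolding a''(2) using cp c Mc a'' by (simp add: m_assoc)
    finally show ?case using a''(1) by blast
  qed
  have minus_eq: "x = z \<ominus> y" if "x \<oplus> y = z" "x \<in> carrier R" "y \<in> carrier R" for x y z
    using that by (metis a_closed a_minus_def add.inv_solve_right)
  have bSN: "b [^] N \<otimes> b = p \<otimes> b [^] N \<otimes> c \<ominus> q \<otimes> (c [^] N \<otimes> c)"
    using minus_eq[OF eq] b c qc bp[of N] cp[of N] by simp
  \<comment> \<open>Since \<open>x\<close> satisfies a monic equation of degree
    \<open>N + 1\<close>, the powers up to \<open>x^N\<close> span \<open>R[x]\<close> and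
    \<open>c^N\<close> clears all denominators. The induction replaces \<open>x^i\<close> by
    \<open>p x^(i-1) - q x^(i-N-1)\<close>.\<close>
  have cN: "c [^] N \<in> M"
  proof (rule M_I[OF cp])
    fix i :: nat
    show "\<exists>y\<in>carrier R. b [^] i \<otimes> c [^] N = c [^] i \<otimes> y"
    proof (induction i rule: less_induct)
      case (less i)
      show ?case
      proof (cases "i \<le> N")
        case True
        then have "c [^] N = c [^] i \<otimes> c [^] (N - i)" using c by (simp add: nat_pow_mult)
        then have "b [^] i \<otimes> c [^] N = c [^] i \<otimes> (b [^] i \<otimes> c [^] (N - i))"
          using bp cp by (simp add: m_lcomm)
        then show ?thesis using bp cp by blast
      next
        case False
        define m where "m = i - Suc N"
        have i: "i = m + Suc N" using False unfolding m_def by simp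
        obtain y1 where y1: "y1 \<in> carrier R" "b [^] (m + N) \<otimes> c [^] N = c [^] (m + N) \<otimes> y1"
          using less[of "m + N"] i by auto
        obtain y2 where y2: "y2 \<in> carrier R" "b [^] m \<otimes> c [^] N = c [^] m \<otimes> y2"
          using less[of m] i by auto
        have id: "bm \<otimes> (p \<otimes> bN \<otimes> c \<ominus> q \<otimes> (cN \<otimes> c)) \<otimes> cN
          = p \<otimes> c \<otimes> (bm \<otimes> bN \<otimes> cN) \<ominus> q \<otimes> (cN \<otimes> c) \<otimes> (bm \<otimes> cN)"
          if "bm \<in> carrier R" "bN \<in> carrier R" "cN \<in> carrier R" for bm bN cN
          using that p c qc by algebra
        have id2: "p \<otimes> c \<otimes> (cm \<otimes> cN \<otimes> y1) \<ominus> q \<otimes> (cN \<otimes> c) \<otimes> (cm \<otimes> y2)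
          = cm \<otimes> (cN \<otimes> c) \<otimes> (p \<otimes> y1 \<ominus> q \<otimes> y2)"
          if "cm \<in> carrier R" "cN \<in> carrier R" for cm cN
          using that p c qc y1(1) y2(1) by algebra
        have "b [^] i \<otimes> c [^] N = b [^] m \<otimes> (b [^] N \<otimes> b) \<otimes> c [^] N"
          unfolding i nat_pow_mult[OF b, symmetric] by simp
        also have "\<dots> = p \<otimes> c \<otimes> (b [^] m \<otimes> b [^] N \<otimes> c [^] N) \<ominus> q \<otimes> (c [^] N \<otimes> c) \<otimes> (b [^] m \<otimes> c [^] N)"
          unfolding bSN by (rule id[OF bp bp cp])
        also have "\<dots> = p \<otimes> c \<otimes> (c [^] m \<otimes> c [^] N \<otimes> y1) \<ominus> q \<otimes> (c [^] N \<otimes> c) \<otimes> (c [^] m \<otimes> y2)"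
          using y1(2) y2(2) by (simp only: nat_pow_mult[OF b] nat_pow_mult[OF c])
        also have "\<dots> = c [^] m \<otimes> (c [^] N \<otimes> c) \<otimes> (p \<otimes> y1 \<ominus> q \<otimes> y2)"
          by (rule id2[OF cp cp])
        also have "c [^] m \<otimes> (c [^] N \<otimes> c) = c [^] i"
          unfolding i nat_pow_mult[OF c, symmetric] by simp
        finally show ?thesis using p qc y1(1) y2(1) by blast
      qed
    qed
  qed
  \<comment> \<open>This is \<open>x^i M\<close> with denominators cleared. Membership of
    \<open>a\<close> in \<open>R\<close> is required explicitly, and
    \<open>x M \<subseteq> M\<close> makes the sequence descend.\<close>
  define T where "T i = {a \<in> carrier R. \<exists>a'\<in>M. c [^] i \<otimes> a = b [^] i \<otimes> a'}" for i :: nat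
  have T_iff: "a \<in> T i \<longleftrightarrow> a \<in> carrier R \<and> (\<exists>a'\<in>M. c [^] i \<otimes> a = b [^] i \<otimes> a')" for a i
    unfolding T_def by blast
  have T_ideal: "ideal (T i) R" for i
  proof (rule ideal_of_closed)
    show "T i \<subseteq> carrier R" unfolding T_def by blast
    show "\<zero> \<in> T i" unfolding T_iff using M0 bp cp by (auto intro!: bexI[of _ \<zero>])
    show "a \<oplus> a' \<in> T i" if aa: "a \<in> T i" "a' \<in> T i" for a a'
    proof -
      obtain y y' where y: "a \<in> carrier R" "a' \<in> carrier R" "y \<in> M" "y' \<in> M"
        "c [^] i \<otimes> a = b [^] i \<otimes> y" "c [^] i \<otimes> a' = b [^] i \<otimes> y'"
        using aa unfolding T_iff by blast
      then have "c [^] i \<otimes> (a \<oplus> a') = b [^] i \<otimes> (y \<oplus> y')" using bp cp Mc by (simp add: r_distr)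
      then show ?thesis unfolding T_iff using y(1,2) Madd[OF y(3,4)] by blast
    qed
    show "x \<otimes> a \<in> T i" if xa: "a \<in> T i" "x \<in> carrier R" for a x
    proof -
      obtain y where y: "a \<in> carrier R" "y \<in> M" "c [^] i \<otimes> a = b [^] i \<otimes> y"
        using xa unfolding T_iff by blast
      have "c [^] i \<otimes> (x \<otimes> a) = x \<otimes> (c [^] i \<otimes> a)" using cp xa(2) y(1) by (simp add: m_lcomm)
      also have "\<dots> = b [^] i \<otimes> (x \<otimes> y)" unfolding y(3) using bp xa(2) Mc y(2) by (simp add: m_lcomm)
      finally show ?thesis unfolding T_iff using y(1) xa(2) Mmult[OF xa(2) y(2)] by blast
    qed
  qed
  have T_dec: "T (Suc i) \<subseteq> T i" for i
  proof
    fix a assume "a \<in> T (Suc i)"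
    then obtain a' where a': "a \<in> carrier R" "a' \<in> M" "c [^] Suc i \<otimes> a = b [^] Suc i \<otimes> a'"
      unfolding T_iff by blast
    obtain a'' where a'': "a'' \<in> M" "b \<otimes> a' = c \<otimes> a''" using stab[OF a'(2)] ..
    have "c \<otimes> (c [^] i \<otimes> a) = b [^] i \<otimes> (b \<otimes> a')"
      using a' Mc bp cp b c by (simp add: m_ac)
    also have "\<dots> = c \<otimes> (b [^] i \<otimes> a'')" unfolding a''(2) using Mc a'' bp c by (simp add: m_lcomm)
    finally have "c [^] i \<otimes> a = b [^] i \<otimes> a''"
      using lcancel[OF _ c c0] a'(1) a''(1) Mc bp cp by simp
    then show "a \<in> T i" unfolding T_iff using a'(1) a''(1) by blast
  qed
  have T_le: "T j \<subseteq> T i" if "i \<le> j" for i j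
    using that
  proof (induction rule: dec_induct)
    case (step n)
    then show ?case using T_dec[of n] by blast
  qed simp
  \<comment> \<open>The equation of \<open>x\<close> reads \<open>q = x^N (p - x)\<close>, so
    multiplication by \<open>q\<close> advances the sequence by \<open>N\<close> places.\<close>
  have T_shift: "q \<otimes> a \<in> T (i + N)" if a: "a \<in> T i" for a i
  proof -
    obtain a' where a': "a \<in> carrier R" "a' \<in> M" "c [^] i \<otimes> a = b [^] i \<otimes> a'"
      using a unfolding T_iff by blast
    obtain a1 where a1: "a1 \<in> M" "b \<otimes> a' = c \<otimes> a1" using stab[OF a'(2)] ..
    have cc: "a' \<in> carrier R" "a1 \<in> carrier R" using Mc a' a1 by auto
    have id: "c \<otimes> (cN \<otimes> q \<otimes> a') = (p \<otimes> bN \<otimes> c \<ominus> bN \<otimes> b) \<otimes> a'"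
      if "cN \<in> carrier R" "bN \<in> carrier R" "bN \<otimes> b = p \<otimes> bN \<otimes> c \<ominus> q \<otimes> (cN \<otimes> c)" for bN cN
      unfolding that(3) using that(1,2) p c qc cc by algebra
    have id2: "(p \<otimes> bN \<otimes> c \<ominus> bN \<otimes> b) \<otimes> a' = bN \<otimes> (p \<otimes> c \<otimes> a' \<ominus> b \<otimes> a')" if "bN \<in> carrier R" for bN
      using that p c b cc by algebra
    have id3: "bN \<otimes> (p \<otimes> c \<otimes> a' \<ominus> c \<otimes> a1) = c \<otimes> (bN \<otimes> (p \<otimes> a' \<ominus> a1))" if "bN \<in> carrier R" for bN
      using that p c b cc by algebra
    have "c \<otimes> (c [^] N \<otimes> q \<otimes> a') = b [^] N \<otimes> (p \<otimes> c \<otimes> a' \<ominus> b \<otimes> a')"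
      using id[OF cp bp bSN] id2[OF bp] by simp
    also have "\<dots> = c \<otimes> (b [^] N \<otimes> (p \<otimes> a' \<ominus> a1))" unfolding a1(2) by (rule id3[OF bp])
    finally have e: "c [^] N \<otimes> q \<otimes> a' = b [^] N \<otimes> (p \<otimes> a' \<ominus> a1)"
      using lcancel[OF _ c c0] p qc cc bp cp by simp
    have "c [^] (i + N) \<otimes> (q \<otimes> a) = c [^] N \<otimes> q \<otimes> (c [^] i \<otimes> a)"
      unfolding nat_pow_mult[OF c, symmetric] using cp qc a'(1) by (simp add: m_ac)
    also have "\<dots> = b [^] i \<otimes> (c [^] N \<otimes> q \<otimes> a')" unfolding a'(3) using cp bp qc cc by (simp add: m_lcomm)
    also have "\<dots> = b [^] (i + N) \<otimes> (p \<otimes> a' \<ominus> a1)"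
      unfolding e nat_pow_mult[OF b, symmetric] using bp p cc by (simp add: m_assoc)
    finally show ?thesis
      unfolding T_iff using Mdiff[OF Mmult[OF p a'(2)] a1(1)] qc a'(1) by blast
  qed
  \<comment> \<open>Because \<open>c^N\<close> is a nonzero element of \<open>M\<close>, Krull's
    theorem puts a power of \<open>q\<close> into \<open>M\<close> at \<open>P\<close>. This anchors
    the lower bound of the chain.\<close>
  obtain e :: nat and s w where sw: "s \<in> S" "w \<in> carrier R" "s \<otimes> q [^] e = w \<otimes> c [^] N"
    using exists_power_multiple[OF q(1) len cp pow0[OF c c0]] by blast
  have sc: "s \<in> carrier R" using sw by blast
  have sqM: "s \<otimes> q [^] e \<in> M" unfolding sw(3) by (rule Mmult[OF sw(2) cN])
  have low: "s \<otimes> q [^] (e + j) \<in> T (j * N)" for j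
  proof (induction j)
    case 0
    show ?case unfolding T_iff using sqM Mc by auto
  next
    case (Suc j)
    have "s \<otimes> q [^] (e + Suc j) = q \<otimes> (s \<otimes> q [^] (e + j))" using sc qp qc by (simp add: m_ac)
    then show ?case using T_shift[OF Suc.IH] by (simp add: add.commute)
  qed
  \<comment> \<open>Equality at place \<open>i\<close> gives \<open>M = x M\<close> at
    \<open>P\<close> after division by \<open>x^i\<close>. The equation then gives
    \<open>M = q M\<close> at \<open>P\<close>. Iterating once more than the exponent
    \<open>e\<close> puts \<open>s q^e\<close> into \<open>q^(e+1) M\<close> up to a factor outside
    \<open>P\<close>, and cancelling \<open>q^e\<close> puts an element outside \<open>P\<close>
    into \<open>(q)\<close>.\<close>
  have strict: "\<not> T i \<preceq> T (Suc i)" for i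
  proof
    assume le: "T i \<preceq> T (Suc i)"
    have H1: "\<exists>t\<in>S. \<exists>a'\<in>M. t \<otimes> (c \<otimes> a) = b \<otimes> a'" if a: "a \<in> M" for a
    proof -
      obtain a0 where a0: "a0 \<in> M" "b [^] i \<otimes> a = c [^] i \<otimes> a0" using stab_pow[OF a] ..
      have "a0 \<in> T i" unfolding T_iff using a0 a Mc by metis
      then obtain t where t: "t \<in> S" "t \<otimes> a0 \<in> T (Suc i)" using le unfolding loc_le_def by blast
      then obtain a' where a': "a' \<in> M" "c [^] Suc i \<otimes> (t \<otimes> a0) = b [^] Suc i \<otimes> a'"
        unfolding T_iff by blast
      have tc: "t \<in> carrier R" using t by blast
      have "b [^] i \<otimes> (t \<otimes> (c \<otimes> a)) = t \<otimes> c \<otimes> (b [^] i \<otimes> a)"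
        using bp tc c Mc[OF a] by (simp add: m_ac)
      also have "\<dots> = c [^] Suc i \<otimes> (t \<otimes> a0)" unfolding a0(2) using cp tc c Mc[OF a0(1)] by (simp add: m_ac)
      also have "\<dots> = b [^] i \<otimes> (b \<otimes> a')" unfolding a'(2) using bp b Mc[OF a'(1)] by (simp add: m_ac)
      finally have "t \<otimes> (c \<otimes> a) = b \<otimes> a'"
        using lcancel[OF _ bp pow0[OF b b0]] tc c b Mc[OF a] Mc[OF a'(1)] by simp
      then show ?thesis using t(1) a'(1) by blast
    qed
    have H2: "\<exists>t\<in>S. \<exists>a'\<in>M. t \<otimes> (c [^] k \<otimes> a) = b [^] k \<otimes> a'" if a: "a \<in> M" for a and k :: nat
    proof (induction k)
      case 0
      show ?case using a Mc S_one by (intro bexI[of _ \<one>] bexI[of _ a]) auto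
    next
      case (Suc k)
      then obtain t a' where t: "t \<in> S" "a' \<in> M" "t \<otimes> (c [^] k \<otimes> a) = b [^] k \<otimes> a'" by blast
      obtain u a'' where u: "u \<in> S" "a'' \<in> M" "u \<otimes> (c \<otimes> a') = b \<otimes> a''" using H1[OF t(2)] by blast
      have cc: "t \<in> carrier R" "u \<in> carrier R" using t u by auto
      have "(u \<otimes> t) \<otimes> (c [^] Suc k \<otimes> a) = u \<otimes> c \<otimes> (t \<otimes> (c [^] k \<otimes> a))"
        using cc c cp Mc[OF a] by (simp add: m_ac)
      also have "\<dots> = b [^] k \<otimes> (u \<otimes> (c \<otimes> a'))" unfolding t(3) using cc c bp Mc[OF t(2)] by (simp add: m_ac)
      also have "\<dots> = b [^] Suc k \<otimes> a''" unfolding u(3) using b bp Mc[OF u(2)] by (simp add: m_assoc)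
      finally show ?case using S_mult[OF u(1) t(1)] u(2) by blast
    qed
    \<comment> \<open>Here the hypothesis that \<open>q\<close> divides \<open>p\<close> at
      \<open>P\<close> is used: \<open>x^(N+1) = p x^N - q\<close> becomes a multiple of
      \<open>q\<close>.\<close>
    have H3: "\<exists>t\<in>S. \<exists>a'\<in>M. t \<otimes> a = q \<otimes> a'" if a: "a \<in> M" for a
    proof -
      obtain t a' where t: "t \<in> S" "a' \<in> M" "t \<otimes> (c [^] Suc N \<otimes> a) = b [^] Suc N \<otimes> a'"
        using H2[OF a, of "Suc N"] by blast
      obtain a3 where a3: "a3 \<in> M" "b [^] N \<otimes> a' = c [^] N \<otimes> a3" using stab_pow[OF t(2)] ..
      have cc: "t \<in> carrier R" "a' \<in> carrier R" "a3 \<in> carrier R" "a \<in> carrier R" using t Mc a a3 by auto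
      have id: "(s0 \<otimes> t) \<otimes> ((cN \<otimes> c) \<otimes> a) = (cN \<otimes> c) \<otimes> (q \<otimes> (r \<otimes> a3 \<ominus> s0 \<otimes> a'))"
        if cb: "cN \<in> carrier R" "bN \<in> carrier R" "t \<otimes> ((cN \<otimes> c) \<otimes> a) = (bN \<otimes> b) \<otimes> a'" "bN \<otimes> a' = cN \<otimes> a3"
          "bN \<otimes> b = p \<otimes> bN \<otimes> c \<ominus> q \<otimes> (cN \<otimes> c)" for cN bN
      proof -
        have "(s0 \<otimes> t) \<otimes> ((cN \<otimes> c) \<otimes> a) = s0 \<otimes> (t \<otimes> ((cN \<otimes> c) \<otimes> a))"
          using cb(1,2) s0c cc c by algebra
        also have "\<dots> = s0 \<otimes> ((p \<otimes> bN \<otimes> c \<ominus> q \<otimes> (cN \<otimes> c)) \<otimes> a')" unfolding cb(3,5) ..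
        also have "\<dots> = (s0 \<otimes> p) \<otimes> c \<otimes> (bN \<otimes> a') \<ominus> s0 \<otimes> q \<otimes> (cN \<otimes> c) \<otimes> a'"
          using cb(1,2) s0c cc c p qc by algebra
        also have "\<dots> = (cN \<otimes> c) \<otimes> (q \<otimes> (r \<otimes> a3 \<ominus> s0 \<otimes> a'))"
          unfolding cb(4) s0(3) using cb(1,2) s0c s0(2) cc c p qc by algebra
        finally show ?thesis .
      qed
      have "(c [^] N \<otimes> c) \<otimes> ((s0 \<otimes> t) \<otimes> a) = (s0 \<otimes> t) \<otimes> ((c [^] N \<otimes> c) \<otimes> a)"
        using cp c s0c cc by (simp add: m_lcomm)
      also have "\<dots> = (c [^] N \<otimes> c) \<otimes> (q \<otimes> (r \<otimes> a3 \<ominus> s0 \<otimes> a'))"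
        by (rule id[OF cp bp _ a3(2) bSN]) (use t(3) in simp)
      finally have "(s0 \<otimes> t) \<otimes> a = q \<otimes> (r \<otimes> a3 \<ominus> s0 \<otimes> a')"
        using lcancel[OF _ cp[of "Suc N"] pow0[OF c c0]] s0c s0(2) cc qc by simp
      then show ?thesis
        using S_mult[OF s0(1) t(1)] Mdiff[OF Mmult[OF s0(2) a3(1)] Mmult[OF s0c t(2)]] by blast
    qed
    have H4: "\<exists>t\<in>S. \<exists>a'\<in>M. t \<otimes> a = q [^] k \<otimes> a'" if a: "a \<in> M" for a and k :: nat
    proof (induction k)
      case 0
      show ?case using a Mc S_one by (intro bexI[of _ \<one>] bexI[of _ a]) auto
    next
      case (Suc k)
      then obtain t a' where t: "t \<in> S" "a' \<in> M" "t \<otimes> a = q [^] k \<otimes> a'" by blast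
      obtain u a'' where u: "u \<in> S" "a'' \<in> M" "u \<otimes> a' = q \<otimes> a''" using H3[OF t(2)] by blast
      have cc: "t \<in> carrier R" "u \<in> carrier R" using t u by auto
      have "(u \<otimes> t) \<otimes> a = u \<otimes> (t \<otimes> a)" using cc Mc[OF a] by (simp add: m_assoc)
      also have "\<dots> = q [^] k \<otimes> (u \<otimes> a')" unfolding t(3) using cc qp Mc[OF t(2)] by (simp add: m_lcomm)
      also have "\<dots> = q [^] Suc k \<otimes> a''" unfolding u(3) using qp qc Mc[OF u(2)] by (simp add: m_assoc)
      finally show ?case using S_mult[OF u(1) t(1)] u(2) by blast
    qed
    obtain t a' where t: "t \<in> S" "a' \<in> M" "t \<otimes> (s \<otimes> q [^] e) = q [^] Suc e \<otimes> a'"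
      using H4[OF sqM, of "Suc e"] by blast
    have tc: "t \<in> carrier R" using t by blast
    have "q [^] e \<otimes> (t \<otimes> s) = q [^] e \<otimes> (a' \<otimes> q)"
      using t(3) qp qc tc sc Mc[OF t(2)] by (simp add: m_ac)
    then have "t \<otimes> s = a' \<otimes> q"
      using lcancel[OF _ qp pow0[OF qc q(2)]] qc tc sc Mc[OF t(2)] by simp
    then have "t \<otimes> s \<in> P" using ideal_memD(5)[OF P_ideal q(1) Mc[OF t(2)]] by simp
    then show False using S_mult[OF t(1) sw(1)] by blast
  qed
  \<comment> \<open>The \<open>j N\<close> strict steps must fit into the length
    \<open>(e + j) l\<close>. As \<open>N > l\<close>, this would force
    \<open>j \<le> e l\<close>.\<close>
  define j where "j = e * l + 1"
  have "descending (carrier R) (PIdl (q [^] (e + j))) T (j * N)"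
    unfolding descending_def
  proof (intro conjI allI impI)
    fix i
    show "ideal (T i) R" by (rule T_ideal)
    show "T i \<subseteq> carrier R" by (rule ideal_memD(1)[OF T_ideal])
    show "T (Suc i) \<subseteq> T i" by (rule T_dec)
  next
    fix i assume i: "i \<le> j * N"
    show "PIdl (q [^] (e + j)) \<preceq> T i"
      unfolding loc_le_def
    proof
      fix x assume "x \<in> PIdl (q [^] (e + j))"
      then obtain u where u: "u \<in> carrier R" "x = u \<otimes> q [^] (e + j)" unfolding PIdl_iff by blast
      have "s \<otimes> x = u \<otimes> (s \<otimes> q [^] (e + j))" unfolding u(2) using u(1) sc qp by (simp add: m_lcomm)
      also have "\<dots> \<in> T i"
        by (rule ideal_memD(5)[OF T_ideal _ u(1)]) (use low T_le[OF i] in blast)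
      finally show "\<exists>s\<in>S. s \<otimes> x \<in> T i" using sw(1) by blast
    qed
  qed
  then have "card {i. i < j * N \<and> \<not> T i \<preceq> T (Suc i)} \<le> (e + j) * l"
    using length_le_power[OF qc len, of "e + j"] unfolding length_le_def by blast
  moreover have "{i. i < j * N \<and> \<not> T i \<preceq> T (Suc i)} = {..<j * N}" using strict by auto
  ultimately have "j * N \<le> (e + j) * l" by simp
  moreover have "j * (l + 1) \<le> j * N" using N by (intro mult_le_mono2) simp
  ultimately have "j * (l + 1) \<le> (e + j) * l" by linarith
  then have "j \<le> e * l" by (simp add: algebra_simps)
  then show False unfolding j_def by simp
qed

text \<open>
  The iteration \<open>x/z \<mapsto> p - q (z/x)^N\<close> converges \<open>q\<close>-adically to the root of
  \<open>X^(N+1) - p X^N + q\<close> that is congruent to the unit \<open>p\<close> modulo \<open>P\<close>.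
\<close>

lemma approximate_root:
  fixes N e :: nat
  assumes p: "p \<in> S" and q: "q \<in> P"
  shows "\<exists>x\<in>S. \<exists>z\<in>S. \<exists>y\<in>carrier R.
    x [^] Suc N \<oplus> q \<otimes> z [^] Suc N \<ominus> p \<otimes> x [^] N \<otimes> z = q [^] e \<otimes> y"
proof (induction e)
  case 0
  have "p \<in> carrier R" "q \<in> carrier R" using p q ideal_memD(7)[OF P_ideal] by auto
  then show ?case
    using S_one by (intro bexI[of _ \<one>] bexI[of _ "\<one> \<oplus> q \<otimes> \<one> \<ominus> p"]) auto
next
  case (Suc e)
  have pq: "p \<in> carrier R" "q \<in> carrier R" using p q ideal_memD(7)[OF P_ideal] by auto
  from Suc obtain x z y where x: "x \<in> S" "z \<in> S" "y \<in> carrier R"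
    "x [^] Suc N \<oplus> q \<otimes> z [^] Suc N \<ominus> p \<otimes> x [^] N \<otimes> z = q [^] e \<otimes> y"
    by blast
  have xz: "x \<in> carrier R" "z \<in> carrier R" using x by auto
  define x' where "x' = p \<otimes> x [^] N \<ominus> q \<otimes> z [^] N"
  have x'c: "x' \<in> carrier R" unfolding x'_def using pq xz by simp
  have id0: "u \<ominus> v \<oplus> v = u" if "u \<in> carrier R" "v \<in> carrier R" for u v
    using that by algebra
  have x'S: "x' \<in> S"
  proof -
    have "x' \<notin> P"
    proof
      assume "x' \<in> P"
      moreover have "q \<otimes> z [^] N \<in> P" using ideal_memD(6)[OF P_ideal q] xz by simp
      ultimately have "x' \<oplus> q \<otimes> z [^] N \<in> P" by (rule ideal_memD(3)[OF P_ideal])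
      then have "p \<otimes> x [^] N \<in> P" unfolding x'_def using id0[of "p \<otimes> x [^] N" "q \<otimes> z [^] N"] pq xz by simp
      then show False using S_mult[OF p S_pow[OF x(1)]] by blast
    qed
    then show ?thesis using x'c by blast
  qed
  \<comment> \<open>The difference \<open>U - V\<close> is the previous value of the form, whereas
    the new value is \<open>q (U^N - V^N)\<close>. Since \<open>U - V\<close> divides
    \<open>U^N - V^N\<close>, exactly one further factor \<open>q\<close> is extracted.\<close>
  define U where "U = x [^] Suc N" define V where "V = z \<otimes> x'"
  have UV: "U \<in> carrier R" "V \<in> carrier R" unfolding U_def V_def using xz x'c by auto
  obtain w where w: "w \<in> carrier R" "U [^] N \<ominus> V [^] N = (U \<ominus> V) \<otimes> w"
    using nat_pow_diff_factor[OF UV] by blast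
  have id1: "xN \<otimes> x \<ominus> z \<otimes> (p \<otimes> xN \<ominus> q \<otimes> zN) = xN \<otimes> x \<oplus> q \<otimes> (zN \<otimes> z) \<ominus> p \<otimes> xN \<otimes> z"
    if "xN \<in> carrier R" "zN \<in> carrier R" for xN zN
    using that xz pq by algebra
  have UmV: "U \<ominus> V = q [^] e \<otimes> y"
    unfolding U_def V_def x'_def nat_pow_Suc
    using id1[of "x [^] N" "z [^] N"] x(4) xz by simp
  have id2: "x'N \<otimes> (p \<otimes> xN \<ominus> q \<otimes> zN) \<oplus> q \<otimes> uN \<ominus> p \<otimes> x'N \<otimes> xN = q \<otimes> (uN \<ominus> zN \<otimes> x'N)"
    if "xN \<in> carrier R" "zN \<in> carrier R" "x'N \<in> carrier R" "uN \<in> carrier R" for xN zN x'N uN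
    using that pq by algebra
  have "(x [^] N) [^] Suc N = U [^] N"
    unfolding U_def using xz by (simp only: nat_pow_pow mult.commute)
  then have "x' [^] Suc N \<oplus> q \<otimes> (x [^] N) [^] Suc N \<ominus> p \<otimes> x' [^] N \<otimes> x [^] N
      = x' [^] N \<otimes> (p \<otimes> x [^] N \<ominus> q \<otimes> z [^] N) \<oplus> q \<otimes> U [^] N \<ominus> p \<otimes> x' [^] N \<otimes> x [^] N"
    by (simp only: nat_pow_Suc[of x'] x'_def[symmetric])
  also have "\<dots> = q \<otimes> (U [^] N \<ominus> z [^] N \<otimes> x' [^] N)"
    by (rule id2) (use xz x'c UV in simp_all)
  also have "z [^] N \<otimes> x' [^] N = V [^] N"
    unfolding V_def using xz x'c by (simp add: nat_pow_distrib)
  also have "q \<otimes> (U [^] N \<ominus> V [^] N) = q [^] Suc e \<otimes> (y \<otimes> w)"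
    unfolding w(2) UmV using pq x(3) w(1) by (simp add: m_ac)
  finally show ?case
    using x'S S_pow[OF x(1), of N] x(3) w(1) by blast
qed

end

text \<open>The form is the norm of \<open>X - \<theta> Z\<close> for the class
  \<open>\<theta>\<close> of \<open>T\<close> modulo \<open>T^(N+1) - p T^N + q\<close>. For nonzero
  \<open>t\<close>, values divisible by a high power of \<open>q\<close> exist by the iteration at
  \<open>P\<close>, and at \<open>P\<close> such a power is a multiple of \<open>t\<close>. For
  \<open>t = 0\<close> the form would vanish with \<open>z\<close> outside \<open>P\<close>, which
  \<open>no_root\<close> at the other prime \<open>P'\<close> excludes.\<close>

lemma (in noetherian_domain) nonzero_iff_divides_norm:
  assumes P: "primeideal P R" and q1: "q1 \<in> P" "q1 \<noteq> \<zero>"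
    and min: "\<And>Q. primeideal Q R \<Longrightarrow> q1 \<in> Q \<Longrightarrow> Q \<subseteq> P \<Longrightarrow> Q = P"
    and Q: "primeideal Q R" and p0: "p0 \<in> Q" "p0 \<notin> P"
  shows "\<exists>(N::nat). \<exists>p\<in>carrier R. \<exists>q\<in>carrier R. \<forall>t\<in>carrier R. t \<noteq> \<zero> \<longleftrightarrow>
    (\<exists>s\<in>carrier R - P. \<exists>z\<in>carrier R - P. \<exists>x\<in>carrier R. \<exists>w\<in>carrier R.
      s \<otimes> (x [^] Suc N \<oplus> q \<otimes> z [^] Suc N \<ominus> p \<otimes> x [^] N \<otimes> z) = w \<otimes> t)"
proof -
  have q1c: "q1 \<in> carrier R" and p0c: "p0 \<in> carrier R"
    using ideal_memD(7)[OF primeideal.axioms(1)[OF P] q1(1)] ideal_memD(7)[OF primeideal.axioms(1)[OF Q] p0(1)] .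
  have p00: "p0 \<noteq> \<zero>" using p0(2) ideal_memD(2)[OF primeideal.axioms(1)[OF P]] by blast
  have sub: "{p0} \<subseteq> Q" using p0(1) by simp
  obtain P' where ex: "primeideal P' R \<and> {p0} \<subseteq> P' \<and> P' \<subseteq> Q \<and>
      (\<forall>Q'. primeideal Q' R \<longrightarrow> {p0} \<subseteq> Q' \<longrightarrow> Q' \<subseteq> P' \<longrightarrow> Q' = P')"
    using exists_minimal_prime[OF Q sub] ..
  note P' = ex[THEN conjunct1] ex[THEN conjunct2, THEN conjunct1]
    ex[THEN conjunct2, THEN conjunct2, THEN conjunct1]
    ex[THEN conjunct2, THEN conjunct2, THEN conjunct2, rule_format]
  interpret L: noetherian_domain_prime R P
    by (intro noetherian_domain_prime.intro noetherian_prime.intro noetherian_prime_axioms.intro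
        noetherian_cring_axioms domain_axioms P)
  interpret L': noetherian_domain_prime R P'
    by (intro noetherian_domain_prime.intro noetherian_prime.intro noetherian_prime_axioms.intro
        noetherian_cring_axioms domain_axioms P'(1))
  \<comment> \<open>The factor \<open>q1\<close> puts \<open>q\<close> into \<open>P\<close> and the
    factor \<open>p0\<close> puts it into \<open>P'\<close>. As \<open>p0\<close> is outside
    \<open>P\<close>, the prime \<open>P\<close> is still minimal over \<open>q\<close>.\<close>
  define q where "q = q1 \<otimes> p0"
  have qc: "q \<in> carrier R" and q0: "q \<noteq> \<zero>"
    unfolding q_def using q1c p0c q1(2) p00 by (simp_all add: integral_iff)
  have qP: "q \<in> P" and qP': "q \<in> P'"
    unfolding q_def
    using ideal_memD(6)[OF L.P_ideal q1(1) p0c] ideal_memD(5)[OF L'.P_ideal _ q1c] P'(2) by auto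
  have PI: "x \<in> Q'" if "PIdl x \<subseteq> Q'" "x \<in> carrier R" for x Q'
    using that cgenideal_self by blast
  have "\<exists>n. L'.length_le (carrier R) (PIdl p0) n"
  proof (rule L'.exists_length_le[OF cgenideal_ideal[OF p0c]])
    show "Q' = P'" if "primeideal Q' R" "PIdl p0 \<subseteq> Q'" "Q' \<subseteq> P'" for Q'
      using P'(4)[OF that(1) _ that(3)] PI[OF that(2) p0c] by simp
  qed
  then obtain l0 where l0: "L'.length_le (carrier R) (PIdl p0) l0" ..
  \<comment> \<open>Krull's theorem at \<open>P'\<close> makes a power of \<open>p0\<close> a
    multiple of \<open>q\<close> there. This power is taken as \<open>p\<close>; the same relation
    shows that \<open>P'\<close> is minimal over \<open>q\<close>, so that \<open>R/q\<close> has
    finite length at \<open>P'\<close> as well.\<close>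
  obtain e s0 r where er: "s0 \<in> carrier R - P'" "r \<in> carrier R" "s0 \<otimes> p0 [^] (e::nat) = r \<otimes> q"
    using L'.exists_power_multiple[OF _ l0 qc q0] P'(2) by blast
  have "\<exists>n. L'.length_le (carrier R) (PIdl q) n"
  proof (rule L'.exists_length_le[OF cgenideal_ideal[OF qc]])
    fix Q' assume Q': "primeideal Q' R" "PIdl q \<subseteq> Q'" "Q' \<subseteq> P'"
    have "s0 \<otimes> p0 [^] e \<in> Q'"
      unfolding er(3) using ideal_memD(5)[OF primeideal.axioms(1)[OF Q'(1)] PI[OF Q'(2) qc] er(2)] .
    moreover have "s0 \<in> carrier R - Q'" using er(1) Q'(3) by blast
    ultimately have "p0 \<in> Q'"
      using primeideal_compl(2,3)[OF Q'(1)] p0c by blast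
    then show "Q' = P'" using P'(4)[OF Q'(1) _ Q'(3)] by simp
  qed
  then obtain l where l: "L'.length_le (carrier R) (PIdl q) l" ..
  have "\<exists>n. L.length_le (carrier R) (PIdl q) n"
  proof (rule L.exists_length_le[OF cgenideal_ideal[OF qc]])
    fix Q' assume Q': "primeideal Q' R" "PIdl q \<subseteq> Q'" "Q' \<subseteq> P"
    have "q1 \<otimes> p0 \<in> Q'" using PI[OF Q'(2) qc] unfolding q_def .
    moreover have "p0 \<in> carrier R - Q'" using p0(2) p0c Q'(3) by blast
    ultimately have "q1 \<in> Q'" using primeideal_compl(2)[OF Q'(1), of q1 p0] q1c by blast
    then show "Q' = P" using min[OF Q'(1) _ Q'(3)] by simp
  qed
  then obtain l1 where l1: "L.length_le (carrier R) (PIdl q) l1" ..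
  define p where "p = p0 [^] e"
  \<comment> \<open>The exponent only has to exceed the length at \<open>P'\<close>; the length at
    \<open>P\<close> does not influence it.\<close>
  define N where "N = Suc l"
  have pc: "p \<in> carrier R" unfolding p_def using p0c by simp
  have pS: "p \<in> carrier R - P"
    unfolding p_def by (rule L.S_pow) (use p0(2) p0c in blast)
  have main: "t \<noteq> \<zero> \<longleftrightarrow>
    (\<exists>s\<in>carrier R - P. \<exists>z\<in>carrier R - P. \<exists>x\<in>carrier R. \<exists>w\<in>carrier R.
      s \<otimes> (x [^] Suc N \<oplus> q \<otimes> z [^] Suc N \<ominus> p \<otimes> x [^] N \<otimes> z) = w \<otimes> t)" (is "_ \<longleftrightarrow> ?F")
    if t: "t \<in> carrier R" for t
  proof
    assume t0: "t \<noteq> \<zero>"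
    obtain d s w where d: "s \<in> carrier R - P" "w \<in> carrier R" "s \<otimes> q [^] (d::nat) = w \<otimes> t"
      using L.exists_power_multiple[OF qP l1 t t0] by blast
    obtain x z y where x: "x \<in> carrier R - P" "z \<in> carrier R - P" "y \<in> carrier R"
      "x [^] Suc N \<oplus> q \<otimes> z [^] Suc N \<ominus> p \<otimes> x [^] N \<otimes> z = q [^] d \<otimes> y"
      using L.approximate_root[OF pS qP, of N d] by blast
    have "s \<otimes> (q [^] d \<otimes> y) = (s \<otimes> q [^] d) \<otimes> y" using d(1) qc x(3) by (simp add: m_assoc)
    also have "\<dots> = (w \<otimes> y) \<otimes> t" unfolding d(3) using d(2) t x(3) by (simp add: m_ac)
    finally have "s \<otimes> (x [^] Suc N \<oplus> q \<otimes> z [^] Suc N \<ominus> p \<otimes> x [^] N \<otimes> z) = (w \<otimes> y) \<otimes> t"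
      unfolding x(4) .
    moreover have "w \<otimes> y \<in> carrier R" "x \<in> carrier R" using d(2) x by auto
    ultimately show ?F using d(1) x(2) by blast
  next
    assume ?F
    then obtain s z x w where f: "s \<in> carrier R - P" "z \<in> carrier R - P" "x \<in> carrier R" "w \<in> carrier R"
      "s \<otimes> (x [^] Suc N \<oplus> q \<otimes> z [^] Suc N \<ominus> p \<otimes> x [^] N \<otimes> z) = w \<otimes> t" by blast
    have nz: "s \<noteq> \<zero>" "z \<noteq> \<zero>" using f(1,2) ideal_memD(2)[OF L.P_ideal] by auto
    have zc: "z \<in> carrier R" "s \<in> carrier R" using f by auto
    show "t \<noteq> \<zero>"
    proof
      assume "t = \<zero>"
      then have "s \<otimes> (x [^] Suc N \<oplus> q \<otimes> z [^] Suc N \<ominus> p \<otimes> x [^] N \<otimes> z) = \<zero>"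
        using f(4,5) by simp
      then have "x [^] Suc N \<oplus> q \<otimes> z [^] Suc N \<ominus> p \<otimes> x [^] N \<otimes> z = \<zero>"
        using integral_iff[of s] nz(1) zc f(3) qc pc by simp
      then have "x [^] Suc N \<oplus> q \<otimes> z [^] Suc N = p \<otimes> x [^] N \<otimes> z"
        using zc f(3) qc pc by (simp add: r_right_minus_eq)
      then have "z = \<zero>"
        using L'.no_root[OF qP' q0 l _ pc er(1,2) _ f(3) zc(1), of N] er(3)
        unfolding N_def p_def by simp
      then show False using nz(2) by blast
    qed
  qed
  show ?thesis
    by (intro exI[of _ N] bexI[OF _ pc] bexI[OF _ qc] ballI) (rule main)
qed


section \<open>Existential definability of complements of prime ideals\<close>

context cring
begin

lemmas polyfun_intros = polyfun_const polyfun_add polyfun_mult polyfun_minus polyfun_nat_pow polyfun_nth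

lemma pe_subst1:
  assumes "pe 1 (\<lambda>t. P (t ! 0))" "polyfun r \<phi>"
  shows "pe r (\<lambda>t. P (\<phi> t))"
  using pe_subst[OF assms(1), of "[\<phi>]" r] assms(2) by simp

definition submod :: "nat \<Rightarrow> 'a list set \<Rightarrow> bool"
  where "submod n N \<longleftrightarrow> N \<subseteq> tuples R n \<and> replicate n \<zero> \<in> N \<and>
    (\<forall>u\<in>N. \<forall>v\<in>N. \<forall>a\<in>carrier R. map (\<lambda>j. u ! j \<oplus> a \<otimes> v ! j) [0..<n] \<in> N)"

lemma submodD:
  assumes "submod n N"
  shows "\<And>u. u \<in> N \<Longrightarrow> u \<in> tuples R n" "replicate n \<zero> \<in> N"
    "\<And>u v a. u \<in> N \<Longrightarrow> v \<in> N \<Longrightarrow> a \<in> carrier R \<Longrightarrow> map (\<lambda>j. u ! j \<oplus> a \<otimes> v ! j) [0..<n] \<in> N"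
  using assms unfolding submod_def by (simp_all add: subset_iff)

lemma genideal_insert_iff:
  assumes "S \<subseteq> carrier R" "g \<in> carrier R"
  shows "x \<in> Idl (insert g S) \<longleftrightarrow> (\<exists>y\<in>Idl S. \<exists>a\<in>carrier R. x = y \<oplus> a \<otimes> g)"
proof -
  have "Idl (insert g S) = Idl S <+>\<^bsub>R\<^esub> PIdl g"
  proof
    have S: "ideal (Idl S) R" and g: "ideal (PIdl g) R"
      using assms by (auto intro: genideal_ideal cgenideal_ideal)
    show "Idl (insert g S) \<subseteq> Idl S <+>\<^bsub>R\<^esub> PIdl g"
      by (rule genideal_minimal[OF add_ideals[OF S g]])
        (use ideal_sum_upper[OF S g] genideal_self[OF assms(1)] cgenideal_self[OF assms(2)] in auto)
    have I: "ideal (Idl (insert g S)) R"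
      using assms by (intro genideal_ideal) auto
    have sub: "insert g S \<subseteq> Idl (insert g S)"
      using assms by (intro genideal_self) auto
    have "Idl S \<subseteq> Idl (insert g S)" by (rule genideal_minimal[OF I]) (use sub in auto)
    moreover have "PIdl g \<subseteq> Idl (insert g S)" by (rule cgenideal_minimal[OF I]) (use sub in auto)
    ultimately show "Idl S <+>\<^bsub>R\<^esub> PIdl g \<subseteq> Idl (insert g S)"
      unfolding subset_iff ideal_sum_iff using ideal_memD(3)[OF I] by (metis subsetD)
  qed
  then show ?thesis by (simp only: ideal_sum_PIdl_iff)
qed

lemma genideal_empty: "Idl {} = {\<zero>}"
  using genideal_minimal[OF zeroideal, of "{}"] ideal_memD(2)[OF genideal_ideal[of "{}"]] by auto

end

context noetherian_cring
begin

text \<open>The proof that submodules of \<open>R^n\<close> are finitely generated, turned into a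
  formula. The first coordinates of \<open>N\<close> form an ideal with finitely many generators,
  each the first coordinate of some \<open>v\<close> in \<open>N\<close>. Subtracting existentially
  quantified multiples of these vectors makes the first coordinate zero, and the remaining
  coordinates lie in a submodule of \<open>R^(n-1)\<close>.\<close>

lemma pe_submod: "submod n N \<Longrightarrow> pe n (\<lambda>t. t \<in> N)"
proof (induction n arbitrary: N)
  case 0
  then have "[] \<in> N" using submodD(2)[of 0 N] by simp
  then show ?case
    by (intro pe_cong[OF pe_True]) (simp add: tuples_def)
next
  case (Suc n)
  note N = submodD[OF Suc.prems]
  define N0 where "N0 = {w. \<zero> # w \<in> N}"
  have cons: "map f [0..<Suc n] = f 0 # map (\<lambda>j. f (Suc j)) [0..<n]" for f :: "nat \<Rightarrow> 'a"
    by (simp add: map_upt_Suc del: upt_Suc)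
  have "submod n N0"
    unfolding submod_def
  proof (intro conjI ballI subsetI)
    show "w \<in> tuples R n" if "w \<in> N0" for w
      using N(1)[of "\<zero> # w"] that unfolding N0_def by (simp add: tuples_def)
    show "replicate n \<zero> \<in> N0" using N(2) unfolding N0_def by simp
    fix u v a assume uv: "u \<in> N0" "v \<in> N0" "a \<in> carrier R"
    then have "map (\<lambda>j. (\<zero> # u) ! j \<oplus> a \<otimes> (\<zero> # v) ! j) [0..<Suc n] \<in> N"
      unfolding N0_def by (intro N(3)) auto
    then show "map (\<lambda>j. u ! j \<oplus> a \<otimes> v ! j) [0..<n] \<in> N0"
      unfolding N0_def cons using uv(3) by simp
  qed
  then have pe0: "pe n (\<lambda>t. t \<in> N0)" by (rule Suc.IH)
  define I where "I = (\<lambda>v. v ! 0) ` N"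
  have I: "ideal I R"
  proof (rule ideal_of_closed)
    show "I \<subseteq> carrier R"
      unfolding I_def using nth_tuples[OF N(1)] by auto
    show "\<zero> \<in> I"
      unfolding I_def using N(2) by (intro image_eqI[of _ _ "replicate (Suc n) \<zero>"]) auto
    have lin: "x \<oplus> a \<otimes> y \<in> I" if "x \<in> I" "y \<in> I" "a \<in> carrier R" for x y a
    proof -
      obtain u v where uv: "u \<in> N" "x = u ! 0" "v \<in> N" "y = v ! 0"
        using \<open>x \<in> I\<close> \<open>y \<in> I\<close> unfolding I_def by auto
      show ?thesis
        unfolding I_def
        by (rule image_eqI[OF _ N(3)[OF uv(1,3) that(3)]]) (simp add: cons uv del: upt_Suc)
    qed
    have Ic: "x \<in> carrier R" if "x \<in> I" for x
      using that nth_tuples[OF N(1)] unfolding I_def by auto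
    show "a \<oplus> b \<in> I" if "a \<in> I" "b \<in> I" for a b
      using lin[OF that one_closed] Ic that by simp
    show "x \<otimes> a \<in> I" if "a \<in> I" "x \<in> carrier R" for a x
      using lin[OF \<open>\<zero> \<in> I\<close> that] Ic that by simp
  qed
  obtain G where G: "G \<subseteq> carrier R" "finite G" "I = Idl G"
    using finetely_gen[OF I] by auto
  \<comment> \<open>The generators are eliminated one at a time, with one new quantified coefficient
    for each. The base case \<open>S = {}\<close> is the one in which \<open>N0\<close> takes
    over.\<close>
  have "S \<subseteq> G \<Longrightarrow> pe (Suc n) (\<lambda>t. t \<in> N \<and> t ! 0 \<in> Idl S)" if "finite S" for S
    using that
  proof (induction S rule: finite_induct)
    case empty
    have 1: "pe (Suc n) (\<lambda>t. t ! 0 = \<zero>)"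
      by (intro pe_eq polyfun_intros zero_closed) simp
    have "pe (Suc n) (\<lambda>t. map ((!) t) [1..<Suc n] \<in> N0)"
      by (rule pe_reindex[OF pe0]) auto
    then have 2: "pe (Suc n) (\<lambda>t. tl t \<in> N0)"
    proof (rule pe_cong)
      fix t assume "t \<in> tuples R (Suc n)"
      then have "tl t = map ((!) t) [1..<Suc n]"
        by (intro nth_equalityI) (auto simp: tuples_def nth_tl simp del: upt_Suc)
      then show "tl t \<in> N0 \<longleftrightarrow> map ((!) t) [1..<Suc n] \<in> N0" by simp
    qed
    show ?case
    proof (rule pe_cong[OF pe_conj[OF 1 2]])
      fix t assume "t \<in> tuples R (Suc n)"
      then obtain a w where "t = a # w" by (auto simp: tuples_def length_Suc_conv)
      then show "t \<in> N \<and> t ! 0 \<in> Idl {} \<longleftrightarrow> t ! 0 = \<zero> \<and> tl t \<in> N0"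
        by (auto simp: genideal_empty N0_def)
    qed
  next
    case (insert g S)
    have S: "S \<subseteq> carrier R" and g: "g \<in> carrier R" using insert.prems G(1) by auto
    have "g \<in> I" using genideal_self[OF G(1)] insert.prems G(3) by auto
    then obtain v where v: "v \<in> N" "v ! 0 = g" unfolding I_def by auto
    note vt = nth_tuples[OF N(1)[OF v(1)]]
    let ?sub = "\<lambda>u. map (\<lambda>j. u ! j \<ominus> u ! Suc n \<otimes> v ! j) [0..<Suc n]"
    have IH: "pe (Suc n) (\<lambda>t. t \<in> N \<and> t ! 0 \<in> Idl S)" by (rule insert.IH) (use insert.prems in auto)
    have "pe (Suc n + 1) (\<lambda>u. map (\<lambda>\<psi>. \<psi> u) (map (\<lambda>j u. u ! j \<ominus> u ! Suc n \<otimes> v ! j) [0..<Suc n]) \<in> N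
        \<and> map (\<lambda>\<psi>. \<psi> u) (map (\<lambda>j u. u ! j \<ominus> u ! Suc n \<otimes> v ! j) [0..<Suc n]) ! 0 \<in> Idl S)"
    proof (rule pe_subst[OF IH])
      fix \<psi> assume "\<psi> \<in> set (map (\<lambda>j u. u ! j \<ominus> u ! Suc n \<otimes> v ! j) [0..<Suc n])"
      then have "\<psi> \<in> (\<lambda>j u. u ! j \<ominus> u ! Suc n \<otimes> v ! j) ` {..<Suc n}"
        by (simp only: set_map set_upt atLeast0LessThan)
      then obtain j where j: "j < Suc n" "\<psi> = (\<lambda>u. u ! j \<ominus> u ! Suc n \<otimes> v ! j)"
        by (elim imageE) (simp only: lessThan_iff)
      show "polyfun (Suc n + 1) \<psi>"
        unfolding j(2) by (intro polyfun_intros vt) (use j(1) in simp_all)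
    qed simp
    then have "pe (Suc n + 1) (\<lambda>u. ?sub u \<in> N \<and> ?sub u ! 0 \<in> Idl S)"
      by (simp only: map_map comp_def)
    then have "pe (Suc n) (\<lambda>t. \<exists>x\<in>tuples R 1. ?sub (t @ x) \<in> N \<and> ?sub (t @ x) ! 0 \<in> Idl S)"
      by (rule pe_ex)
    then show ?case
    proof (rule pe_cong)
      fix t assume t: "t \<in> tuples R (Suc n)"
      have len: "length t = Suc n" using t by (simp add: tuples_def)
      have sub: "?sub (t @ [a]) = map (\<lambda>j. t ! j \<ominus> a \<otimes> v ! j) [0..<Suc n]" for a
        using len by (intro map_cong refl) (auto simp: nth_append)
      have sub0: "?sub (t @ [a]) ! 0 = t ! 0 \<ominus> a \<otimes> g" for a
        unfolding sub using v(2) by (simp del: upt_Suc)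
      have tc: "t ! j \<in> carrier R" if "j < Suc n" for j using nth_tuples[OF t that] .
      have restore: "map (\<lambda>j. w ! j \<oplus> a \<otimes> v ! j) [0..<Suc n] = t"
        if "a \<in> carrier R" "w = map (\<lambda>j. t ! j \<ominus> a \<otimes> v ! j) [0..<Suc n]" for w a
      proof (rule nth_equalityI)
        fix j assume "j < length (map (\<lambda>j. w ! j \<oplus> a \<otimes> v ! j) [0..<Suc n])"
        then have j: "j < Suc n" by simp
        have "t ! j \<ominus> a \<otimes> v ! j \<oplus> a \<otimes> v ! j = t ! j"
          using tc[OF j] vt[OF j] that(1) by algebra
        then show "map (\<lambda>j. w ! j \<oplus> a \<otimes> v ! j) [0..<Suc n] ! j = t ! j"
          unfolding that(2) using j by (simp del: upt_Suc)
      qed (use len in simp)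
      show "t \<in> N \<and> t ! 0 \<in> Idl (insert g S) \<longleftrightarrow>
        (\<exists>x\<in>tuples R 1. ?sub (t @ x) \<in> N \<and> ?sub (t @ x) ! 0 \<in> Idl S)"
      proof
        assume A: "t \<in> N \<and> t ! 0 \<in> Idl (insert g S)"
        then obtain y a where y: "y \<in> Idl S" "a \<in> carrier R" "t ! 0 = y \<oplus> a \<otimes> g"
          unfolding genideal_insert_iff[OF S g] by blast
        have yc: "y \<in> carrier R" using ideal_memD(7)[OF genideal_ideal[OF S] y(1)] .
        have "map (\<lambda>j. t ! j \<oplus> (\<ominus> a) \<otimes> v ! j) [0..<Suc n] \<in> N"
          by (rule N(3)[OF conjunct1[OF A] v(1)]) (use y(2) in simp)
        also have "map (\<lambda>j. t ! j \<oplus> (\<ominus> a) \<otimes> v ! j) [0..<Suc n] = ?sub (t @ [a])"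
          unfolding sub
        proof (intro map_cong refl)
          fix j assume "j \<in> set [0..<Suc n]"
          then have "v ! j \<in> carrier R" "t ! j \<in> carrier R" using vt tc by (simp_all del: upt_Suc)
          then show "t ! j \<oplus> (\<ominus> a) \<otimes> v ! j = t ! j \<ominus> a \<otimes> v ! j"
            using y(2) by (simp add: a_minus_def l_minus)
        qed
        finally have "?sub (t @ [a]) \<in> N" .
        moreover have "?sub (t @ [a]) ! 0 = y"
          unfolding sub0 y(3) using yc y(2) g by algebra
        moreover have "[a] \<in> tuples R 1" using y(2) by (simp add: tuples_def)
        ultimately show "\<exists>x\<in>tuples R 1. ?sub (t @ x) \<in> N \<and> ?sub (t @ x) ! 0 \<in> Idl S"
          using y(1) by (intro bexI[of _ "[a]"] conjI) simp_all
      next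
        assume "\<exists>x\<in>tuples R 1. ?sub (t @ x) \<in> N \<and> ?sub (t @ x) ! 0 \<in> Idl S"
        then obtain x where x: "x \<in> tuples R 1" "?sub (t @ x) \<in> N" "?sub (t @ x) ! 0 \<in> Idl S" by auto
        then obtain a where a: "a \<in> carrier R" "x = [a]" by (auto simp: tuples_def length_Suc_conv)
        have "t \<in> N"
          using N(3)[OF x(2) v(1) a(1)] restore[OF a(1), of "?sub (t @ x)"] sub a(2) by simp
        moreover have "t ! 0 = (t ! 0 \<ominus> a \<otimes> g) \<oplus> a \<otimes> g" using tc[OF zero_less_Suc] a(1) g by algebra
        ultimately show "t \<in> N \<and> t ! 0 \<in> Idl (insert g S)"
          unfolding genideal_insert_iff[OF S g]
          using x(3)[unfolded a(2) sub0] a(1) by (intro conjI bexI[of _ "t ! 0 \<ominus> a \<otimes> g"] bexI[of _ a])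
      qed
    qed
  qed
  from this[OF G(2) subset_refl] show ?case
    by (rule pe_cong) (use G(3) I_def in auto)
qed

lemma pe_mem_ideal:
  assumes I: "ideal I R" and \<phi>: "polyfun r \<phi>"
  shows "pe r (\<lambda>t. \<phi> t \<in> I)"
proof (rule pe_subst1[OF _ \<phi>])
  note I' = ideal_memD[OF I]
  have "submod 1 ((\<lambda>a. [a]) ` I)"
    unfolding submod_def using I'(2,3,5,7) by (auto simp: tuples_def)
  then have "pe 1 (\<lambda>t. t \<in> (\<lambda>a. [a]) ` I)" by (rule pe_submod)
  then show "pe 1 (\<lambda>t. t ! 0 \<in> I)"
    by (rule pe_cong) (auto simp: tuples_def length_Suc_conv)
qed

end

section \<open>Passage to a quotient domain and back\<close>

lemma noetherian_ring_surj:
  assumes "noetherian_ring R" "ring_hom_ring R S h" and surj: "h ` carrier R = carrier S"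
  shows "noetherian_ring S"
proof -
  interpret R: noetherian_ring R by (rule assms(1))
  interpret h: ring_hom_ring R S h by (rule assms(2))
  show ?thesis
  proof (rule h.S.trivial_ideal_chain_imp_noetherian)
    fix C assume C: "C \<noteq> {}" "subset.chain {I. ideal I S} C"
    let ?pre = "\<lambda>I. {r \<in> carrier R. h r \<in> I}"
    have id: "ideal I S" if "I \<in> C" for I
      using C(2) that unfolding subset_chain_def by auto
    have tot: "I \<subseteq> J \<or> J \<subseteq> I" if "I \<in> C" "J \<in> C" for I J
      using C(2) that unfolding subset_chain_def by simp
    have "\<Union>(?pre ` C) \<in> ?pre ` C"
    proof (rule R.ideal_chain_is_trivial)
      show "?pre ` C \<noteq> {}" using C(1) by simp
      show "subset.chain {I. ideal I R} (?pre ` C)"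
        unfolding subset_chain_def
      proof (intro conjI ballI subsetI)
        fix I assume "I \<in> ?pre ` C"
        then obtain J where "J \<in> C" "I = ?pre J" by (elim imageE)
        then show "I \<in> {I. ideal I R}" using h.ideal_vimage[OF id] by simp
      next
        fix I I' assume "I \<in> ?pre ` C" "I' \<in> ?pre ` C"
        then obtain J J' where J: "J \<in> C" "I = ?pre J" "J' \<in> C" "I' = ?pre J'" by (elim imageE)
        show "I \<subseteq> I' \<or> I' \<subseteq> I"
          unfolding J(2,4) using tot[OF J(1,3)] by auto
      qed
    qed
    then obtain I0 where I0: "I0 \<in> C" "\<Union>(?pre ` C) = ?pre I0" by (elim imageE)
    have "\<Union>C \<subseteq> I0"
    proof
      fix x assume "x \<in> \<Union>C"
      then obtain I where I: "I \<in> C" "x \<in> I" by (elim UnionE)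
      have "x \<in> carrier S"
        using additive_subgroup.a_subset[OF ideal.axioms(1)[OF id[OF I(1)]]] I(2) by (rule subsetD)
      then obtain r where r: "r \<in> carrier R" "x = h r" using surj by (metis imageE)
      then have "r \<in> \<Union>(?pre ` C)" using I by auto
      then show "x \<in> I0" unfolding I0(2) r(2) by simp
    qed
    then have "\<Union>C = I0" using I0(1) by auto
    then show "\<Union>C \<in> C" using I0(1) by simp
  qed
qed

lemma (in cring) primeideal_vimage:
  assumes "ring_hom_cring R S h" "primeideal P S"
  shows "primeideal {r \<in> carrier R. h r \<in> P} R"
proof -
  interpret h: ring_hom_cring R S h by (rule assms(1))
  interpret P: primeideal P S by (rule assms(2))
  show ?thesis
  proof (rule primeidealI[OF _ is_cring])
    show "ideal {r \<in> carrier R. h r \<in> P} R"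
      by (rule h.ring.ideal_vimage[OF P.is_ideal])
    show "carrier R \<noteq> {r \<in> carrier R. h r \<in> P}"
    proof
      assume eq: "carrier R = {r \<in> carrier R. h r \<in> P}"
      have "\<one> \<in> {r \<in> carrier R. h r \<in> P}" unfolding eq[symmetric] by (rule one_closed)
      then have "\<one>\<^bsub>S\<^esub> \<in> P" by simp
      then show False using P.I_notcarr P.one_imp_carrier by simp
    qed
  qed (use P.I_prime in auto)
qed

lemma (in cring) primeideal_image:
  assumes h: "ring_hom_cring R S h" and surj: "h ` carrier R = carrier S"
    and P: "primeideal P R" and ker: "a_kernel R S h \<subseteq> P"
  shows "primeideal (h ` P) S" "\<And>r. r \<in> carrier R \<Longrightarrow> h r \<in> h ` P \<longleftrightarrow> r \<in> P"
proof -
  interpret h: ring_hom_cring R S h by (rule h)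
  note P' = ideal_memD[OF primeideal.axioms(1)[OF P]]
  show mem: "h r \<in> h ` P \<longleftrightarrow> r \<in> P" if r: "r \<in> carrier R" for r
  proof
    assume "h r \<in> h ` P"
    then obtain x where x: "x \<in> P" "h r = h x" by (elim imageE)
    have xc: "x \<in> carrier R" using x P'(7) by simp
    have "h (r \<ominus> x) = \<zero>\<^bsub>S\<^esub>"
      using r xc x(2) by (simp add: a_minus_def h.S.r_neg)
    then have "r \<ominus> x \<in> P" using ker r xc unfolding a_kernel_def' by auto
    then have "(r \<ominus> x) \<oplus> x \<in> P" using x(1) by (rule P'(3))
    moreover have "(r \<ominus> x) \<oplus> x = r" using r xc by algebra
    ultimately show "r \<in> P" by simp
  qed simp
  show "primeideal (h ` P) S"
  proof (rule primeidealI[OF _ h.S.is_cring])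
    show "ideal (h ` P) S"
    proof (rule h.S.ideal_of_closed)
      show "h ` P \<subseteq> carrier S" using P'(7) by auto
      show "\<zero>\<^bsub>S\<^esub> \<in> h ` P" using P'(2) by (intro image_eqI[of _ _ \<zero>]) auto
      show "a \<oplus>\<^bsub>S\<^esub> b \<in> h ` P" if ab: "a \<in> h ` P" "b \<in> h ` P" for a b
      proof -
        obtain x y where "x \<in> P" "a = h x" "y \<in> P" "b = h y" using ab by (elim imageE)
        then show ?thesis using P'(3,7) by (intro image_eqI[of _ _ "x \<oplus> y"]) auto
      qed
      show "x \<otimes>\<^bsub>S\<^esub> a \<in> h ` P" if xa: "a \<in> h ` P" "x \<in> carrier S" for a x
      proof -
        obtain y where y: "y \<in> P" "a = h y" using xa by (elim imageE)
        obtain r where r: "r \<in> carrier R" "x = h r" using xa(2) surj by (metis imageE)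
        show ?thesis using P'(5,7) y r by (intro image_eqI[of _ _ "r \<otimes> y"]) auto
      qed
    qed
    show "carrier S \<noteq> h ` P"
    proof
      assume "carrier S = h ` P"
      then have "h \<one> \<in> h ` P" using h.hom_closed[OF one_closed] by simp
      then have "\<one> \<in> P" unfolding mem[OF one_closed] .
      then show False using primeideal_compl(1)[OF P] by simp
    qed
    fix a b assume ab: "a \<in> carrier S" "b \<in> carrier S" "a \<otimes>\<^bsub>S\<^esub> b \<in> h ` P"
    obtain x y where xy: "x \<in> carrier R" "a = h x" "y \<in> carrier R" "b = h y"
      using ab(1,2) surj by (metis imageE)
    have "h (x \<otimes> y) \<in> h ` P" using ab(3) xy by simp
    then have "x \<otimes> y \<in> P" using mem[of "x \<otimes> y"] xy by simp
    then have "x \<in> P \<or> y \<in> P" using primeideal.I_prime[OF P xy(1,3)] by simp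
    then show "a \<in> h ` P \<or> b \<in> h ` P" using xy by auto
  qed
qed

context noetherian_cring
begin

lemma quotient_noetherian_domain:
  assumes "primeideal I R"
  shows "noetherian_domain (R Quot I)" "ring_hom_cring R (R Quot I) ((+>) I)"
    "(+>) I ` carrier R = carrier (R Quot I)" "a_kernel R (R Quot I) ((+>) I) = I"
    "\<And>t. t \<in> carrier R \<Longrightarrow> I +> t = \<zero>\<^bsub>R Quot I\<^esub> \<longleftrightarrow> t \<in> I"
proof -
  interpret I: primeideal I R by (rule assms)
  show h: "ring_hom_cring R (R Quot I) ((+>) I)" by (rule I.rcos_ring_hom_cring)
  show surj: "(+>) I ` carrier R = carrier (R Quot I)"
    unfolding FactRing_def A_RCOSETS_def' by auto
  have "noetherian_ring (R Quot I)"
    by (rule noetherian_ring_surj[OF noetherian_ring_axioms _ surj]) (rule I.rcos_ring_hom_ring)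
  then show "noetherian_domain (R Quot I)"
    using I.quotient_is_domain by (rule noetherian_domain.intro)
  show z: "I +> t = \<zero>\<^bsub>R Quot I\<^esub> \<longleftrightarrow> t \<in> I" if "t \<in> carrier R" for t
    using that I.a_rcos_const I.a_rcos_self unfolding FactRing_def by auto
  show "a_kernel R (R Quot I) ((+>) I) = I"
    unfolding a_kernel_def' using z I.a_subset by auto
qed

text \<open>Definability descends from a definable nonmaximal prime to all primes below it. The
  larger prime \<open>M\<close> supplies the element \<open>p0\<close> of a proper ideal outside
  \<open>Q\<close>. Modulo the maximal counterexample \<open>J\<close>, the formula of
  \<open>nonzero_iff_divides_norm\<close> describes the complement of zero and is lifted back to
  \<open>R\<close>.\<close>

theorem pe_compl_prime_below:
  assumes Q: "primeideal Q R" "pe 1 (\<lambda>t. t ! 0 \<notin> Q)" and M: "primeideal M R" "Q \<subset> M"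
    and I: "primeideal I R" "I \<subseteq> Q"
  shows "pe 1 (\<lambda>t. t ! 0 \<notin> I)"
proof (rule ccontr)
  assume notI: "\<not> ?thesis"
  let ?F = "{P. primeideal P R \<and> P \<subseteq> Q \<and> \<not> pe 1 (\<lambda>t. t ! 0 \<notin> P)}"
  have "I \<in> ?F" using I notI by simp
  then have "?F \<noteq> {}" by auto
  then have "\<exists>J. J \<in> ?F \<and> (\<forall>P. P \<in> ?F \<longrightarrow> J \<subseteq> P \<longrightarrow> P = J)"
  proof (rule exists_maximal_ideal_in)
    show "ideal P R" if "P \<in> ?F" for P using that primeideal.axioms(1)[of P R] by simp
  qed auto
  then obtain J where J: "J \<in> ?F" "\<And>P. P \<in> ?F \<Longrightarrow> J \<subseteq> P \<Longrightarrow> P = J" by auto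
  have Op: "primeideal J R" and OQ: "J \<subseteq> Q" and Onot: "\<not> pe 1 (\<lambda>t. t ! 0 \<notin> J)" using J(1) by simp_all
  have "J \<noteq> Q" using Q(2) Onot by auto
  then obtain q1 where q1: "q1 \<in> Q" "q1 \<notin> J" using OQ by auto
  obtain p0 where p0: "p0 \<in> M" "p0 \<notin> Q" using M(2) by auto
  have carr: "x \<in> carrier R" if "x \<in> P" "primeideal P R" for x P
    using ideal_memD(7)[OF primeideal.axioms(1)[OF that(2)] that(1)] .
  have q1c: "q1 \<in> carrier R" and p0c: "p0 \<in> carrier R"
    using carr[OF q1(1) Q(1)] carr[OF p0(1) M(1)] .
  let ?D = "R Quot J"
  define h where "h = (+>) J"
  note quot = quotient_noetherian_domain[OF Op, folded h_def]
  have z: "h t = \<zero>\<^bsub>?D\<^esub> \<longleftrightarrow> t \<in> J" if "t \<in> carrier R" for t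
    using quot(5)[OF that] unfolding h_def .
  interpret D: noetherian_domain ?D by (rule quot(1))
  interpret h: ring_hom_cring R ?D h by (rule quot(2))
  have OM: "J \<subseteq> M" using OQ M(2) by auto
  note Qi = primeideal_image[OF quot(2,3) Q(1), unfolded quot(4), OF OQ]
  note Mi = primeideal_image[OF quot(2,3) M(1), unfolded quot(4), OF OM]
  have "{h q1} \<subseteq> h ` Q" using q1(1) by simp
  from D.exists_minimal_prime[OF Qi(1) this] obtain P where ex: "primeideal P ?D \<and> {h q1} \<subseteq> P \<and> P \<subseteq> h ` Q \<and>
      (\<forall>Q'. primeideal Q' ?D \<longrightarrow> {h q1} \<subseteq> Q' \<longrightarrow> Q' \<subseteq> P \<longrightarrow> Q' = P)" ..
  note P = ex[THEN conjunct1] ex[THEN conjunct2, THEN conjunct1]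
    ex[THEN conjunct2, THEN conjunct2, THEN conjunct1]
    ex[THEN conjunct2, THEN conjunct2, THEN conjunct2, rule_format]
  have "\<exists>(N::nat). \<exists>p\<in>carrier ?D. \<exists>q\<in>carrier ?D. \<forall>t\<in>carrier ?D. t \<noteq> \<zero>\<^bsub>?D\<^esub> \<longleftrightarrow>
    (\<exists>s\<in>carrier ?D - P. \<exists>z\<in>carrier ?D - P. \<exists>x\<in>carrier ?D. \<exists>w\<in>carrier ?D.
      s \<otimes>\<^bsub>?D\<^esub> (x [^]\<^bsub>?D\<^esub> Suc N \<oplus>\<^bsub>?D\<^esub> q \<otimes>\<^bsub>?D\<^esub> z [^]\<^bsub>?D\<^esub> Suc N \<ominus>\<^bsub>?D\<^esub> p \<otimes>\<^bsub>?D\<^esub> x [^]\<^bsub>?D\<^esub> N \<otimes>\<^bsub>?D\<^esub> z)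
        = w \<otimes>\<^bsub>?D\<^esub> t)"
  proof (rule D.nonzero_iff_divides_norm[OF P(1) _ _ _ Mi(1)])
    show "h q1 \<in> P" using P(2) by simp
    show "h q1 \<noteq> \<zero>\<^bsub>?D\<^esub>" using z[OF q1c] q1(2) by simp
    show "Q' = P" if "primeideal Q' ?D" "h q1 \<in> Q'" "Q' \<subseteq> P" for Q'
      by (rule P(4)) (use that in simp_all)
    show "h p0 \<in> h ` M" using p0(1) by simp
    show "h p0 \<notin> P" using Qi(2)[OF p0c] p0(2) P(3) by auto
  qed
  then obtain N :: nat and p q where pq: "p \<in> carrier ?D" "q \<in> carrier ?D"
    and main: "\<forall>t\<in>carrier ?D. t \<noteq> \<zero>\<^bsub>?D\<^esub> \<longleftrightarrow>
    (\<exists>s\<in>carrier ?D - P. \<exists>z\<in>carrier ?D - P. \<exists>x\<in>carrier ?D. \<exists>w\<in>carrier ?D.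
      s \<otimes>\<^bsub>?D\<^esub> (x [^]\<^bsub>?D\<^esub> Suc N \<oplus>\<^bsub>?D\<^esub> q \<otimes>\<^bsub>?D\<^esub> z [^]\<^bsub>?D\<^esub> Suc N \<ominus>\<^bsub>?D\<^esub> p \<otimes>\<^bsub>?D\<^esub> x [^]\<^bsub>?D\<^esub> N \<otimes>\<^bsub>?D\<^esub> z)
        = w \<otimes>\<^bsub>?D\<^esub> t)" by (elim exE bexE)
  have lift: "\<exists>r\<in>carrier R. d = h r" if "d \<in> carrier ?D" for d
    using that quot(3) by auto
  obtain p' q' where pq': "p' \<in> carrier R" "p = h p'" "q' \<in> carrier R" "q = h q'"
    using lift[OF pq(1)] lift[OF pq(2)] by auto
  define P1 where "P1 = {r \<in> carrier R. h r \<in> P}"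
  have P1p: "primeideal P1 R" unfolding P1_def by (rule primeideal_vimage[OF quot(2) P(1)])
  have "P1 \<subseteq> Q"
  proof
    fix r assume "r \<in> P1"
    then have r: "r \<in> carrier R" "h r \<in> h ` Q" using P(3) unfolding P1_def by auto
    then show "r \<in> Q" using Qi(2)[OF r(1)] by simp
  qed
  moreover have "J \<subseteq> P1"
  proof
    fix r assume r: "r \<in> J"
    then have rc: "r \<in> carrier R" using carr[OF _ Op] by simp
    then have "h r = \<zero>\<^bsub>?D\<^esub>" using z r by simp
    then show "r \<in> P1" unfolding P1_def using D.ideal_memD(2)[OF primeideal.axioms(1)[OF P(1)]] rc by simp
  qed
  moreover have "P1 \<noteq> J" using q1(2) q1c P(2) unfolding P1_def by auto
  \<comment> \<open>The preimage \<open>P1\<close> lies below \<open>Q\<close> and strictly above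
    \<open>J\<close>, because it contains \<open>q1\<close>. Maximality of \<open>J\<close>
    therefore makes it definable.\<close>
  ultimately have peP1: "pe 1 (\<lambda>t. t ! 0 \<notin> P1)"
    using J(2)[of P1] P1p by auto
  \<comment> \<open>The entries of \<open>u\<close> are \<open>t, s, z, x, w\<close>. An equation in
    the quotient becomes membership of the difference of the lifted sides in \<open>J\<close>, and
    "outside \<open>P\<close>" becomes "outside \<open>P1\<close>".\<close>
  define F where "F u = u ! 1 \<otimes> ((u ! 3) [^] Suc N \<oplus> q' \<otimes> (u ! 2) [^] Suc N \<ominus> p' \<otimes> (u ! 3) [^] N \<otimes> u ! 2)
    \<ominus> u ! 4 \<otimes> u ! 0" for u :: "'a list"
  have "polyfun (1 + 4) F"
    unfolding F_def by (intro polyfun_intros pq') simp_all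
  then have pe5: "pe (1 + 4) (\<lambda>u. F u \<in> J \<and> u ! 1 \<notin> P1 \<and> u ! 2 \<notin> P1)"
    by (intro pe_conj pe_mem_ideal primeideal.axioms(1)[OF Op] pe_subst1[OF peP1] polyfun_nth) simp_all
  have "pe 1 (\<lambda>t. t ! 0 \<notin> J)"
  proof (rule pe_cong[OF pe_ex[OF pe5]])
    fix t assume "t \<in> tuples R 1"
    then obtain t0 where t: "t = [t0]" "t0 \<in> carrier R" by (auto simp: tuples_def length_Suc_conv)
    have hpow: "h (x [^] n) = h x [^]\<^bsub>?D\<^esub> n" if "x \<in> carrier R" for x and n :: nat
      using that by (induction n) simp_all
    have hF: "h (s \<otimes> (x [^] Suc N \<oplus> q' \<otimes> z [^] Suc N \<ominus> p' \<otimes> x [^] N \<otimes> z) \<ominus> w \<otimes> t0) =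
      h s \<otimes>\<^bsub>?D\<^esub> (h x [^]\<^bsub>?D\<^esub> Suc N \<oplus>\<^bsub>?D\<^esub> q \<otimes>\<^bsub>?D\<^esub> h z [^]\<^bsub>?D\<^esub> Suc N \<ominus>\<^bsub>?D\<^esub> p \<otimes>\<^bsub>?D\<^esub> h x [^]\<^bsub>?D\<^esub> N \<otimes>\<^bsub>?D\<^esub> h z)
        \<ominus>\<^bsub>?D\<^esub> h w \<otimes>\<^bsub>?D\<^esub> h t0"
      if "s \<in> carrier R" "x \<in> carrier R" "z \<in> carrier R" "w \<in> carrier R" for s x z w
      using that t(2) pq' by (simp add: a_minus_def hpow del: nat_pow_Suc D.nat_pow_Suc)
    have in_O: "s \<otimes> (x [^] Suc N \<oplus> q' \<otimes> z [^] Suc N \<ominus> p' \<otimes> x [^] N \<otimes> z) \<ominus> w \<otimes> t0 \<in> J \<longleftrightarrow>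
      h s \<otimes>\<^bsub>?D\<^esub> (h x [^]\<^bsub>?D\<^esub> Suc N \<oplus>\<^bsub>?D\<^esub> q \<otimes>\<^bsub>?D\<^esub> h z [^]\<^bsub>?D\<^esub> Suc N \<ominus>\<^bsub>?D\<^esub> p \<otimes>\<^bsub>?D\<^esub> h x [^]\<^bsub>?D\<^esub> N \<otimes>\<^bsub>?D\<^esub> h z)
        = h w \<otimes>\<^bsub>?D\<^esub> h t0"
      if c: "s \<in> carrier R" "x \<in> carrier R" "z \<in> carrier R" "w \<in> carrier R" for s x z w
    proof -
      have "s \<otimes> (x [^] Suc N \<oplus> q' \<otimes> z [^] Suc N \<ominus> p' \<otimes> x [^] N \<otimes> z) \<ominus> w \<otimes> t0 \<in> carrier R"
        using c t(2) pq' by simp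
      from z[OF this] show ?thesis
        unfolding hF[OF c] using c t(2) pq h.hom_closed by (subst D.r_right_minus_eq[symmetric]) simp_all
    qed
    show "t ! 0 \<notin> J \<longleftrightarrow> (\<exists>y\<in>tuples R 4. F (t @ y) \<in> J \<and> (t @ y) ! 1 \<notin> P1 \<and> (t @ y) ! 2 \<notin> P1)"
    proof
      assume "t ! 0 \<notin> J"
      then have "h t0 \<noteq> \<zero>\<^bsub>?D\<^esub>" using z[OF t(2)] t(1) by simp
      with bspec[OF main h.hom_closed[OF t(2)]]
      obtain s z x w where f: "s \<in> carrier ?D - P" "z \<in> carrier ?D - P" "x \<in> carrier ?D" "w \<in> carrier ?D"
        "s \<otimes>\<^bsub>?D\<^esub> (x [^]\<^bsub>?D\<^esub> Suc N \<oplus>\<^bsub>?D\<^esub> q \<otimes>\<^bsub>?D\<^esub> z [^]\<^bsub>?D\<^esub> Suc N \<ominus>\<^bsub>?D\<^esub> p \<otimes>\<^bsub>?D\<^esub> x [^]\<^bsub>?D\<^esub> N \<otimes>\<^bsub>?D\<^esub> z)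
        = w \<otimes>\<^bsub>?D\<^esub> h t0" by auto
      obtain s' z' x' w' where l: "s' \<in> carrier R" "s = h s'" "z' \<in> carrier R" "z = h z'"
        "x' \<in> carrier R" "x = h x'" "w' \<in> carrier R" "w = h w'"
        using lift[of s] lift[of z] lift[OF f(3)] lift[OF f(4)] f(1,2) by auto
      have "F (t @ [s', z', x', w']) \<in> J"
        unfolding F_def t(1) using in_O[OF l(1,5,3,7)] f(5) l by simp
      moreover have "s' \<notin> P1" "z' \<notin> P1" using f(1,2) l unfolding P1_def by auto
      moreover have "[s', z', x', w'] \<in> tuples R 4" using l by (simp add: tuples_def)
      ultimately show "\<exists>y\<in>tuples R 4. F (t @ y) \<in> J \<and> (t @ y) ! 1 \<notin> P1 \<and> (t @ y) ! 2 \<notin> P1"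
        unfolding t(1) by (intro bexI[of _ "[s', z', x', w']"]) simp_all
    next
      assume "\<exists>y\<in>tuples R 4. F (t @ y) \<in> J \<and> (t @ y) ! 1 \<notin> P1 \<and> (t @ y) ! 2 \<notin> P1"
      then obtain y where y: "y \<in> tuples R 4" "F (t @ y) \<in> J" "(t @ y) ! 1 \<notin> P1" "(t @ y) ! 2 \<notin> P1" by auto
      obtain s z x w where l: "s \<in> carrier R" "z \<in> carrier R" "x \<in> carrier R" "w \<in> carrier R" "y = [s, z, x, w]"
        using y(1) by (auto simp: tuples_def length_Suc_conv numeral_eq_Suc)
      have 1: "h s \<otimes>\<^bsub>?D\<^esub> (h x [^]\<^bsub>?D\<^esub> Suc N \<oplus>\<^bsub>?D\<^esub> q \<otimes>\<^bsub>?D\<^esub> h z [^]\<^bsub>?D\<^esub> Suc N \<ominus>\<^bsub>?D\<^esub> p \<otimes>\<^bsub>?D\<^esub> h x [^]\<^bsub>?D\<^esub> N \<otimes>\<^bsub>?D\<^esub> h z)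
        = h w \<otimes>\<^bsub>?D\<^esub> h t0"
        using y(2) in_O[OF l(1,3,2,4)] unfolding F_def t(1) l(5) by simp
      have 2: "h s \<in> carrier ?D - P" "h z \<in> carrier ?D - P"
        using y(3,4) l(1,2) unfolding P1_def t(1) l(5) by simp_all
      have "h t0 \<noteq> \<zero>\<^bsub>?D\<^esub>"
        by (rule bspec[OF main h.hom_closed[OF t(2)], THEN iffD2])
          (rule bexI[OF _ 2(1)], rule bexI[OF _ 2(2)], rule bexI[OF _ h.hom_closed[OF l(3)]],
            rule bexI[OF _ h.hom_closed[OF l(4)]], rule 1)
      then show "t ! 0 \<notin> J" using z[OF t(2)] t(1) by simp
    qed
  qed
  then show False using Onot by simp
qed

text \<open>
  \<open>Q\<close> is maximal among the ideals that are not \<open>good\<close>. If \<open>good\<close> is existential on the ideals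
  \<open>Q + (t)\<close>, the equivalence makes the complement of \<open>Q\<close> existential.
\<close>

lemma exists_prime_not_good:
  assumes mult: "\<And>I J K. ideal I R \<Longrightarrow> ideal J R \<Longrightarrow> ideal K R \<Longrightarrow> good I \<Longrightarrow> good J \<Longrightarrow>
      (\<And>a b. a \<in> I \<Longrightarrow> b \<in> J \<Longrightarrow> a \<otimes> b \<in> K) \<Longrightarrow> good K"
    and top: "good (carrier R)" and bot: "\<not> good {\<zero>}"
  shows "\<exists>Q. primeideal Q R \<and> \<not> good Q \<and> (\<forall>t\<in>carrier R. t \<notin> Q \<longleftrightarrow> good (Q <+>\<^bsub>R\<^esub> PIdl t))"
proof -
  let ?F = "{I. ideal I R \<and> \<not> good I}"
  have "{\<zero>} \<in> ?F" using bot zeroideal by simp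
  then have "?F \<noteq> {}" by auto
  then have "\<exists>Q. Q \<in> ?F \<and> (\<forall>I. I \<in> ?F \<longrightarrow> Q \<subseteq> I \<longrightarrow> I = Q)"
    by (rule exists_maximal_ideal_in) auto
  then obtain Q where Q: "ideal Q R" "\<not> good Q" "\<And>I. ideal I R \<Longrightarrow> \<not> good I \<Longrightarrow> Q \<subseteq> I \<Longrightarrow> I = Q"
    by auto
  note Q' = ideal_memD[OF Q(1)]
  have sum: "ideal (Q <+>\<^bsub>R\<^esub> PIdl t) R" "Q \<subseteq> Q <+>\<^bsub>R\<^esub> PIdl t" "t \<in> Q <+>\<^bsub>R\<^esub> PIdl t"
    if "t \<in> carrier R" for t
    using add_ideals[OF Q(1) cgenideal_ideal[OF that]] ideal_sum_upper[OF Q(1) cgenideal_ideal[OF that]]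
      cgenideal_self[OF that] by auto
  have good: "good (Q <+>\<^bsub>R\<^esub> PIdl t)" if "t \<in> carrier R" "t \<notin> Q" for t
    using Q(3)[OF sum(1)[OF that(1)] _ sum(2)[OF that(1)]] sum(3)[OF that(1)] that(2) by auto
  have "primeideal Q R"
  proof (rule primeidealI[OF Q(1) is_cring])
    show "carrier R \<noteq> Q" using Q(2) top by auto
    fix x y assume xy: "x \<in> carrier R" "y \<in> carrier R" "x \<otimes> y \<in> Q"
    show "x \<in> Q \<or> y \<in> Q"
    proof (rule ccontr)
      assume "\<not> (x \<in> Q \<or> y \<in> Q)"
      then have "good (Q <+>\<^bsub>R\<^esub> PIdl x)" "good (Q <+>\<^bsub>R\<^esub> PIdl y)" using good xy by auto
      then have "good Q"
      proof (rule mult[OF sum(1)[OF xy(1)] sum(1)[OF xy(2)] Q(1)])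
        fix a b assume "a \<in> Q <+>\<^bsub>R\<^esub> PIdl x" "b \<in> Q <+>\<^bsub>R\<^esub> PIdl y"
        then obtain u r v s where uv: "u \<in> Q" "r \<in> carrier R" "a = u \<oplus> r \<otimes> x" "v \<in> Q" "s \<in> carrier R" "b = v \<oplus> s \<otimes> y"
          unfolding ideal_sum_PIdl_iff by auto
        have c: "u \<in> carrier R" "v \<in> carrier R" using uv Q'(7) by simp_all
        have "a \<otimes> b = (v \<oplus> s \<otimes> y) \<otimes> u \<oplus> (r \<otimes> x) \<otimes> v \<oplus> (r \<otimes> s) \<otimes> (x \<otimes> y)"
          unfolding uv(3,6) using c uv(2,5) xy(1,2) by algebra
        also have "\<dots> \<in> Q"
          by (rule Q'(3)[OF Q'(3)[OF Q'(5)[OF uv(1)] Q'(5)[OF uv(4)]] Q'(5)[OF xy(3)]])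
            (use c uv(2,5) xy(1,2) in simp_all)
        finally show "a \<otimes> b \<in> Q" .
      qed
      then show False using Q(2) by simp
    qed
  qed
  moreover have "t \<notin> Q \<longleftrightarrow> good (Q <+>\<^bsub>R\<^esub> PIdl t)" if t: "t \<in> carrier R" for t
  proof
    show "good (Q <+>\<^bsub>R\<^esub> PIdl t)" if "t \<notin> Q" using good[OF t that] .
    show "t \<notin> Q" if g: "good (Q <+>\<^bsub>R\<^esub> PIdl t)"
    proof
      assume "t \<in> Q"
      have "Q <+>\<^bsub>R\<^esub> PIdl t = Q"
      proof
        show "Q <+>\<^bsub>R\<^esub> PIdl t \<subseteq> Q"
          unfolding subset_iff ideal_sum_PIdl_iff using Q'(3,5) \<open>t \<in> Q\<close> by auto
      qed (rule sum(2)[OF t])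
      then show False using g Q(2) by simp
    qed
  qed
  ultimately show ?thesis using Q(2) by auto
qed

lemma exists_maximalideal_above:
  assumes "ideal I R" "I \<noteq> carrier R"
  shows "\<exists>M. maximalideal M R \<and> I \<subseteq> M"
proof -
  let ?F = "{J. ideal J R \<and> J \<noteq> carrier R \<and> I \<subseteq> J}"
  have "I \<in> ?F" using assms by simp
  then have "?F \<noteq> {}" by auto
  then have "\<exists>M. M \<in> ?F \<and> (\<forall>J. J \<in> ?F \<longrightarrow> M \<subseteq> J \<longrightarrow> J = M)"
    by (rule exists_maximal_ideal_in) auto
  then obtain M where M: "M \<in> ?F" "\<And>J. J \<in> ?F \<Longrightarrow> M \<subseteq> J \<Longrightarrow> J = M" by auto
  have "maximalideal M R"
  proof (rule maximalidealI)
    show "J = M \<or> J = carrier R" if "ideal J R" "M \<subseteq> J" "J \<subseteq> carrier R" for J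
      using M(2)[of J] M(1) that by auto
  qed (use M(1) in auto)
  then show ?thesis using M(1) by auto
qed

lemma maximalideals_comaximal:
  assumes M: "maximalideal M R" "maximalideal N R" "M \<noteq> N"
  shows "\<exists>u\<in>M. \<exists>v\<in>N. \<one> = u \<oplus> v"
proof -
  have i: "ideal M R" "ideal N R" using M maximalideal.axioms(1) by auto
  have "M <+>\<^bsub>R\<^esub> N = carrier R"
  proof (rule ccontr)
    assume ne: "M <+>\<^bsub>R\<^esub> N \<noteq> carrier R"
    have s: "ideal (M <+>\<^bsub>R\<^esub> N) R" by (rule add_ideals[OF i])
    have "M <+>\<^bsub>R\<^esub> N = M"
      using maximalideal.I_maximal[OF M(1) s ideal_sum_upper(1)[OF i] ideal_memD(1)[OF s]] ne by simp
    moreover have "M <+>\<^bsub>R\<^esub> N = N"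
      using maximalideal.I_maximal[OF M(2) s ideal_sum_upper(2)[OF i] ideal_memD(1)[OF s]] ne by simp
    ultimately show False using M(3) by simp
  qed
  then have "\<one> \<in> M <+>\<^bsub>R\<^esub> N" by simp
  then show ?thesis unfolding ideal_sum_iff .
qed

end

text \<open>Goodness is multiplicative since \<open>1 + M1\<close> and \<open>1 + M2\<close> are
  closed under products. It passes to every maximal ideal, because a maximal ideal differs from
  \<open>M1\<close> or from \<open>M2\<close> and is comaximal with the one it differs from. Hence
  the prime obtained from \<open>exists_prime_not_good\<close> cannot be maximal.\<close>

lemma (in noetherian_domain) exists_pe_prime_two_maximal:
  assumes M: "maximalideal M1 R" "maximalideal M2 R" "M1 \<noteq> M2"
  shows "\<exists>Q M. primeideal Q R \<and> pe 1 (\<lambda>t. t ! 0 \<notin> Q) \<and> primeideal M R \<and> Q \<subset> M"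
proof -
  define good where "good I \<longleftrightarrow> (\<exists>x\<in>carrier R. \<exists>y\<in>carrier R. \<one> \<ominus> x \<in> M1 \<and> \<one> \<ominus> y \<in> M2 \<and> x \<otimes> y \<in> I)" for I
  have i1: "ideal M1 R" and i2: "ideal M2 R" using M maximalideal.axioms(1) by auto
  note m1 = ideal_memD[OF i1] and m2 = ideal_memD[OF i2]
  have n1: "\<one> \<notin> M1" "\<one> \<notin> M2"
    using maximalideal.I_notcarr[OF M(1)] maximalideal.I_notcarr[OF M(2)] proper_ideal_one i1 i2 by auto
  have goodI: "good I" if "x \<in> carrier R" "y \<in> carrier R" "\<one> \<ominus> x \<in> M1" "\<one> \<ominus> y \<in> M2" "x \<otimes> y \<in> I" for x y I
    using that unfolding good_def by auto
  have one0: "\<one> \<ominus> \<one> = \<zero>" by (simp add: r_right_minus_eq)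
  have prod: "\<one> \<ominus> x \<otimes> x' \<in> I" if "ideal I R" "x \<in> carrier R" "x' \<in> carrier R" "\<one> \<ominus> x \<in> I" "\<one> \<ominus> x' \<in> I" for x x' I
  proof -
    have "\<one> \<ominus> x \<otimes> x' = (\<one> \<ominus> x) \<oplus> x \<otimes> (\<one> \<ominus> x')" using that(2,3) by algebra
    then show ?thesis using ideal_memD(3,5)[OF that(1)] that by simp
  qed
  have "\<exists>Q. primeideal Q R \<and> \<not> good Q \<and> (\<forall>t\<in>carrier R. t \<notin> Q \<longleftrightarrow> good (Q <+>\<^bsub>R\<^esub> PIdl t))"
  proof (rule exists_prime_not_good)
    fix I J K assume IJK: "good I" "good J" "\<And>a b. a \<in> I \<Longrightarrow> b \<in> J \<Longrightarrow> a \<otimes> b \<in> K"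
    obtain x y where x: "x \<in> carrier R" "y \<in> carrier R" "\<one> \<ominus> x \<in> M1" "\<one> \<ominus> y \<in> M2" "x \<otimes> y \<in> I"
      using IJK(1) unfolding good_def by auto
    obtain x' y' where x': "x' \<in> carrier R" "y' \<in> carrier R" "\<one> \<ominus> x' \<in> M1" "\<one> \<ominus> y' \<in> M2" "x' \<otimes> y' \<in> J"
      using IJK(2) unfolding good_def by auto
    have "(x \<otimes> x') \<otimes> (y \<otimes> y') = (x \<otimes> y) \<otimes> (x' \<otimes> y')" using x x' by (simp add: m_ac)
    then have "(x \<otimes> x') \<otimes> (y \<otimes> y') \<in> K" using IJK(3)[OF x(5) x'(5)] by simp
    then show "good K"
      using goodI[OF m_closed[OF x(1) x'(1)] m_closed[OF x(2) x'(2)]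
          prod[OF i1 x(1) x'(1) x(3) x'(3)] prod[OF i2 x(2) x'(2) x(4) x'(4)]] by simp
  next
    show "good (carrier R)"
      by (rule goodI[of \<one> \<one>]) (simp_all add: one0 m1(2) m2(2))
    \<comment> \<open>In a domain one of the two factors would be zero, but neither
      \<open>1 + M1\<close> nor \<open>1 + M2\<close> contains zero.\<close>
    show "\<not> good {\<zero>}"
    proof
      assume "good {\<zero>}"
      then obtain x y where x: "x \<in> carrier R" "y \<in> carrier R" "\<one> \<ominus> x \<in> M1" "\<one> \<ominus> y \<in> M2" "x \<otimes> y = \<zero>"
        unfolding good_def by auto
      then have "x = \<zero> \<or> y = \<zero>" by (simp add: integral_iff)
      then show False using x(3,4) n1 by (auto simp: a_minus_def)
    qed
  qed
  then obtain Q where Q: "primeideal Q R" "\<not> good Q" "\<And>t. t \<in> carrier R \<Longrightarrow> t \<notin> Q \<longleftrightarrow> good (Q <+>\<^bsub>R\<^esub> PIdl t)"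
    by auto
  have Qi: "ideal Q R" by (rule primeideal.axioms(1)[OF Q(1)])
  obtain M where MM: "maximalideal M R" "Q \<subseteq> M"
    using exists_maximalideal_above[OF Qi] primeideal.I_notcarr[OF Q(1)] by auto
  have "good M"
  proof (cases "M = M1")
    case True
    obtain u v where uv: "u \<in> M" "v \<in> M2" "\<one> = u \<oplus> v"
      using maximalideals_comaximal[OF MM(1) M(2)] True M(3) by auto
    have c: "u \<in> carrier R" "v \<in> carrier R" using uv m1(7) m2(7) True by auto
    have "\<one> \<ominus> u = v" unfolding uv(3) using c by algebra
    then show ?thesis
      by (intro goodI[of \<one> u]) (use c uv(1,2) in \<open>simp_all add: one0 m1(2)\<close>)
  next
    case False
    obtain u v where uv: "u \<in> M" "v \<in> M1" "\<one> = u \<oplus> v"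
      using maximalideals_comaximal[OF MM(1) M(1)] False by auto
    have c: "u \<in> carrier R" "v \<in> carrier R"
      using uv m1(7) ideal_memD(7)[OF maximalideal.axioms(1)[OF MM(1)]] by auto
    have "\<one> \<ominus> u = v" unfolding uv(3) using c by algebra
    then show ?thesis
      by (intro goodI[of u \<one>]) (use c uv(1,2) in \<open>simp_all add: one0 m2(2)\<close>)
  qed
  then have QM: "Q \<subset> M" using MM(2) Q(2) by auto
  \<comment> \<open>The entries of \<open>u\<close> are \<open>t, x, y, w\<close>. Membership of
    \<open>x y\<close> in \<open>Q + (t)\<close> is written as \<open>x y - w t \<in> Q\<close>,
    which involves only the fixed ideal \<open>Q\<close>.\<close>
  have pe4: "pe (1 + 3) (\<lambda>u. \<one> \<ominus> u ! 1 \<in> M1 \<and> \<one> \<ominus> u ! 2 \<in> M2 \<and> u ! 1 \<otimes> u ! 2 \<ominus> u ! 3 \<otimes> u ! 0 \<in> Q)"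
    by (intro pe_conj pe_mem_ideal i1 i2 Qi polyfun_intros one_closed) simp_all
  have "pe 1 (\<lambda>t. t ! 0 \<notin> Q)"
  proof (rule pe_cong[OF pe_ex[OF pe4]])
    fix t assume "t \<in> tuples R 1"
    then obtain t0 where t: "t = [t0]" "t0 \<in> carrier R" by (auto simp: tuples_def length_Suc_conv)
    show "t ! 0 \<notin> Q \<longleftrightarrow> (\<exists>x\<in>tuples R 3. \<one> \<ominus> (t @ x) ! 1 \<in> M1 \<and> \<one> \<ominus> (t @ x) ! 2 \<in> M2 \<and>
        (t @ x) ! 1 \<otimes> (t @ x) ! 2 \<ominus> (t @ x) ! 3 \<otimes> (t @ x) ! 0 \<in> Q)"
    proof
      assume "t ! 0 \<notin> Q"
      then have "good (Q <+>\<^bsub>R\<^esub> PIdl t0)" using Q(3)[OF t(2)] t(1) by simp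
      then obtain x y where x: "x \<in> carrier R" "y \<in> carrier R" "\<one> \<ominus> x \<in> M1" "\<one> \<ominus> y \<in> M2" "x \<otimes> y \<in> Q <+>\<^bsub>R\<^esub> PIdl t0"
        unfolding good_def by auto
      then obtain a w where a: "a \<in> Q" "w \<in> carrier R" "x \<otimes> y = a \<oplus> w \<otimes> t0"
        unfolding ideal_sum_PIdl_iff by auto
      have "a \<in> carrier R" using ideal_memD(7)[OF Qi a(1)] .
      then have "x \<otimes> y \<ominus> w \<otimes> t0 = a" unfolding a(3) using a(2) t(2) by algebra
      then show "\<exists>x\<in>tuples R 3. \<one> \<ominus> (t @ x) ! 1 \<in> M1 \<and> \<one> \<ominus> (t @ x) ! 2 \<in> M2 \<and>
        (t @ x) ! 1 \<otimes> (t @ x) ! 2 \<ominus> (t @ x) ! 3 \<otimes> (t @ x) ! 0 \<in> Q"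
        unfolding t(1) by (intro bexI[of _ "[x, y, w]"]) (use x a in \<open>simp_all add: tuples_def\<close>)
    next
      assume "\<exists>x\<in>tuples R 3. \<one> \<ominus> (t @ x) ! 1 \<in> M1 \<and> \<one> \<ominus> (t @ x) ! 2 \<in> M2 \<and>
        (t @ x) ! 1 \<otimes> (t @ x) ! 2 \<ominus> (t @ x) ! 3 \<otimes> (t @ x) ! 0 \<in> Q"
      then obtain x where x: "x \<in> tuples R 3" "\<one> \<ominus> (t @ x) ! 1 \<in> M1" "\<one> \<ominus> (t @ x) ! 2 \<in> M2"
        "(t @ x) ! 1 \<otimes> (t @ x) ! 2 \<ominus> (t @ x) ! 3 \<otimes> (t @ x) ! 0 \<in> Q" by auto
      obtain a b w where l: "a \<in> carrier R" "b \<in> carrier R" "w \<in> carrier R" "x = [a, b, w]"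
        using x(1) by (auto simp: tuples_def length_Suc_conv numeral_eq_Suc)
      have "a \<otimes> b = (a \<otimes> b \<ominus> w \<otimes> t0) \<oplus> w \<otimes> t0" using l t(2) by algebra
      then have "a \<otimes> b \<in> Q <+>\<^bsub>R\<^esub> PIdl t0"
        unfolding ideal_sum_PIdl_iff using x(4) l t(1) by auto
      then have "good (Q <+>\<^bsub>R\<^esub> PIdl t0)"
        by (intro goodI[OF l(1,2)]) (use x(2,3) l(4) t(1) in simp_all)
      then show "t ! 0 \<notin> Q" using Q(3)[OF t(2)] t(1) by simp
    qed
  qed
  then show ?thesis
    using Q(1) maximalideal_prime[OF MM(1)] QM by auto
qed


section \<open>Idempotents and decompositions into local rings\<close>

text \<open>If a sum of two nonunits were a unit, scaling by its inverse would produce two nonunits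
  with sum 1. So the nonunits form an ideal, which contains every proper ideal.\<close>

lemma (in cring) local_ringI:
  assumes ne: "\<one> \<noteq> \<zero>"
    and sum: "\<And>x y. x \<in> carrier R \<Longrightarrow> y \<in> carrier R \<Longrightarrow> x \<oplus> y = \<one> \<Longrightarrow> x \<in> Units R \<or> y \<in> Units R"
  shows "local_ring R"
proof -
  let ?M = "carrier R - Units R"
  have unit_factor: "x \<in> Units R" if xy: "x \<in> carrier R" "y \<in> carrier R" "x \<otimes> y \<in> Units R" for x y
  proof -
    obtain z where z: "z \<in> carrier R" "x \<otimes> y \<otimes> z = \<one>"
      using xy(3) unfolding Units_def by auto
    have "x \<otimes> (y \<otimes> z) = \<one>" using z xy(1,2) by (simp add: m_assoc)
    moreover have "(y \<otimes> z) \<otimes> x = x \<otimes> (y \<otimes> z)" using z(1) xy(1,2) by (simp add: m_comm)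
    ultimately show ?thesis using xy(1,2) z(1) unfolding Units_def by auto
  qed
  have M: "ideal ?M R"
  proof (rule ideal_of_closed)
    show "\<zero> \<in> ?M" using ne unfolding Units_def by auto
    show "a \<oplus> b \<in> ?M" if ab: "a \<in> ?M" "b \<in> ?M" for a b
    proof (rule ccontr)
      assume "a \<oplus> b \<notin> ?M"
      then have u: "a \<oplus> b \<in> Units R" using ab by simp
      have c: "a \<in> carrier R" "b \<in> carrier R" "inv (a \<oplus> b) \<in> carrier R" using ab u by auto
      have "a \<otimes> inv (a \<oplus> b) \<oplus> b \<otimes> inv (a \<oplus> b) = \<one>"
        using c u by (simp add: l_distr[symmetric])
      then have "a \<otimes> inv (a \<oplus> b) \<in> Units R \<or> b \<otimes> inv (a \<oplus> b) \<in> Units R"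
        using c by (intro sum) simp_all
      then have "a \<in> Units R \<or> b \<in> Units R"
        using unit_factor[OF c(1,3)] unit_factor[OF c(2,3)] by (elim disjE) simp_all
      then show False using ab by simp
    qed
    show "x \<otimes> a \<in> ?M" if "a \<in> ?M" "x \<in> carrier R" for a x
    proof -
      have "a \<otimes> x = x \<otimes> a" using that by (simp add: m_comm)
      then show ?thesis using unit_factor[of a x] that by (metis DiffD1 DiffD2 DiffI m_closed)
    qed
  qed simp
  have nounit: "I \<subseteq> ?M" if I: "ideal I R" "I \<noteq> carrier R" for I
  proof
    fix x assume x: "x \<in> I"
    have xc: "x \<in> carrier R" using ideal_memD(7)[OF I(1) x] .
    have "x \<notin> Units R"
    proof
      assume u: "x \<in> Units R"
      have "inv x \<otimes> x \<in> I" by (rule ideal_memD(5)[OF I(1) x Units_inv_closed[OF u]])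
      then have "\<one> \<in> I" by (simp only: Units_l_inv[OF u])
      then show False using I proper_ideal_one by simp
    qed
    then show "x \<in> ?M" using xc by simp
  qed
  have "maximalideal ?M R"
  proof (rule maximalidealI[OF M])
    show "carrier R \<noteq> ?M" using Units_one_closed Units_closed by auto
    show "K = ?M \<or> K = carrier R" if "ideal K R" "?M \<subseteq> K" "K \<subseteq> carrier R" for K
      using nounit[OF that(1)] that(2) by auto
  qed
  moreover have "I = ?M" if I: "maximalideal I R" for I
  proof -
    have "?M = I \<or> ?M = carrier R"
      using maximalideal.I_maximal[OF I M nounit[OF maximalideal.axioms(1)[OF I]]]
        maximalideal.I_notcarr[OF I] by auto
    then show ?thesis using Units_one_closed Units_closed by auto
  qed
  ultimately show ?thesis
    unfolding local_ring_def using is_cring by auto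
qed

section \<open>Factors of a ring cut out by idempotents\<close>

definition corner :: "('b, 'n) ring_scheme \<Rightarrow> 'b \<Rightarrow> 'b ring"
  where "corner B e = \<lparr>carrier = (\<lambda>x. e \<otimes>\<^bsub>B\<^esub> x) ` carrier B, monoid.mult = monoid.mult B, monoid.one = e,
    ring.zero = \<zero>\<^bsub>B\<^esub>, ring.add = ring.add B\<rparr>"

lemma corner_simps [simp]:
  "carrier (corner B e) = (\<lambda>x. e \<otimes>\<^bsub>B\<^esub> x) ` carrier B" "x \<otimes>\<^bsub>corner B e\<^esub> y = x \<otimes>\<^bsub>B\<^esub> y"
  "\<one>\<^bsub>corner B e\<^esub> = e" "\<zero>\<^bsub>corner B e\<^esub> = \<zero>\<^bsub>B\<^esub>" "x \<oplus>\<^bsub>corner B e\<^esub> y = x \<oplus>\<^bsub>B\<^esub> y"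
  by (simp_all add: corner_def)

lemma is_ring_isoI: "f \<in> ring_iso A B \<Longrightarrow> A \<simeq> B"
  unfolding is_ring_iso_def by auto

lemma RDirProd_list_append:
  "RDirProd (RDirProd_list Rs) (RDirProd_list Ss) \<simeq> RDirProd_list (Rs @ Ss)"
proof (induction Rs)
  case Nil
  have "(\<lambda>(x, y). y) \<in> ring_iso (RDirProd nil_ring (RDirProd_list Ss)) (RDirProd_list Ss)"
    by (rule ring_iso_memI) (auto simp: RDirProd_def DirProd_def monoid.defs bij_betw_def inj_on_def image_iff)
  then show ?case unfolding append_Nil RDirProd_list_nil by (rule is_ring_isoI)
next
  case (Cons R Rs)
  let ?T = "RDirProd_list Ss"
  have 1: "RDirProd (RDirProd_list (R # Rs)) ?T \<simeq> RDirProd (RDirProd R (RDirProd_list Rs)) ?T"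
    by (rule is_ring_isoI, rule RDirProd_iso4, rule RDirProd_list_iso2)
  have 2: "RDirProd (RDirProd R (RDirProd_list Rs)) ?T \<simeq> RDirProd R (RDirProd (RDirProd_list Rs) ?T)"
    by (rule is_ring_isoI, rule RDirProd_iso3)
  obtain f where "f \<in> ring_iso (RDirProd (RDirProd_list Rs) ?T) (RDirProd_list (Rs @ Ss))"
    using Cons unfolding is_ring_iso_def by auto
  then have 3: "RDirProd R (RDirProd (RDirProd_list Rs) ?T) \<simeq> RDirProd R (RDirProd_list (Rs @ Ss))"
    using is_ring_isoI[OF RDirProd_iso5] by auto
  have 4: "RDirProd R (RDirProd_list (Rs @ Ss)) \<simeq> RDirProd_list (R # (Rs @ Ss))"
    by (rule is_ring_isoI, rule RDirProd_list_iso1)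
  show ?case
    unfolding append_Cons by (rule ring_iso_trans[OF 1 ring_iso_trans[OF 2 ring_iso_trans[OF 3 4]]])
qed

text \<open>
  The hypotheses say that \<open>J\<close> lies in the Jacobson radical and that the quotient by \<open>J\<close> is Artinian.
  The example is the extension of the maximal ideal of a local ring to a finite algebra.
\<close>

locale radical_ideal = cring +
  fixes J
  assumes J: "ideal J R"
    and nakayama: "\<And>W. ideal W R \<Longrightarrow> carrier R \<subseteq> W <+>\<^bsub>R\<^esub> J \<Longrightarrow> W = carrier R"
    and dcc: "\<And>V. (\<And>i. ideal (V i) R) \<Longrightarrow> (\<And>i. J \<subseteq> V i) \<Longrightarrow> (\<And>i. V (Suc i) \<subseteq> V i) \<Longrightarrow>
      \<exists>i0. \<forall>i\<ge>(i0::nat). V i = V i0"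
begin

lemma PIdl_sum_iff: "x \<in> PIdl a <+>\<^bsub>R\<^esub> I \<longleftrightarrow> (\<exists>r\<in>carrier R. \<exists>y\<in>I. x = r \<otimes> a \<oplus> y)"
  by (simp only: ideal_sum_iff PIdl_iff Bex_def) blast

lemma PIdl_sum_PIdl_iff:
  "x \<in> PIdl a <+>\<^bsub>R\<^esub> PIdl b \<longleftrightarrow> (\<exists>r\<in>carrier R. \<exists>t\<in>carrier R. x = r \<otimes> a \<oplus> t \<otimes> b)"
  by (simp only: ideal_sum_iff PIdl_iff Bex_def) blast

definition idem :: "'a \<Rightarrow> bool" where "idem e \<longleftrightarrow> e \<in> carrier R \<and> e \<otimes> e = e"

lemmas JD = ideal_memD[OF J]

lemma one_in_sum:
  assumes W: "ideal W R" and one: "\<one> \<in> W <+>\<^bsub>R\<^esub> J"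
  shows "\<one> \<in> W"
proof -
  have "W <+>\<^bsub>R\<^esub> J = carrier R"
    using proper_ideal_one[OF add_ideals[OF W J]] one by simp
  then show ?thesis using nakayama[OF W] by simp
qed

lemma unit_one_plus:
  assumes u: "u \<in> carrier R" "u \<ominus> \<one> \<in> J"
  shows "\<exists>v\<in>carrier R. v \<otimes> u = \<one>"
proof -
  have "\<one> = u \<oplus> ((\<ominus> \<one>) \<otimes> (u \<ominus> \<one>))" using u(1) by algebra
  moreover have "(\<ominus> \<one>) \<otimes> (u \<ominus> \<one>) \<in> J" using JD(5)[OF u(2)] by simp
  ultimately have "\<one> \<in> PIdl u <+>\<^bsub>R\<^esub> J"
    unfolding ideal_sum_iff using cgenideal_self[OF u(1)] by auto
  then have "\<one> \<in> PIdl u" by (rule one_in_sum[OF cgenideal_ideal[OF u(1)]])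
  then show ?thesis unfolding PIdl_iff by auto
qed

text \<open>The element \<open>1 - e\<close> is a unit because \<open>e\<close> lies in the radical,
  and it annihilates \<open>e\<close>.\<close>

lemma idem_in_J:
  assumes "idem e" "e \<in> J"
  shows "e = \<zero>"
proof -
  have e: "e \<in> carrier R" "e \<otimes> e = e" using assms(1) unfolding idem_def by auto
  have "(\<one> \<ominus> e) \<ominus> \<one> = (\<ominus> \<one>) \<otimes> e" using e(1) by algebra
  then have "(\<one> \<ominus> e) \<ominus> \<one> \<in> J" using JD(5)[OF assms(2)] by simp
  then obtain v where v: "v \<in> carrier R" "v \<otimes> (\<one> \<ominus> e) = \<one>"
    using unit_one_plus[of "\<one> \<ominus> e"] e(1) by auto
  have "e = (v \<otimes> (\<one> \<ominus> e)) \<otimes> e" using v(2) e(1) by simp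
  also have "\<dots> = v \<otimes> (e \<ominus> e \<otimes> e)" using v(1) e(1) by algebra
  also have "\<dots> = \<zero>" unfolding e(2) using v(1) e(1) by algebra
  finally show ?thesis .
qed

lemma corner_cring:
  assumes "idem e"
  shows "cring (corner R e)"
proof -
  have e: "e \<in> carrier R" "e \<otimes> e = e" using assms unfolding idem_def by auto
  have el: "x \<in> carrier R \<and> e \<otimes> x = x" if x: "x \<in> carrier (corner R e)" for x
  proof -
    obtain y where "y \<in> carrier R" "x = e \<otimes> y" using x by auto
    then show ?thesis using e by (simp add: m_assoc[symmetric])
  qed
  have mem: "x \<in> carrier (corner R e)" if "x \<in> carrier R" "e \<otimes> x = x" for x
    using that by (auto intro!: image_eqI[of x _ x])
  show ?thesis
  proof (rule cringI[OF abelian_groupI comm_monoidI])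
    fix x assume x: "x \<in> carrier (corner R e)"
    have "\<ominus> x \<in> carrier (corner R e)" using el[OF x] e(1) by (intro mem) (simp_all add: r_minus)
    moreover have "\<ominus> x \<oplus> x = \<zero>" using el[OF x] by (simp add: l_neg)
    ultimately show "\<exists>y\<in>carrier (corner R e). y \<oplus>\<^bsub>corner R e\<^esub> x = \<zero>\<^bsub>corner R e\<^esub>" by auto
  next
    show "\<zero>\<^bsub>corner R e\<^esub> \<in> carrier (corner R e)" using mem[of \<zero>] e(1) by simp
    show "\<one>\<^bsub>corner R e\<^esub> \<in> carrier (corner R e)" using mem[of e] e by simp
  next
    fix x y assume xy: "x \<in> carrier (corner R e)" "y \<in> carrier (corner R e)"
    note c = el[OF xy(1)] el[OF xy(2)]
    show "x \<oplus>\<^bsub>corner R e\<^esub> y \<in> carrier (corner R e)"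
      using mem[of "x \<oplus> y"] c e(1) by (simp add: r_distr)
    show "x \<otimes>\<^bsub>corner R e\<^esub> y \<in> carrier (corner R e)"
      using mem[of "x \<otimes> y"] c e(1) by (simp add: m_assoc[symmetric])
    show "x \<oplus>\<^bsub>corner R e\<^esub> y = y \<oplus>\<^bsub>corner R e\<^esub> x" using c by (simp add: a_comm)
    show "x \<otimes>\<^bsub>corner R e\<^esub> y = y \<otimes>\<^bsub>corner R e\<^esub> x" using c by (simp add: m_comm)
    fix z assume z: "z \<in> carrier (corner R e)"
    show "x \<oplus>\<^bsub>corner R e\<^esub> y \<oplus>\<^bsub>corner R e\<^esub> z = x \<oplus>\<^bsub>corner R e\<^esub> (y \<oplus>\<^bsub>corner R e\<^esub> z)"
      using c el[OF z] by (simp add: a_assoc)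
    show "x \<otimes>\<^bsub>corner R e\<^esub> y \<otimes>\<^bsub>corner R e\<^esub> z = x \<otimes>\<^bsub>corner R e\<^esub> (y \<otimes>\<^bsub>corner R e\<^esub> z)"
      using c el[OF z] by (simp add: m_assoc)
    show "(x \<oplus>\<^bsub>corner R e\<^esub> y) \<otimes>\<^bsub>corner R e\<^esub> z = x \<otimes>\<^bsub>corner R e\<^esub> z \<oplus>\<^bsub>corner R e\<^esub> y \<otimes>\<^bsub>corner R e\<^esub> z"
      using c el[OF z] by (simp add: l_distr)
  next
    fix x assume x: "x \<in> carrier (corner R e)"
    show "\<zero>\<^bsub>corner R e\<^esub> \<oplus>\<^bsub>corner R e\<^esub> x = x" using el[OF x] by simp
    show "\<one>\<^bsub>corner R e\<^esub> \<otimes>\<^bsub>corner R e\<^esub> x = x" using el[OF x] by simp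
  qed
qed

text \<open>The Peirce decomposition of an idempotent that is a sum of two orthogonal ones;
  \<open>x \<mapsto> (f x, f' x)\<close> is inverted by the sum \<open>f x + f' x\<close>.\<close>

lemma corner_split:
  assumes f: "idem f" and f': "idem f'" and orth: "f \<otimes> f' = \<zero>" and e: "e = f \<oplus> f'"
  shows "corner R e \<simeq> RDirProd (corner R f) (corner R f')"
proof (rule is_ring_isoI)
  have c: "f \<in> carrier R" "f' \<in> carrier R" "f \<otimes> f = f" "f' \<otimes> f' = f'"
    using f f' unfolding idem_def by auto
  have ec: "e \<in> carrier R" using c e by simp
  have orth': "f' \<otimes> f = \<zero>" using orth c by (simp add: m_comm)
  have fe: "f \<otimes> (e \<otimes> x) = f \<otimes> x" "f' \<otimes> (e \<otimes> x) = f' \<otimes> x" if "x \<in> carrier R" for x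
  proof -
    have "f \<otimes> (e \<otimes> x) = (f \<otimes> f) \<otimes> x \<oplus> (f \<otimes> f') \<otimes> x" unfolding e using c(1,2) that by algebra
    then show "f \<otimes> (e \<otimes> x) = f \<otimes> x" using c(1,3) that orth by simp
    have "f' \<otimes> (e \<otimes> x) = (f' \<otimes> f) \<otimes> x \<oplus> (f' \<otimes> f') \<otimes> x" unfolding e using c(1,2) that by algebra
    then show "f' \<otimes> (e \<otimes> x) = f' \<otimes> x" using c(2,4) that orth' by simp
  qed
  have ee: "e \<otimes> e = e"
  proof -
    have "e \<otimes> e = f \<otimes> (e \<otimes> \<one>) \<oplus> f' \<otimes> (e \<otimes> \<one>)" using c(1,2) ec unfolding e by (simp add: l_distr)
    then show ?thesis unfolding fe[OF one_closed] using c(1,2) e by simp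
  qed
  have el: "x \<in> carrier R \<and> e \<otimes> x = x" if x: "x \<in> carrier (corner R e)" for x
  proof -
    obtain y where "y \<in> carrier R" "x = e \<otimes> y" using x by auto
    then show ?thesis using ec ee by (simp add: m_assoc[symmetric])
  qed
  have sum: "f \<otimes> x \<oplus> f' \<otimes> x = x" if x: "x \<in> carrier (corner R e)" for x
  proof -
    have "f \<otimes> x \<oplus> f' \<otimes> x = e \<otimes> x"
      by (simp only: e l_distr[OF c(1,2) conjunct1[OF el[OF x]]])
    then show ?thesis using el[OF x] by simp
  qed
  let ?h = "\<lambda>x. (f \<otimes> x, f' \<otimes> x)"
  show "?h \<in> ring_iso (corner R e) (RDirProd (corner R f) (corner R f'))"
  proof (rule ring_iso_memI)
    fix x assume x: "x \<in> carrier (corner R e)"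
    show "?h x \<in> carrier (RDirProd (corner R f) (corner R f'))"
      using el[OF x] by (simp add: RDirProd_carrier)
    fix y assume y: "y \<in> carrier (corner R e)"
    note xy = el[OF x] el[OF y]
    have m: "k \<otimes> (x \<otimes> y) = (k \<otimes> x) \<otimes> (k \<otimes> y)" if "k \<in> carrier R" "k \<otimes> k = k" for k
    proof -
      have "(k \<otimes> x) \<otimes> (k \<otimes> y) = (k \<otimes> k) \<otimes> (x \<otimes> y)"
        using that(1) conjunct1[OF xy(1)] conjunct1[OF xy(2)] by (simp add: m_ac)
      then show ?thesis by (simp only: that(2))
    qed
    show "?h (x \<otimes>\<^bsub>corner R e\<^esub> y) = ?h x \<otimes>\<^bsub>RDirProd (corner R f) (corner R f')\<^esub> ?h y"
      by (simp add: RDirProd_def DirProd_def monoid.defs m[OF c(1,3), symmetric] m[OF c(2,4), symmetric])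
    show "?h (x \<oplus>\<^bsub>corner R e\<^esub> y) = ?h x \<oplus>\<^bsub>RDirProd (corner R f) (corner R f')\<^esub> ?h y"
      using c(1,2) conjunct1[OF xy(1)] conjunct1[OF xy(2)]
      by (simp add: RDirProd_def DirProd_def monoid.defs r_distr)
  next
    have "f \<otimes> e = f" "f' \<otimes> e = f'" using fe[OF one_closed] by (simp_all only: r_one[OF ec] r_one[OF c(1)] r_one[OF c(2)])
    then show "?h \<one>\<^bsub>corner R e\<^esub> = \<one>\<^bsub>RDirProd (corner R f) (corner R f')\<^esub>"
      by (simp only: corner_simps) (simp add: RDirProd_def DirProd_def monoid.defs)
    show "bij_betw ?h (carrier (corner R e)) (carrier (RDirProd (corner R f) (corner R f')))"
      unfolding bij_betw_def
    proof (intro conjI inj_onI subset_antisym subsetI)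
      fix x y assume xy: "x \<in> carrier (corner R e)" "y \<in> carrier (corner R e)" "?h x = ?h y"
      have "f \<otimes> x = f \<otimes> y" "f' \<otimes> x = f' \<otimes> y" using xy(3) by (simp_all only: prod.inject)
      then have "f \<otimes> x \<oplus> f' \<otimes> x = f \<otimes> y \<oplus> f' \<otimes> y" by (simp only:)
      then show "x = y" by (simp only: sum[OF xy(1)] sum[OF xy(2)])
    next
      fix z assume "z \<in> ?h ` carrier (corner R e)"
      then obtain x where x: "x \<in> carrier (corner R e)" "z = ?h x" by (elim imageE)
      show "z \<in> carrier (RDirProd (corner R f) (corner R f'))"
        unfolding x(2) RDirProd_carrier corner_simps
        by (intro SigmaI imageI conjunct1[OF el[OF x(1)]])
    next
      fix z assume "z \<in> carrier (RDirProd (corner R f) (corner R f'))"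
      then obtain x y where z: "x \<in> carrier R" "y \<in> carrier R" "z = (f \<otimes> x, f' \<otimes> y)"
        by (auto simp: RDirProd_carrier)
      let ?w = "f \<otimes> x \<oplus> f' \<otimes> y"
      have id: "k \<otimes> ?w = (k \<otimes> f) \<otimes> x \<oplus> (k \<otimes> f') \<otimes> y" if "k \<in> carrier R" for k
        using that c(1,2) z(1,2) by algebra
      have fw: "f \<otimes> ?w = f \<otimes> x" "f' \<otimes> ?w = f' \<otimes> y"
        unfolding id[OF c(1)] id[OF c(2)] c(3,4) orth orth' using c(1,2) z(1,2) by simp_all
      have wc: "?w \<in> carrier R" using c(1,2) z(1,2) by simp
      have "f \<otimes> (e \<otimes> ?w) = f \<otimes> x" "f' \<otimes> (e \<otimes> ?w) = f' \<otimes> y" by (simp_all only: fe[OF wc] fw)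
      then show "z \<in> ?h ` carrier (corner R e)"
        unfolding z(3) corner_simps image_image by (intro image_eqI[OF _ wc]) simp
    qed
  qed
qed

text \<open>
  A pair \<open>x, y\<close> with \<open>x y = 0\<close> that lifts \<open>e\<^sub>0, 1 - e\<^sub>0\<close> gives the idempotent \<open>x / (x + y)\<close> lifting \<open>e\<^sub>0\<close>.
\<close>

definition lifts :: "'a \<Rightarrow> bool"
  where "lifts e0 \<longleftrightarrow> (\<exists>x\<in>carrier R. \<exists>y\<in>carrier R. x \<ominus> e0 \<in> J \<and> y \<ominus> (\<one> \<ominus> e0) \<in> J \<and> x \<otimes> y = \<zero>)"

lemma lifts_idem:
  assumes e0: "e0 \<in> carrier R" and l: "lifts e0"
  shows "\<exists>f. idem f \<and> f \<ominus> e0 \<in> J"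
proof -
  obtain x y where xy: "x \<in> carrier R" "y \<in> carrier R" "x \<ominus> e0 \<in> J" "y \<ominus> (\<one> \<ominus> e0) \<in> J" "x \<otimes> y = \<zero>"
    using l unfolding lifts_def by auto
  define d where "d = (x \<ominus> e0) \<oplus> (y \<ominus> (\<one> \<ominus> e0))"
  have dJ: "d \<in> J" unfolding d_def by (rule JD(3)[OF xy(3,4)])
  have dc: "d \<in> carrier R" using JD(7)[OF dJ] .
  have d: "(x \<oplus> y) \<ominus> \<one> = d" unfolding d_def using xy(1,2) e0 by algebra
  obtain v where v: "v \<in> carrier R" "v \<otimes> (x \<oplus> y) = \<one>"
    using unit_one_plus[of "x \<oplus> y"] d dJ xy(1,2) by auto
  let ?f = "v \<otimes> x"
  have "?f \<otimes> ?f = ?f \<otimes> (v \<otimes> (x \<oplus> y)) \<ominus> (v \<otimes> v) \<otimes> (x \<otimes> y)" using v(1) xy(1,2) by algebra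
  also have "\<dots> = ?f" unfolding v(2) xy(5) using v(1) xy(1,2) by algebra
  finally have ff: "?f \<otimes> ?f = ?f" .
  \<comment> \<open>Modulo \<open>J\<close> the sum \<open>x + y\<close> is 1 and so is its inverse
    \<open>v\<close>; hence \<open>v x\<close> is congruent to \<open>x\<close> and thus to
    \<open>e0\<close>. The identity makes this explicit.\<close>
  have "?f \<ominus> e0 = v \<otimes> (x \<ominus> e0) \<oplus> e0 \<otimes> (v \<ominus> v \<otimes> (x \<oplus> y)) \<oplus> e0 \<otimes> (v \<otimes> (x \<oplus> y) \<ominus> \<one>)"
    using v(1) xy(1,2) e0 by algebra
  also have "v \<ominus> v \<otimes> (x \<oplus> y) = (\<ominus> v) \<otimes> ((x \<oplus> y) \<ominus> \<one>)" using v(1) xy(1,2) by algebra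
  finally have "?f \<ominus> e0 = v \<otimes> (x \<ominus> e0) \<oplus> e0 \<otimes> ((\<ominus> v) \<otimes> d) \<oplus> e0 \<otimes> (\<one> \<ominus> \<one>)"
    unfolding d v(2) .
  also have "\<dots> \<in> J"
  proof (intro JD(3))
    show "v \<otimes> (x \<ominus> e0) \<in> J" by (rule JD(5)[OF xy(3) v(1)])
    show "e0 \<otimes> ((\<ominus> v) \<otimes> d) \<in> J" by (intro JD(5)[OF JD(5)[OF dJ]]) (use v(1) e0 in simp_all)
    show "e0 \<otimes> (\<one> \<ominus> \<one>) \<in> J" using JD(2) e0 by (simp add: a_minus_def r_neg)
  qed
  finally show ?thesis using ff v(1) xy(1) unfolding idem_def by auto
qed

text \<open>A Fitting argument. A corner that is not local contains nonunits \<open>b\<close> and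
  \<open>b'\<close> with sum \<open>e\<close>. The chain condition modulo \<open>J\<close> provides
  an idempotent modulo \<open>J\<close> in the ideal of a power of \<open>b\<close>; it is lifted
  and multiplied by \<open>e\<close>. The result is not \<open>e\<close>, as \<open>b\<close> would
  be a unit, and not zero, as \<open>b\<close> would be nilpotent modulo \<open>J\<close> and
  \<open>b'\<close> a unit.\<close>

lemma exists_splitting_idem:
  assumes e: "idem e" "e \<noteq> \<zero>" and nl: "\<not> local_ring (corner R e)"
    and lift: "\<And>e0. e0 \<in> carrier R \<Longrightarrow> e0 \<otimes> e0 \<ominus> e0 \<in> J \<Longrightarrow> lifts e0"
  shows "\<exists>f. idem f \<and> f \<otimes> e = f \<and> f \<noteq> \<zero> \<and> f \<noteq> e"
proof -
  have ec: "e \<in> carrier R" and ee: "e \<otimes> e = e" using e(1) unfolding idem_def by auto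
  interpret C: cring "corner R e" by (rule corner_cring[OF e(1)])
  have "\<not> (\<forall>b b'. b \<in> carrier (corner R e) \<longrightarrow> b' \<in> carrier (corner R e) \<longrightarrow> b \<oplus> b' = e \<longrightarrow>
      b \<in> Units (corner R e) \<or> b' \<in> Units (corner R e))"
  proof
    assume "\<forall>b b'. b \<in> carrier (corner R e) \<longrightarrow> b' \<in> carrier (corner R e) \<longrightarrow> b \<oplus> b' = e \<longrightarrow>
      b \<in> Units (corner R e) \<or> b' \<in> Units (corner R e)"
    then have "local_ring (corner R e)"
      by (intro C.local_ringI) (use e(2) in \<open>simp_all del: corner_simps(1)\<close>)
    then show False using nl by simp
  qed
  then obtain b b' where bb: "b \<in> carrier (corner R e)" "b' \<in> carrier (corner R e)" "b \<oplus> b' = e"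
    "b \<notin> Units (corner R e)" "b' \<notin> Units (corner R e)" by auto
  have el: "x \<in> carrier R \<and> e \<otimes> x = x" if x: "x \<in> carrier (corner R e)" for x
  proof -
    obtain y where "y \<in> carrier R" "x = e \<otimes> y" using x by auto
    then show ?thesis using ec ee by (simp add: m_assoc[symmetric])
  qed
  have bc: "b \<in> carrier R" "b' \<in> carrier R" "e \<otimes> b = b" "e \<otimes> b' = b'"
    by (rule conjunct1[OF el[OF bb(1)]] conjunct1[OF el[OF bb(2)]]
        conjunct2[OF el[OF bb(1)]] conjunct2[OF el[OF bb(2)]])+
  \<comment> \<open>Adding the ideal of \<open>1 - e\<close> translates "nonunit of the corner" into
    a proper ideal of the whole ring, to which Nakayama applies.\<close>
  have nonunit: "\<one> \<notin> PIdl x <+>\<^bsub>R\<^esub> PIdl (\<one> \<ominus> e)" if x: "x \<in> carrier (corner R e)" "x \<notin> Units (corner R e)" for x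
  proof
    have xc: "x \<in> carrier R" "e \<otimes> x = x" using el[OF x(1)] by auto
    assume "\<one> \<in> PIdl x <+>\<^bsub>R\<^esub> PIdl (\<one> \<ominus> e)"
    then obtain s t where st: "s \<in> carrier R" "t \<in> carrier R" "\<one> = s \<otimes> x \<oplus> t \<otimes> (\<one> \<ominus> e)"
      unfolding PIdl_sum_PIdl_iff by (elim bexE)
    have "e = e \<otimes> \<one>" using ec by simp
    also have "\<dots> = e \<otimes> (s \<otimes> x \<oplus> t \<otimes> (\<one> \<ominus> e))" using st(3) by simp
    also have "\<dots> = (e \<otimes> s) \<otimes> x \<oplus> t \<otimes> (e \<ominus> e \<otimes> e)" using ec st(1,2) xc(1) by algebra
    also have "\<dots> = (e \<otimes> s) \<otimes> x" unfolding ee using ec st(1,2) xc(1) by algebra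
    finally have 1: "(e \<otimes> s) \<otimes> x = e" by simp
    then have "x \<otimes> (e \<otimes> s) = e" using ec st(1) xc(1) by (simp add: m_comm)
    moreover have "e \<otimes> s \<in> carrier (corner R e)" using st(1) by simp
    ultimately have "x \<in> Units (corner R e)"
      unfolding Units_def using 1 x(1) by (auto simp del: corner_simps(1))
    then show False using x(2) by simp
  qed
  have sumI: "ideal (PIdl x <+>\<^bsub>R\<^esub> PIdl (\<one> \<ominus> e)) R" if "x \<in> carrier R" for x
    using that ec by (intro add_ideals cgenideal_ideal) simp_all
  have no_small: False if x: "x \<in> carrier (corner R e)" "x \<notin> Units (corner R e)"
    and k: "k \<in> carrier R" "e \<ominus> k \<otimes> x \<in> J" for x k
  proof -
    have xc: "x \<in> carrier R" using el[OF x(1)] by auto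
    have "\<one> = (k \<otimes> x \<oplus> \<one> \<otimes> (\<one> \<ominus> e)) \<oplus> (e \<ominus> k \<otimes> x)" using ec k(1) xc by algebra
    moreover have "k \<otimes> x \<oplus> \<one> \<otimes> (\<one> \<ominus> e) \<in> PIdl x <+>\<^bsub>R\<^esub> PIdl (\<one> \<ominus> e)"
      unfolding PIdl_sum_PIdl_iff by (intro bexI[OF _ k(1)] bexI[OF _ one_closed] refl)
    ultimately have "\<one> \<in> (PIdl x <+>\<^bsub>R\<^esub> PIdl (\<one> \<ominus> e)) <+>\<^bsub>R\<^esub> J"
      unfolding ideal_sum_iff[of _ "PIdl x <+>\<^bsub>R\<^esub> PIdl (\<one> \<ominus> e)"] using k(2) by blast
    then have "\<one> \<in> PIdl x <+>\<^bsub>R\<^esub> PIdl (\<one> \<ominus> e)" by (rule one_in_sum[OF sumI[OF xc]])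
    then show False using nonunit[OF x] by simp
  qed
  have bp: "b [^] n \<in> carrier R" for n :: nat using bc by simp
  have "\<exists>i0. \<forall>i\<ge>(i0::nat). PIdl (b [^] i) <+>\<^bsub>R\<^esub> J = PIdl (b [^] i0) <+>\<^bsub>R\<^esub> J"
  proof (rule dcc)
    fix i :: nat
    show "ideal (PIdl (b [^] i) <+>\<^bsub>R\<^esub> J) R" by (rule add_ideals[OF cgenideal_ideal[OF bp] J])
    show "J \<subseteq> PIdl (b [^] i) <+>\<^bsub>R\<^esub> J" by (rule ideal_sum_upper(2)[OF cgenideal_ideal[OF bp] J])
    show "PIdl (b [^] Suc i) <+>\<^bsub>R\<^esub> J \<subseteq> PIdl (b [^] i) <+>\<^bsub>R\<^esub> J"
    proof
      fix z assume "z \<in> PIdl (b [^] Suc i) <+>\<^bsub>R\<^esub> J"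
      then obtain s j where z: "s \<in> carrier R" "j \<in> J" "z = s \<otimes> (b [^] i \<otimes> b) \<oplus> j"
        unfolding PIdl_sum_iff nat_pow_Suc by auto
      have "z = (s \<otimes> b) \<otimes> b [^] i \<oplus> j" unfolding z(3) using z(1) bc(1) bp by (simp add: m_ac)
      moreover have "(s \<otimes> b) \<otimes> b [^] i \<in> PIdl (b [^] i)"
        unfolding PIdl_iff using z(1) bc(1) by (intro bexI[of _ "s \<otimes> b"]) simp_all
      ultimately show "z \<in> PIdl (b [^] i) <+>\<^bsub>R\<^esub> J" unfolding ideal_sum_iff using z(2) by blast
    qed
  qed
  then obtain i0 :: nat where i0: "\<And>i. i \<ge> i0 \<Longrightarrow> PIdl (b [^] i) <+>\<^bsub>R\<^esub> J = PIdl (b [^] i0) <+>\<^bsub>R\<^esub> J"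
    by auto
  \<comment> \<open>The exponent is at least 1, so that \<open>B\<close> is a multiple of
    \<open>b\<close> and is fixed by \<open>e\<close>, also when \<open>i0 = 0\<close>.\<close>
  define r where "r = Suc i0"
  define B where "B = b [^] r"
  have Bc: "B \<in> carrier R" unfolding B_def by (rule bp)
  have BB: "b [^] (r + r) = B \<otimes> B" unfolding B_def using bc(1) by (simp add: nat_pow_mult)
  have "B \<in> PIdl B <+>\<^bsub>R\<^esub> J"
    using ideal_sum_upper(1)[OF cgenideal_ideal[OF Bc] J] cgenideal_self[OF Bc] by auto
  also have "PIdl B <+>\<^bsub>R\<^esub> J = PIdl (B \<otimes> B) <+>\<^bsub>R\<^esub> J"
    using i0[of r] i0[of "r + r"] BB unfolding r_def B_def by simp
  finally obtain c j where cj: "c \<in> carrier R" "j \<in> J" "B = c \<otimes> (B \<otimes> B) \<oplus> j"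
    unfolding PIdl_sum_iff by auto
  have jc: "j \<in> carrier R" using JD(7)[OF cj(2)] .
  have Bb: "\<exists>k\<in>carrier R. B = k \<otimes> b" "e \<otimes> B = B"
  proof -
    show "\<exists>k\<in>carrier R. B = k \<otimes> b" unfolding B_def r_def using bp by auto
    have "e \<otimes> B = b [^] i0 \<otimes> (e \<otimes> b)" unfolding B_def r_def using bp bc(1) ec by (simp add: m_ac)
    then show "e \<otimes> B = B" unfolding bc(3) B_def r_def by simp
  qed
  \<comment> \<open>From \<open>B = c B^2\<close> modulo \<open>J\<close> it follows that
    \<open>(B c)^2 = B c\<close> modulo \<open>J\<close>.\<close>
  define e0 where "e0 = B \<otimes> c"
  have e0c: "e0 \<in> carrier R" unfolding e0_def using Bc cj(1) by simp
  have "e0 \<otimes> e0 \<ominus> e0 = c \<otimes> (c \<otimes> (B \<otimes> B) \<ominus> B)" unfolding e0_def using Bc cj(1) by algebra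
  also have "c \<otimes> (B \<otimes> B) \<ominus> B = (\<ominus> \<one>) \<otimes> j"
  proof -
    have "Y \<ominus> (Y \<oplus> j) = (\<ominus> \<one>) \<otimes> j" if "Y \<in> carrier R" for Y using that jc by algebra
    from this[of "c \<otimes> (B \<otimes> B)"] show ?thesis using cj(1,3) Bc by simp
  qed
  finally have "e0 \<otimes> e0 \<ominus> e0 \<in> J" using JD(5)[OF JD(5)[OF cj(2)] cj(1)] by simp
  then obtain f0 where f0: "idem f0" "f0 \<ominus> e0 \<in> J"
    using lifts_idem[OF e0c lift[OF e0c]] by auto
  have f0c: "f0 \<in> carrier R" "f0 \<otimes> f0 = f0" using f0(1) unfolding idem_def by auto
  define f where "f = e \<otimes> f0"
  have fc: "f \<in> carrier R" unfolding f_def using ec f0c by simp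
  have "f \<otimes> f = (e \<otimes> e) \<otimes> (f0 \<otimes> f0)" unfolding f_def using ec f0c(1) by (simp add: m_ac)
  then have ff: "idem f" unfolding idem_def using fc ee f0c(2) f_def by simp
  have "f \<otimes> e = (e \<otimes> e) \<otimes> f0" unfolding f_def using ec f0c(1) by (simp add: m_ac)
  then have fe: "f \<otimes> e = f" using ee f_def by simp
  have diff: "e \<otimes> (f0 \<ominus> e0) \<in> J" by (rule JD(5)[OF f0(2) ec])
  have "f \<noteq> e"
  \<comment> \<open>If \<open>f = e\<close>, then \<open>e\<close> is congruent to a multiple of
    \<open>b\<close> modulo \<open>J\<close>, which \<open>no_small\<close> forbids.\<close>
  proof
    assume fe: "f = e"
    obtain k where k: "k \<in> carrier R" "B = k \<otimes> b" using Bb(1) by auto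
    have "e \<ominus> (e \<otimes> k \<otimes> c) \<otimes> b = f \<ominus> e \<otimes> ((k \<otimes> b) \<otimes> c)" unfolding fe using ec k(1) bc(1) cj(1) by algebra
    also have "\<dots> = e \<otimes> (f0 \<ominus> e0)"
      unfolding f_def e0_def k(2)[symmetric] using ec f0c(1) Bc cj(1) by algebra
    finally have "e \<ominus> (e \<otimes> k \<otimes> c) \<otimes> b \<in> J" using diff by simp
    then show False
      by (rule no_small[OF bb(1,4), rotated]) (use ec k(1) cj(1) in simp)
  qed
  moreover have "f \<noteq> \<zero>"
  proof
    assume fz: "f = \<zero>"
    have "e \<otimes> e0 = f \<ominus> e \<otimes> (f0 \<ominus> e0)" unfolding f_def using ec f0c(1) e0c by algebra
    then have "e \<otimes> e0 = (\<ominus> \<one>) \<otimes> (e \<otimes> (f0 \<ominus> e0))"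
      unfolding fz using ec f0c(1) e0c by (simp add: a_minus_def l_minus)
    then have ee0: "e \<otimes> e0 \<in> J" using JD(5)[OF diff] by simp
    have "B = B \<otimes> (e \<otimes> e0) \<oplus> j"
    proof -
      have "B \<otimes> (e \<otimes> e0) = c \<otimes> ((e \<otimes> B) \<otimes> B)" unfolding e0_def using Bc cj(1) ec by (simp add: m_ac)
      then show ?thesis using cj(3) Bb(2) by simp
    qed
    then have BJ: "B \<in> J" using JD(3)[OF JD(5)[OF ee0 Bc] cj(2)] by simp
    have er: "e [^] r = e" unfolding r_def
    proof (induction i0)
      case (Suc i)
      then show ?case using ee by simp
    qed (use ec in simp)
    \<comment> \<open>Since \<open>B\<close> lies in \<open>J\<close>, the geometric sum shows that
      \<open>b' = e - b\<close> divides \<open>e - b^r\<close>, which is \<open>e\<close> modulo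
      \<open>J\<close>.\<close>
    obtain w where w: "w \<in> carrier R" "e [^] r \<ominus> b [^] r = (e \<ominus> b) \<otimes> w"
      using nat_pow_diff_factor[OF ec bc(1), of r] by auto
    have "e \<ominus> b = b'" unfolding bb(3)[symmetric] using bc(1,2) by algebra
    then have "e \<ominus> B = b' \<otimes> w" using w(2) unfolding er B_def by simp
    moreover have "e \<ominus> (e \<ominus> B) = B" using ec Bc by algebra
    ultimately have "e \<ominus> w \<otimes> b' = B" using w(1) bc(2) by (simp add: m_comm)
    then show False using no_small[OF bb(2,5) w(1)] BJ by simp
  qed
  ultimately show ?thesis using ff fe by auto
qed

text \<open>An idempotent whose corner is not a product of local rings splits into two, at least one
  of which has the same defect. Repeating this yields a strictly decreasing sequence of idempotents.
  The chain condition makes two neighbours generate the same ideal modulo \<open>J\<close>; their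
  difference is then an idempotent in \<open>J\<close>, hence zero.\<close>

lemma product_of_local_rings_of_lifts:
  assumes lift: "\<And>e0. e0 \<in> carrier R \<Longrightarrow> e0 \<otimes> e0 \<ominus> e0 \<in> J \<Longrightarrow> lifts e0"
  shows "product_of_local_rings R"
proof -
  define dec where "dec e \<longleftrightarrow> (\<exists>Rs :: 'a ring list. (\<forall>T\<in>set Rs. local_ring T) \<and> corner R e \<simeq> RDirProd_list Rs)" for e
  have decI: "dec e" if "\<forall>T\<in>set Rs. local_ring T" "corner R e \<simeq> RDirProd_list Rs" for e and Rs :: "'a ring list"
    unfolding dec_def by (intro exI[of _ Rs] conjI that)
  have step: "\<exists>f. (idem f \<and> \<not> dec f) \<and> f \<otimes> e = f \<and> f \<noteq> e" if e: "idem e" "\<not> dec e" for e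
  proof -
    have ec: "e \<in> carrier R" "e \<otimes> e = e" using e(1) unfolding idem_def by auto
    have "e \<noteq> \<zero>"
    proof
      assume ez: "e = \<zero>"
      \<comment> \<open>The zero idempotent cuts out the zero ring, which is the empty
        product.\<close>
      have cc: "carrier (corner R \<zero>) = {\<zero>}" using l_null one_closed by (auto simp: image_iff)
      have "(\<lambda>_. []) \<in> ring_iso (corner R \<zero>) (RDirProd_list [])"
        by (rule ring_iso_memI) (auto simp: cc monoid.defs bij_betw_def simp del: corner_simps(1))
      then have "dec e" unfolding ez by (intro decI[of "[]"] is_ring_isoI) simp_all
      then show False using e(2) by simp
    qed
    moreover have "\<not> local_ring (corner R e)"
    proof
      assume l: "local_ring (corner R e)"
      have "corner R e \<simeq> RDirProd (corner R e) (RDirProd_list ([] :: 'a ring list))"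
        unfolding RDirProd_list_nil by (rule is_ring_isoI, rule RDirProd_iso7)
      moreover have "RDirProd (corner R e) (RDirProd_list ([] :: 'a ring list)) \<simeq> RDirProd_list [corner R e]"
        by (rule is_ring_isoI, rule RDirProd_list_iso1)
      ultimately have "corner R e \<simeq> RDirProd_list [corner R e]" by (rule ring_iso_trans)
      then have "dec e" by (intro decI[of "[corner R e]"]) (use l in simp_all)
      then show False using e(2) by simp
    qed
    ultimately obtain f where f: "idem f" "f \<otimes> e = f" "f \<noteq> \<zero>" "f \<noteq> e"
      using exists_splitting_idem[OF e(1) _ _ lift] by auto
    have fc: "f \<in> carrier R" "f \<otimes> f = f" using f(1) unfolding idem_def by auto
    define f' where "f' = e \<ominus> f"
    have f'c: "f' \<in> carrier R" unfolding f'_def using ec fc by simp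
    have "f' \<otimes> f' = e \<otimes> e \<ominus> f \<otimes> e \<ominus> f \<otimes> e \<oplus> f \<otimes> f" unfolding f'_def using ec(1) fc(1) by algebra
    also have "\<dots> = f'" unfolding f(2) ec(2) fc(2) f'_def using ec(1) fc(1) by algebra
    finally have f'i: "idem f'" unfolding idem_def using f'c by simp
    have "f \<otimes> f' = f \<otimes> e \<ominus> f \<otimes> f" unfolding f'_def using ec(1) fc(1) by algebra
    also have "\<dots> = \<zero>" unfolding f(2) fc(2) using fc(1) by algebra
    finally have orth: "f \<otimes> f' = \<zero>" .
    have sum: "e = f \<oplus> f'" unfolding f'_def using ec(1) fc(1) by algebra
    have "f' \<otimes> e = e \<otimes> e \<ominus> f \<otimes> e" unfolding f'_def using ec(1) fc(1) by algebra
    then have f'e: "f' \<otimes> e = f'" unfolding ec(2) f(2) f'_def .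
    have "f' \<noteq> e"
    proof
      assume "f' = e"
      then have "e = f \<oplus> e" using sum by simp
      then show False using f(3) fc(1) ec(1) by simp
    qed
    have "\<not> dec f \<or> \<not> dec f'"
    proof (rule ccontr)
      assume "\<not> ?thesis"
      then obtain Rs Ss :: "'a ring list" where RS: "\<forall>T\<in>set Rs. local_ring T" "corner R f \<simeq> RDirProd_list Rs"
        "\<forall>T\<in>set Ss. local_ring T" "corner R f' \<simeq> RDirProd_list Ss" unfolding dec_def by auto
      obtain \<phi> \<psi> where "\<phi> \<in> ring_iso (corner R f) (RDirProd_list Rs)" "\<psi> \<in> ring_iso (corner R f') (RDirProd_list Ss)"
        using RS(2,4) unfolding is_ring_iso_def by auto
      then have "RDirProd (corner R f) (corner R f') \<simeq> RDirProd (RDirProd_list Rs) (RDirProd_list Ss)"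
        by (rule is_ring_isoI[OF RDirProd_iso6])
      then have "corner R e \<simeq> RDirProd_list (Rs @ Ss)"
        using corner_split[OF f(1) f'i orth sum] RDirProd_list_append ring_iso_trans by metis
      then have "dec e" by (intro decI[of "Rs @ Ss"]) (use RS(1,3) in auto)
      then show False using e(2) by simp
    qed
    then show ?thesis using f(1,2,4) f'i f'e \<open>f' \<noteq> e\<close> by auto
  qed
  have idem_dec: "dec e" if e: "idem e" for e
  proof (rule ccontr)
    assume "\<not> dec e"
    then have "\<exists>E. \<forall>n. (idem (E n) \<and> \<not> dec (E n)) \<and> E (Suc n) \<otimes> E n = E (Suc n) \<and> E (Suc n) \<noteq> E n"
      using e step by (intro dependent_nat_choice) auto
    then obtain E where E: "\<And>n. idem (E n)" "\<And>n. E (Suc n) \<otimes> E n = E (Suc n)" "\<And>n. E (Suc n) \<noteq> E (n::nat)"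
      by auto
    have Ec: "E n \<in> carrier R" "E n \<otimes> E n = E n" for n using E(1) unfolding idem_def by auto
    have "\<exists>i0. \<forall>i\<ge>(i0::nat). PIdl (E i) <+>\<^bsub>R\<^esub> J = PIdl (E i0) <+>\<^bsub>R\<^esub> J"
    proof (rule dcc)
      fix i :: nat
      show "ideal (PIdl (E i) <+>\<^bsub>R\<^esub> J) R" by (rule add_ideals[OF cgenideal_ideal[OF Ec(1)] J])
      show "J \<subseteq> PIdl (E i) <+>\<^bsub>R\<^esub> J" by (rule ideal_sum_upper(2)[OF cgenideal_ideal[OF Ec(1)] J])
      show "PIdl (E (Suc i)) <+>\<^bsub>R\<^esub> J \<subseteq> PIdl (E i) <+>\<^bsub>R\<^esub> J"
      proof
        fix z assume "z \<in> PIdl (E (Suc i)) <+>\<^bsub>R\<^esub> J"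
        then obtain s j where z: "s \<in> carrier R" "j \<in> J" "z = s \<otimes> E (Suc i) \<oplus> j"
          unfolding PIdl_sum_iff by auto
        have "s \<otimes> E (Suc i) = (s \<otimes> E (Suc i)) \<otimes> E i" using E(2) z(1) Ec(1) by (simp add: m_assoc)
        then have "s \<otimes> E (Suc i) \<in> PIdl (E i)"
          unfolding PIdl_iff using z(1) Ec(1) by (intro bexI[of _ "s \<otimes> E (Suc i)"]) simp_all
        then show "z \<in> PIdl (E i) <+>\<^bsub>R\<^esub> J" unfolding ideal_sum_iff z(3) using z(2) by blast
      qed
    qed
    then obtain i where i: "PIdl (E (Suc i)) <+>\<^bsub>R\<^esub> J = PIdl (E i) <+>\<^bsub>R\<^esub> J" by (metis le_SucI order_refl)
    have "E i \<in> PIdl (E i) <+>\<^bsub>R\<^esub> J"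
      using ideal_sum_upper(1)[OF cgenideal_ideal[OF Ec(1)] J] cgenideal_self[OF Ec(1)] by blast
    then have "E i \<in> PIdl (E (Suc i)) <+>\<^bsub>R\<^esub> J" unfolding i .
    then obtain s j where sj: "s \<in> carrier R" "j \<in> J" "E i = s \<otimes> E (Suc i) \<oplus> j"
      unfolding PIdl_sum_iff by auto
    have jc: "j \<in> carrier R" using JD(7)[OF sj(2)] .
    define a b where "a = E i" and "b = E (Suc i)"
    have ab: "a \<in> carrier R" "b \<in> carrier R" "a \<otimes> a = a" "b \<otimes> b = b" "b \<otimes> a = b" "a = s \<otimes> b \<oplus> j" "a \<noteq> b"
      unfolding a_def b_def by (rule Ec E(2) sj(3) E(3)[symmetric])+
    \<comment> \<open>From \<open>d b = 0\<close> and \<open>a = s b + j\<close> one gets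
      \<open>d = d a = d j\<close>, which lies in \<open>J\<close>.\<close>
    define d where "d = a \<ominus> b"
    have dc: "d \<in> carrier R" unfolding d_def using ab by simp
    have "d \<otimes> d = a \<otimes> a \<ominus> b \<otimes> a \<ominus> b \<otimes> a \<oplus> b \<otimes> b" unfolding d_def using ab(1,2) by algebra
    also have "\<dots> = d" unfolding ab(3,4,5) d_def using ab(1,2) by algebra
    finally have di: "idem d" unfolding idem_def using dc by simp
    have "d = a \<otimes> a \<ominus> b \<otimes> a" unfolding ab(3,5) d_def ..
    also have "\<dots> = d \<otimes> a" unfolding d_def using ab(1,2) by algebra
    also have "\<dots> = d \<otimes> (s \<otimes> b \<oplus> j)" using ab(6) by simp
    also have "\<dots> = s \<otimes> (b \<otimes> a \<ominus> b \<otimes> b) \<oplus> d \<otimes> j" unfolding d_def using ab(1,2) sj(1) jc by algebra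
    also have "\<dots> = d \<otimes> j" unfolding ab(4,5) using ab(1,2) sj(1) jc dc by (simp add: r_right_minus_eq a_minus_def r_neg)
    finally have "d \<in> J" using JD(5)[OF sj(2) dc] by simp
    then have "d = \<zero>" by (rule idem_in_J[OF di])
    then show False using ab(1,2,7) unfolding d_def by (simp add: r_right_minus_eq)
  qed
  have "idem \<one>" unfolding idem_def by simp
  then obtain Rs :: "'a ring list" where Rs: "\<forall>T\<in>set Rs. local_ring T" "corner R \<one> \<simeq> RDirProd_list Rs"
    using idem_dec unfolding dec_def by auto
  have c1: "carrier (corner R \<one>) = carrier R" by (auto simp: image_iff)
  have "id \<in> ring_iso R (corner R \<one>)"
    by (rule ring_iso_memI) (auto simp: c1 simp del: corner_simps(1))
  then have "R \<simeq> RDirProd_list Rs" using Rs(2) is_ring_isoI ring_iso_trans by metis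
  then show ?thesis unfolding product_of_local_rings_def using Rs(1) by auto
qed

end


section \<open>Finite algebras over a local ring\<close>

primrec lincomb :: "('b, 'n) ring_scheme \<Rightarrow> ('a \<Rightarrow> 'b) \<Rightarrow> (nat \<Rightarrow> 'b) \<Rightarrow> nat \<Rightarrow> (nat \<Rightarrow> 'a) \<Rightarrow> 'b"
  where
    "lincomb S h z 0 c = \<zero>\<^bsub>S\<^esub>"
  | "lincomb S h z (Suc k) c = lincomb S h z k c \<oplus>\<^bsub>S\<^esub> h (c k) \<otimes>\<^bsub>S\<^esub> z k"

lemma lincomb_cong:
  "(\<And>i. i < k \<Longrightarrow> c i = d i) \<Longrightarrow> (\<And>i. i < k \<Longrightarrow> y i = z i) \<Longrightarrow> lincomb S h y k c = lincomb S h z k d"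
  by (induction k) simp_all

text \<open>Shows that the product of two lifts of an element idempotent modulo an ideal is again
  such a lift: each summand on the left lies in the ideal.\<close>

lemma (in cring) lift_mult_identity:
  assumes "e \<in> carrier R" "x \<in> carrier R" "y \<in> carrier R"
  shows "x \<otimes> (y \<ominus> e) \<oplus> e \<otimes> (x \<ominus> e) \<oplus> (e \<otimes> e \<ominus> e) = x \<otimes> y \<ominus> e"
  using assms by algebra

context ring_hom_cring
begin

lemma lincomb_closed:
  "(\<And>i. i < k \<Longrightarrow> c i \<in> carrier R) \<Longrightarrow> (\<And>i. i < k \<Longrightarrow> z i \<in> carrier S) \<Longrightarrow> lincomb S h z k c \<in> carrier S"
  by (induction k) simp_all

lemma lincomb_add:
  assumes "\<And>i. i < k \<Longrightarrow> c i \<in> carrier R" "\<And>i. i < k \<Longrightarrow> d i \<in> carrier R" "\<And>i. i < k \<Longrightarrow> z i \<in> carrier S"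
  shows "lincomb S h z k (\<lambda>i. c i \<oplus> d i) = lincomb S h z k c \<oplus>\<^bsub>S\<^esub> lincomb S h z k d"
  using assms
proof (induction k)
  case (Suc k)
  have c: "lincomb S h z k c \<in> carrier S" "lincomb S h z k d \<in> carrier S"
    using Suc.prems by (auto intro: lincomb_closed)
  have "lincomb S h z k (\<lambda>i. c i \<oplus> d i) = lincomb S h z k c \<oplus>\<^bsub>S\<^esub> lincomb S h z k d"
    by (rule Suc.IH) (simp_all add: Suc.prems)
  then show ?case
    using c Suc.prems[of k] by (simp add: S.l_distr S.a_ac)
qed simp

lemma lincomb_smult:
  assumes "\<And>i. i < k \<Longrightarrow> c i \<in> carrier R" "\<And>i. i < k \<Longrightarrow> z i \<in> carrier S" "a \<in> carrier R"
  shows "lincomb S h z k (\<lambda>i. a \<otimes> c i) = h a \<otimes>\<^bsub>S\<^esub> lincomb S h z k c"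
  using assms
proof (induction k)
  case (Suc k)
  have c: "lincomb S h z k c \<in> carrier S"
    using Suc.prems by (auto intro: lincomb_closed)
  have "lincomb S h z k (\<lambda>i. a \<otimes> c i) = h a \<otimes>\<^bsub>S\<^esub> lincomb S h z k c"
    by (rule Suc.IH) (simp_all add: Suc.prems)
  then show ?case
    using c Suc.prems(1,2)[of k] Suc.prems(3) by (simp add: S.r_distr S.m_assoc)
qed simp

lemma lincomb_mult:
  assumes "\<And>i. i < k \<Longrightarrow> c i \<in> carrier R" "\<And>i. i < k \<Longrightarrow> z i \<in> carrier S" "y \<in> carrier S"
  shows "y \<otimes>\<^bsub>S\<^esub> lincomb S h z k c = lincomb S h (\<lambda>i. y \<otimes>\<^bsub>S\<^esub> z i) k c"
  using assms
proof (induction k)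
  case (Suc k)
  have c: "lincomb S h z k c \<in> carrier S"
    using Suc.prems by (auto intro: lincomb_closed)
  have "y \<otimes>\<^bsub>S\<^esub> lincomb S h z k c = lincomb S h (\<lambda>i. y \<otimes>\<^bsub>S\<^esub> z i) k c"
    by (rule Suc.IH) (simp_all add: Suc.prems)
  then show ?case
    using c Suc.prems(1,2)[of k] Suc.prems(3) by (simp add: S.r_distr S.m_lcomm)
qed simp

end

text \<open>A finite algebra \<open>S\<close> over a local ring \<open>R\<close>. Locality enters
  through \<open>M_prime\<close> and \<open>M_units\<close>; the generators \<open>g\<close> may
  satisfy relations, so coordinates are in general not unique.\<close>

locale finite_hom = ring_hom_cring R S h + R?: noetherian_cring R
  for R :: "('a, 'm) ring_scheme" (structure) and S :: "('b, 'n) ring_scheme" (structure) and h :: "'a \<Rightarrow> 'b" +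
  fixes g n M
  assumes g: "\<And>i. i < n \<Longrightarrow> g i \<in> carrier S"
    and gen: "\<And>b. b \<in> carrier S \<Longrightarrow> \<exists>c. (\<forall>i<n. c i \<in> carrier R) \<and> b = lincomb S h g n c"
    and M_prime: "primeideal M R"
    and M_units: "\<And>a. a \<in> carrier R \<Longrightarrow> a \<notin> M \<Longrightarrow> a \<in> Units R"
begin

abbreviation "dec \<equiv> lincomb S h g"

lemma M_ideal: "ideal M R"
  using M_prime by (rule primeideal.axioms(1))

lemma dec_closed: "k \<le> n \<Longrightarrow> (\<And>i. i < k \<Longrightarrow> c i \<in> carrier R) \<Longrightarrow> dec k c \<in> carrier S"
  using g by (intro lincomb_closed) simp_all

lemma dec_add:
  "k \<le> n \<Longrightarrow> (\<And>i. i < k \<Longrightarrow> c i \<in> carrier R) \<Longrightarrow> (\<And>i. i < k \<Longrightarrow> d i \<in> carrier R) \<Longrightarrow>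
    dec k (\<lambda>i. c i \<oplus> d i) = dec k c \<oplus>\<^bsub>S\<^esub> dec k d"
  using g by (intro lincomb_add) simp_all

lemma dec_smult:
  "k \<le> n \<Longrightarrow> (\<And>i. i < k \<Longrightarrow> c i \<in> carrier R) \<Longrightarrow> a \<in> carrier R \<Longrightarrow> dec k (\<lambda>i. a \<otimes> c i) = h a \<otimes>\<^bsub>S\<^esub> dec k c"
  using g by (intro lincomb_smult) simp_all

text \<open>The extension of \<open>I\<close> to an ideal of \<open>S\<close>. Because the
  \<open>g i\<close> span \<open>S\<close> over \<open>R\<close>, combinations of these alone with
  coefficients in \<open>I\<close> suffice. In this form membership is a condition on
  coordinates.\<close>

definition ext :: "'a set \<Rightarrow> 'b set"
  where "ext I = {dec n c | c. \<forall>i<n. c i \<in> I}"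

lemma ext_iff: "x \<in> ext I \<longleftrightarrow> (\<exists>c. (\<forall>i<n. c i \<in> I) \<and> x = dec n c)"
  unfolding ext_def by blast

lemma extI: "(\<And>i. i < n \<Longrightarrow> c i \<in> I) \<Longrightarrow> dec n c \<in> ext I"
  unfolding ext_iff by blast

lemma extE:
  assumes "x \<in> ext I"
  obtains c where "\<And>i. i < n \<Longrightarrow> c i \<in> I" "x = dec n c"
  using assms unfolding ext_iff by blast

lemma ext_carrier: "ext (carrier R) = carrier S"
proof
  show "ext (carrier R) \<subseteq> carrier S"
    by (intro subsetI, erule extE) (simp add: dec_closed)
  show "carrier S \<subseteq> ext (carrier R)"
    unfolding subset_iff ext_iff using gen by simp
qed

lemma ext_sub:
  assumes "ideal I R" "x \<in> ext I"
  shows "x \<in> carrier S"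
  using assms(2) by (rule extE) (simp add: dec_closed R.ideal_memD(7)[OF assms(1)])

lemma ext_zero: "ideal I R \<Longrightarrow> \<zero>\<^bsub>S\<^esub> \<in> ext I"
proof -
  assume I: "ideal I R"
  have "dec k (\<lambda>_. \<zero>) = \<zero>\<^bsub>S\<^esub>" if "k \<le> n" for k
    using that g by (induction k) simp_all
  then have "dec n (\<lambda>_. \<zero>) = \<zero>\<^bsub>S\<^esub>" by simp
  then show ?thesis using extI[of "\<lambda>_. \<zero>" I] R.ideal_memD(2)[OF I] by simp
qed

lemma ext_add:
  assumes I: "ideal I R" and xy: "x \<in> ext I" "y \<in> ext I"
  shows "x \<oplus>\<^bsub>S\<^esub> y \<in> ext I"
proof -
  obtain c where c: "\<And>i. i < n \<Longrightarrow> c i \<in> I" "x = dec n c" using xy(1) by (rule extE) (rule that, simp_all)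
  obtain d where d: "\<And>i. i < n \<Longrightarrow> d i \<in> I" "y = dec n d" using xy(2) by (rule extE) (rule that, simp_all)
  have "x \<oplus>\<^bsub>S\<^esub> y = dec n (\<lambda>i. c i \<oplus> d i)"
    unfolding c(2) d(2) using c(1) d(1) R.ideal_memD(7)[OF I] by (intro dec_add[symmetric]) simp_all
  also have "\<dots> \<in> ext I" using c(1) d(1) R.ideal_memD(3)[OF I] by (intro extI) simp
  finally show ?thesis .
qed

lemma lincomb_in_ext:
  assumes I: "ideal I R" "ideal K R" "ideal L R" and prod: "\<And>a b. a \<in> I \<Longrightarrow> b \<in> K \<Longrightarrow> a \<otimes> b \<in> L"
  shows "(\<And>i. i < k \<Longrightarrow> c i \<in> I) \<Longrightarrow> (\<And>i. i < k \<Longrightarrow> z i \<in> ext K) \<Longrightarrow> lincomb S h z k c \<in> ext L"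
proof (induction k)
  case 0
  show ?case using ext_zero[OF I(3)] by simp
next
  case (Suc k)
  have "z k \<in> ext K" using Suc.prems(2) by simp
  then obtain d where d: "\<And>i. i < n \<Longrightarrow> d i \<in> K" "z k = dec n d" by (rule extE) (rule that, simp_all)
  have ck: "c k \<in> I" using Suc.prems(1) by simp
  have "h (c k) \<otimes>\<^bsub>S\<^esub> z k = dec n (\<lambda>i. c k \<otimes> d i)"
    unfolding d(2) using d(1) R.ideal_memD(7)[OF I(2)] R.ideal_memD(7)[OF I(1) ck]
    by (intro dec_smult[symmetric]) simp_all
  also have "\<dots> \<in> ext L" using prod[OF ck d(1)] by (intro extI) simp
  finally have "h (c k) \<otimes>\<^bsub>S\<^esub> z k \<in> ext L" .
  moreover have "lincomb S h z k c \<in> ext L" using Suc.prems by (intro Suc.IH) simp_all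
  ultimately show ?case using ext_add[OF I(3)] by simp
qed

text \<open>The closure of \<open>ext K\<close> under multiplication is assumed as \<open>KS\<close>
  because the lemma is applied to \<open>K = carrier R\<close>, where it is trivial, in order to
  prove that very closure for all ideals.\<close>

lemma ext_prod:
  assumes I: "ideal I R" "ideal K R" "ideal L R" and prod: "\<And>a b. a \<in> I \<Longrightarrow> b \<in> K \<Longrightarrow> a \<otimes> b \<in> L"
    and KS: "\<And>x y. x \<in> carrier S \<Longrightarrow> y \<in> ext K \<Longrightarrow> x \<otimes>\<^bsub>S\<^esub> y \<in> ext K"
    and xy: "x \<in> ext I" "y \<in> ext K"
  shows "x \<otimes>\<^bsub>S\<^esub> y \<in> ext L"
proof -
  obtain c where c: "\<And>i. i < n \<Longrightarrow> c i \<in> I" "x = dec n c" using xy(1) by (rule extE) (rule that, simp_all)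
  have yc: "y \<in> carrier S" using ext_sub[OF I(2) xy(2)] .
  have "x \<otimes>\<^bsub>S\<^esub> y = y \<otimes>\<^bsub>S\<^esub> dec n c"
    using c ext_sub[OF I(1) xy(1)] yc by (simp add: S.m_comm)
  also have "\<dots> = lincomb S h (\<lambda>i. y \<otimes>\<^bsub>S\<^esub> g i) n c"
    using c(1) R.ideal_memD(7)[OF I(1)] g yc by (intro lincomb_mult) simp_all
  also have "\<dots> \<in> ext L"
  proof (rule lincomb_in_ext[OF I prod c(1)])
    fix i assume "i < n"
    then have "g i \<otimes>\<^bsub>S\<^esub> y \<in> ext K" using KS g xy(2) by simp
    then show "y \<otimes>\<^bsub>S\<^esub> g i \<in> ext K" using g[OF \<open>i < n\<close>] yc by (simp add: S.m_comm)
  qed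
  finally show ?thesis .
qed

lemma ext_mult:
  assumes I: "ideal I R" and x: "x \<in> carrier S" and y: "y \<in> ext I"
  shows "x \<otimes>\<^bsub>S\<^esub> y \<in> ext I"
proof -
  have "y \<otimes>\<^bsub>S\<^esub> x \<in> ext I"
    by (rule ext_prod[OF I R.oneideal I _ _ y])
      (use R.ideal_memD(6)[OF I] x in \<open>simp_all add: ext_carrier\<close>)
  then show ?thesis using x ext_sub[OF I y] by (simp add: S.m_comm)
qed

lemma ext_ideal: "ideal I R \<Longrightarrow> ideal (ext I) S"
  by (rule S.ideal_of_closed) (auto intro: ext_zero ext_add ext_mult ext_sub)

lemma ext_smult: "ideal I R \<Longrightarrow> a \<in> I \<Longrightarrow> b \<in> carrier S \<Longrightarrow> h a \<otimes>\<^bsub>S\<^esub> b \<in> ext I"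
proof -
  assume I: "ideal I R" and a: "a \<in> I" and b: "b \<in> carrier S"
  obtain c where c: "\<forall>i<n. c i \<in> carrier R" "b = dec n c" using gen[OF b] by auto
  have "h a \<otimes>\<^bsub>S\<^esub> b = dec n (\<lambda>i. a \<otimes> c i)"
    unfolding c(2) using c(1) R.ideal_memD(7)[OF I a] by (intro dec_smult[symmetric]) simp_all
  also have "\<dots> \<in> ext I" using c(1) R.ideal_memD(6)[OF I a] by (intro extI) simp
  finally show ?thesis .
qed

lemma ext_zero_ideal: "ext {\<zero>} = {\<zero>\<^bsub>S\<^esub>}"
proof -
  have "dec k c = \<zero>\<^bsub>S\<^esub>" if "k \<le> n" "\<And>i. i < n \<Longrightarrow> c i = \<zero>" for k c
    using that(1)
  proof (induction k)
    case (Suc k)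
    then show ?case using that(2)[of k] g[of k] by simp
  qed simp
  note dec_zero = this
  show ?thesis
  proof (intro equalityI subsetI)
    fix x assume "x \<in> ext {\<zero>}"
    then obtain c where c: "\<And>i. i < n \<Longrightarrow> c i \<in> {\<zero>}" "x = dec n c" by (rule extE) (rule that, simp_all)
    have "dec n c = \<zero>\<^bsub>S\<^esub>" by (rule dec_zero) (use c(1) in simp_all)
    then show "x \<in> {\<zero>\<^bsub>S\<^esub>}" unfolding c(2) by simp
  next
    fix x assume "x \<in> {\<zero>\<^bsub>S\<^esub>}"
    then show "x \<in> ext {\<zero>}" using ext_zero[OF R.zeroideal] by simp
  qed
qed

text \<open>Nakayama's lemma by discarding generators. With \<open>P k\<close> saying that
  \<open>W\<close> and the first \<open>k\<close> generators span \<open>S\<close>, a downward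
  induction reaches \<open>P 0\<close>, that is \<open>W = S\<close>.\<close>

lemma ext_nakayama:
  assumes W: "ideal W S" and sub: "carrier S \<subseteq> W <+>\<^bsub>S\<^esub> ext M"
  shows "W = carrier S"
proof -
  note WD = S.ideal_memD[OF W] and MD = R.ideal_memD[OF M_ideal]
  define P where "P k \<longleftrightarrow> (\<forall>x\<in>carrier S. \<exists>w\<in>W. \<exists>c. (\<forall>i<k. c i \<in> carrier R) \<and> x = w \<oplus>\<^bsub>S\<^esub> dec k c)" for k
  have PD: "\<exists>w\<in>W. \<exists>c. (\<forall>i<k. c i \<in> carrier R) \<and> x = w \<oplus>\<^bsub>S\<^esub> dec k c" if "P k" "x \<in> carrier S" for x k
    using that unfolding P_def by simp
  have "P 0"
  proof (rule inc_induct[of 0 n P])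
    show "P n"
      unfolding P_def
    proof
      fix x assume x: "x \<in> carrier S"
      obtain c where c: "\<forall>i<n. c i \<in> carrier R" "x = dec n c" using gen[OF x] by auto
      then show "\<exists>w\<in>W. \<exists>c. (\<forall>i<n. c i \<in> carrier R) \<and> x = w \<oplus>\<^bsub>S\<^esub> dec n c"
        using x by (intro bexI[OF _ WD(2)] exI[of _ c]) simp
    qed
  next
    fix k assume k: "0 \<le> k" "k < n" and P: "P (Suc k)"
    have kn: "k \<le> n" "Suc k \<le> n" using k by simp_all
    have gk: "g k \<in> carrier S" using g k by simp
    have "g k \<in> W <+>\<^bsub>S\<^esub> ext M" using sub gk by (rule subsetD)
    then obtain w y where wy: "w \<in> W" "y \<in> ext M" "g k = w \<oplus>\<^bsub>S\<^esub> y"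
      unfolding S.ideal_sum_iff by (elim bexE)
    obtain d where d: "\<And>i. i < n \<Longrightarrow> d i \<in> M" "y = dec n d" using wy(2) by (rule extE) (rule that, simp_all)
    \<comment> \<open>The combination \<open>d\<close> uses all \<open>n\<close> generators. By
      \<open>P (Suc k)\<close> each of them is rewritten in terms of the first \<open>k + 1\<close>
      modulo \<open>W\<close>, and the coefficients stay in \<open>M\<close>.\<close>
    have "\<exists>w'\<in>W. \<exists>e. (\<forall>i<Suc k. e i \<in> M) \<and> dec j d = w' \<oplus>\<^bsub>S\<^esub> dec (Suc k) e" if "j \<le> n" for j
      using that
    proof (induction j)
      case 0
      have "dec (Suc k) (\<lambda>_. \<zero>) = \<zero>\<^bsub>S\<^esub> \<otimes>\<^bsub>S\<^esub> dec (Suc k) (\<lambda>_. \<zero>)"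
        using dec_smult[OF kn(2), of "\<lambda>_. \<zero>" \<zero>] by simp
      also have "\<dots> = \<zero>\<^bsub>S\<^esub>" using dec_closed[OF kn(2), of "\<lambda>_. \<zero>"] by (simp del: lincomb.simps)
      finally have "dec (Suc k) (\<lambda>_. \<zero>) = \<zero>\<^bsub>S\<^esub>" .
      then show ?case
        by (intro bexI[OF _ WD(2)] exI[of _ "\<lambda>_. \<zero>"]) (simp add: MD(2) del: lincomb.simps(2))
    next
      case (Suc j)
      then obtain w' e where we: "w' \<in> W" "\<forall>i<Suc k. e i \<in> M" "dec j d = w' \<oplus>\<^bsub>S\<^esub> dec (Suc k) e" by auto
      have j: "j < n" using Suc.prems by simp
      have dj: "d j \<in> M" "d j \<in> carrier R" using d(1)[OF j] MD(7) by auto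
      obtain w1 c1 where wc: "w1 \<in> W" "\<forall>i<Suc k. c1 i \<in> carrier R" "g j = w1 \<oplus>\<^bsub>S\<^esub> dec (Suc k) c1"
        using PD[OF P g[OF j]] by auto
      let ?e = "\<lambda>i. e i \<oplus> d j \<otimes> c1 i"
      have eM: "?e i \<in> M" if "i < Suc k" for i
        using MD(3)[OF we(2)[rule_format, OF that] MD(6)[OF dj(1) wc(2)[rule_format, OF that]]] .
      have "dec (Suc k) ?e = dec (Suc k) e \<oplus>\<^bsub>S\<^esub> dec (Suc k) (\<lambda>i. d j \<otimes> c1 i)"
        by (rule dec_add[OF kn(2)]) (use we(2) MD(7) dj(2) wc(2) in simp_all)
      also have "dec (Suc k) (\<lambda>i. d j \<otimes> c1 i) = h (d j) \<otimes>\<^bsub>S\<^esub> dec (Suc k) c1"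
        by (rule dec_smult[OF kn(2)]) (use dj(2) wc(2) in simp_all)
      finally have e: "dec (Suc k) ?e = dec (Suc k) e \<oplus>\<^bsub>S\<^esub> h (d j) \<otimes>\<^bsub>S\<^esub> dec (Suc k) c1" .
      have cl: "dec (Suc k) e \<in> carrier S" "dec (Suc k) c1 \<in> carrier S" "w' \<in> carrier S" "w1 \<in> carrier S" "h (d j) \<in> carrier S"
        using dec_closed[OF kn(2), of e] dec_closed[OF kn(2), of c1] we wc WD(7) MD(7) dj(2)
        by (simp_all del: lincomb.simps)
      have "dec (Suc j) d = (w' \<oplus>\<^bsub>S\<^esub> dec (Suc k) e) \<oplus>\<^bsub>S\<^esub> h (d j) \<otimes>\<^bsub>S\<^esub> (w1 \<oplus>\<^bsub>S\<^esub> dec (Suc k) c1)"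
        unfolding lincomb.simps(2)[of S h g j] we(3) wc(3)[symmetric] ..
      also have "\<dots> = (w' \<oplus>\<^bsub>S\<^esub> h (d j) \<otimes>\<^bsub>S\<^esub> w1) \<oplus>\<^bsub>S\<^esub> dec (Suc k) ?e"
        unfolding e using cl by (simp add: S.r_distr S.a_ac del: lincomb.simps)
      finally have "dec (Suc j) d = (w' \<oplus>\<^bsub>S\<^esub> h (d j) \<otimes>\<^bsub>S\<^esub> w1) \<oplus>\<^bsub>S\<^esub> dec (Suc k) ?e" .
      moreover have "w' \<oplus>\<^bsub>S\<^esub> h (d j) \<otimes>\<^bsub>S\<^esub> w1 \<in> W" by (rule WD(3)[OF we(1) WD(5)[OF wc(1) cl(5)]])
      ultimately show ?case using eM by (intro bexI[of _ "w' \<oplus>\<^bsub>S\<^esub> h (d j) \<otimes>\<^bsub>S\<^esub> w1"] exI[of _ ?e] conjI allI impI)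
    qed
    from this[of n] obtain w' e where we: "w' \<in> W" "\<forall>i<Suc k. e i \<in> M" "dec n d = w' \<oplus>\<^bsub>S\<^esub> dec (Suc k) e" by auto
    have ec: "\<And>i. i < Suc k \<Longrightarrow> e i \<in> carrier R" using we(2) MD(7) by simp
    \<comment> \<open>Collecting the multiples of \<open>g k\<close> leaves the factor
      \<open>1 - e k\<close>, a unit since \<open>e k\<close> lies in \<open>M\<close>. Dividing by
      it expresses \<open>g k\<close> through \<open>W\<close> and the first \<open>k\<close>
      generators.\<close>
    define v where "v = inv (\<one> \<ominus> e k)"
    have ek: "e k \<in> M" "e k \<in> carrier R" using we(2) MD(7) by simp_all
    have "\<one> \<ominus> e k \<notin> M"
    proof
      assume "\<one> \<ominus> e k \<in> M"
      then have "(\<one> \<ominus> e k) \<oplus> e k \<in> M" using ek(1) by (rule MD(3))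
      moreover have "(\<one> \<ominus> e k) \<oplus> e k = \<one>" using ek(2) R.one_closed by algebra
      ultimately show False using R.primeideal_compl(1)[OF M_prime] by simp
    qed
    then have u: "\<one> \<ominus> e k \<in> Units R" using M_units ek(2) by simp
    have vc: "v \<in> carrier R" unfolding v_def using u by (rule R.Units_inv_closed)
    have "v \<otimes> (\<one> \<ominus> e k) = \<one>" unfolding v_def using u by (rule R.Units_l_inv)
    then have hv: "h v \<otimes>\<^bsub>S\<^esub> (\<one>\<^bsub>S\<^esub> \<ominus>\<^bsub>S\<^esub> h (e k)) = \<one>\<^bsub>S\<^esub>"
      using vc ek(2) hom_mult[of v "\<one> \<ominus> e k"] by (simp add: a_minus_def)
    let ?w = "w \<oplus>\<^bsub>S\<^esub> w'" and ?d = "dec k e"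
    have cl1: "?d \<in> carrier S" by (rule dec_closed[OF kn(1)]) (simp add: ec)
    note cl = cl1 WD(7)[OF wy(1)] WD(7)[OF we(1)] hom_closed[OF ek(2)] hom_closed[OF vc]
    have gk2: "g k = ?w \<oplus>\<^bsub>S\<^esub> ?d \<oplus>\<^bsub>S\<^esub> h (e k) \<otimes>\<^bsub>S\<^esub> g k"
    proof -
      have "g k = w \<oplus>\<^bsub>S\<^esub> (w' \<oplus>\<^bsub>S\<^esub> (?d \<oplus>\<^bsub>S\<^esub> h (e k) \<otimes>\<^bsub>S\<^esub> g k))"
        using wy(3) unfolding d(2) we(3) lincomb.simps(2)[of S h g k] .
      then show ?thesis using cl gk by (simp add: S.a_assoc)
    qed
    have S_id: "x \<ominus>\<^bsub>S\<^esub> z = y" if "x = y \<oplus>\<^bsub>S\<^esub> z" "y \<in> carrier S" "z \<in> carrier S" for x y z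
      unfolding that(1) using that(2,3) by (simp add: a_minus_def S.a_assoc S.r_neg)
    have "h v \<otimes>\<^bsub>S\<^esub> (?w \<oplus>\<^bsub>S\<^esub> ?d) = h v \<otimes>\<^bsub>S\<^esub> (g k \<ominus>\<^bsub>S\<^esub> h (e k) \<otimes>\<^bsub>S\<^esub> g k)"
      using S_id[OF gk2] cl gk by simp
    also have "g k \<ominus>\<^bsub>S\<^esub> h (e k) \<otimes>\<^bsub>S\<^esub> g k = (\<one>\<^bsub>S\<^esub> \<ominus>\<^bsub>S\<^esub> h (e k)) \<otimes>\<^bsub>S\<^esub> g k"
      using cl gk by (simp add: a_minus_def S.l_distr S.l_minus)
    also have "h v \<otimes>\<^bsub>S\<^esub> \<dots> = g k"
      using hv cl gk by (simp add: S.m_assoc[symmetric])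
    finally have gk3: "g k = h v \<otimes>\<^bsub>S\<^esub> ?w \<oplus>\<^bsub>S\<^esub> h v \<otimes>\<^bsub>S\<^esub> ?d" using cl by (simp add: S.r_distr)
    show "P k"
      unfolding P_def
    proof
      fix x assume "x \<in> carrier S"
      from PD[OF P this] obtain w2 c where wc: "w2 \<in> W" "\<forall>i<Suc k. c i \<in> carrier R" "x = w2 \<oplus>\<^bsub>S\<^esub> dec (Suc k) c"
        by (elim bexE exE conjE) (rule that)
      let ?w2 = "w2 \<oplus>\<^bsub>S\<^esub> h (c k) \<otimes>\<^bsub>S\<^esub> (h v \<otimes>\<^bsub>S\<^esub> ?w)" and ?c = "\<lambda>i. c i \<oplus> (c k \<otimes> v) \<otimes> e i"
      have cc: "c k \<in> carrier R" "w2 \<in> carrier S" "dec k c \<in> carrier S"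
        using wc WD(7) dec_closed[OF kn(1), of c] by simp_all
      have "dec k ?c = dec k c \<oplus>\<^bsub>S\<^esub> dec k (\<lambda>i. (c k \<otimes> v) \<otimes> e i)"
        by (rule dec_add[OF kn(1)]) (use wc(2) ec vc cc(1) in simp_all)
      also have "dec k (\<lambda>i. (c k \<otimes> v) \<otimes> e i) = h (c k \<otimes> v) \<otimes>\<^bsub>S\<^esub> ?d"
        by (rule dec_smult[OF kn(1)]) (use ec vc cc(1) in simp_all)
      finally have c': "dec k ?c = dec k c \<oplus>\<^bsub>S\<^esub> h (c k) \<otimes>\<^bsub>S\<^esub> (h v \<otimes>\<^bsub>S\<^esub> ?d)"
        using cc(1) vc cl by (simp add: S.m_assoc)
      have "x = w2 \<oplus>\<^bsub>S\<^esub> (dec k c \<oplus>\<^bsub>S\<^esub> h (c k) \<otimes>\<^bsub>S\<^esub> (h v \<otimes>\<^bsub>S\<^esub> ?w \<oplus>\<^bsub>S\<^esub> h v \<otimes>\<^bsub>S\<^esub> ?d))"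
        unfolding wc(3) lincomb.simps(2)[of S h g k] gk3[symmetric] ..
      also have "\<dots> = ?w2 \<oplus>\<^bsub>S\<^esub> dec k ?c"
        unfolding c' using cc cl by (simp add: S.r_distr S.a_ac)
      finally have "x = ?w2 \<oplus>\<^bsub>S\<^esub> dec k ?c" .
      moreover have "?w2 \<in> W"
        by (intro WD(3)[OF wc(1)] WD(5) WD(3)[OF wy(1) we(1)]) (use cl cc(1) in simp_all)
      moreover have "\<forall>i<k. ?c i \<in> carrier R" using wc(2) ec vc cc(1) by simp
      ultimately show "\<exists>w\<in>W. \<exists>c. (\<forall>i<k. c i \<in> carrier R) \<and> x = w \<oplus>\<^bsub>S\<^esub> dec k c"
        by (intro bexI[of _ ?w2] exI[of _ ?c] conjI)
    qed
  qed simp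
  then have "carrier S \<subseteq> W"
  proof (intro subsetI)
    fix x assume "P 0" "x \<in> carrier S"
    then obtain w where "w \<in> W" "x = w \<oplus>\<^bsub>S\<^esub> \<zero>\<^bsub>S\<^esub>" using PD[of 0 x] by auto
    then show "x \<in> W" using WD(7) by simp
  qed
  then show ?thesis using WD(1) by auto
qed

text \<open>Submodules over \<open>R\<close> instead of ideals of \<open>S\<close>: the induction on
  the chain condition intersects with the span of some of the generators, which need not be an
  ideal.\<close>

definition submodule_above :: "'b set \<Rightarrow> bool"
  where "submodule_above V \<longleftrightarrow> V \<subseteq> carrier S \<and> ext M \<subseteq> V \<and> (\<forall>x\<in>V. \<forall>y\<in>V. x \<oplus>\<^bsub>S\<^esub> y \<in> V) \<and>
    (\<forall>a\<in>carrier R. \<forall>x\<in>V. h a \<otimes>\<^bsub>S\<^esub> x \<in> V)"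

lemma submodule_aboveD:
  assumes "submodule_above V"
  shows "\<And>x. x \<in> V \<Longrightarrow> x \<in> carrier S" "\<And>x. x \<in> ext M \<Longrightarrow> x \<in> V" "\<And>x y. x \<in> V \<Longrightarrow> y \<in> V \<Longrightarrow> x \<oplus>\<^bsub>S\<^esub> y \<in> V"
    "\<And>a x. a \<in> carrier R \<Longrightarrow> x \<in> V \<Longrightarrow> h a \<otimes>\<^bsub>S\<^esub> x \<in> V" "\<And>x y. x \<in> V \<Longrightarrow> y \<in> V \<Longrightarrow> x \<ominus>\<^bsub>S\<^esub> y \<in> V"
proof -
  show 1: "\<And>x. x \<in> V \<Longrightarrow> x \<in> carrier S" "\<And>x. x \<in> ext M \<Longrightarrow> x \<in> V" and 2: "\<And>x y. x \<in> V \<Longrightarrow> y \<in> V \<Longrightarrow> x \<oplus>\<^bsub>S\<^esub> y \<in> V"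
    and 3: "\<And>a x. a \<in> carrier R \<Longrightarrow> x \<in> V \<Longrightarrow> h a \<otimes>\<^bsub>S\<^esub> x \<in> V"
    using assms unfolding submodule_above_def by (simp_all add: subset_iff)
  show "x \<ominus>\<^bsub>S\<^esub> y \<in> V" if "x \<in> V" "y \<in> V" for x y
  proof -
    have "h (\<ominus> \<one>) \<otimes>\<^bsub>S\<^esub> y = \<ominus>\<^bsub>S\<^esub> y" using 1(1)[OF that(2)] by (simp add: S.l_minus)
    then show ?thesis using 2[OF that(1) 3[of "\<ominus> \<one>", OF _ that(2)]] by (simp add: a_minus_def)
  qed
qed

text \<open>Holds because the quotient of \<open>S\<close> by \<open>ext M\<close> is a finite-dimensional vector space over \<open>R/M\<close>.\<close>

lemma descending_submodules_stable:
  assumes V: "\<And>i. submodule_above (V i)" "\<And>i. V (Suc i) \<subseteq> V i"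
  shows "\<exists>i0. \<forall>i\<ge>(i0::nat). V i = V i0"
proof -
  \<comment> \<open>A flag from \<open>ext M\<close> to \<open>S\<close>; each step adds the line of
    one generator over the residue field.\<close>
  define U where "U k = {x. \<exists>c y. (\<forall>i<k. c i \<in> carrier R) \<and> y \<in> ext M \<and> x = dec k c \<oplus>\<^bsub>S\<^esub> y}" for k
  note MD = R.ideal_memD[OF M_ideal] and ED = S.ideal_memD[OF ext_ideal[OF M_ideal]]
  have UE: "\<exists>c y. (\<forall>i<k. c i \<in> carrier R) \<and> y \<in> ext M \<and> x = dec k c \<oplus>\<^bsub>S\<^esub> y" if "x \<in> U k" for x k
    using that unfolding U_def by simp
  have UI: "dec k c \<oplus>\<^bsub>S\<^esub> y \<in> U k" if "\<forall>i<k. c i \<in> carrier R" "y \<in> ext M" for k c y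
    using that unfolding U_def by auto
  have Usub: "submodule_above (U k)" if k: "k \<le> n" for k
    unfolding submodule_above_def
  proof (intro conjI ballI subsetI)
    fix x assume "x \<in> U k"
    from UE[OF this] obtain c y where x: "\<forall>i<k. c i \<in> carrier R" "y \<in> ext M" "x = dec k c \<oplus>\<^bsub>S\<^esub> y" by (elim exE conjE) (rule that)
    have cl: "dec k c \<in> carrier S" "y \<in> carrier S" using dec_closed[OF k, of c] x ED(7) by simp_all
    show "x \<in> carrier S" unfolding x(3) using cl by simp
    show "h a \<otimes>\<^bsub>S\<^esub> x \<in> U k" if a: "a \<in> carrier R" for a
    proof -
      have "h a \<otimes>\<^bsub>S\<^esub> x = dec k (\<lambda>i. a \<otimes> c i) \<oplus>\<^bsub>S\<^esub> h a \<otimes>\<^bsub>S\<^esub> y"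
        unfolding x(3) using dec_smult[OF k, of c a] x(1) a cl by (simp add: S.r_distr)
      also have "\<dots> \<in> U k" by (rule UI) (use x a ED(5) in simp_all)
      finally show ?thesis .
    qed
    fix x' assume "x' \<in> U k"
    from UE[OF this] obtain c' y' where x': "\<forall>i<k. c' i \<in> carrier R" "y' \<in> ext M" "x' = dec k c' \<oplus>\<^bsub>S\<^esub> y'" by (elim exE conjE) (rule that)
    have cl': "dec k c' \<in> carrier S" "y' \<in> carrier S" using dec_closed[OF k, of c'] x' ED(7) by simp_all
    have "x \<oplus>\<^bsub>S\<^esub> x' = dec k (\<lambda>i. c i \<oplus> c' i) \<oplus>\<^bsub>S\<^esub> (y \<oplus>\<^bsub>S\<^esub> y')"
      unfolding x(3) x'(3) using dec_add[OF k, of c c'] x(1) x'(1) cl cl' by (simp add: S.a_ac)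
    also have "\<dots> \<in> U k" by (rule UI) (use x x' ED(3) in simp_all)
    finally show "x \<oplus>\<^bsub>S\<^esub> x' \<in> U k" .
  next
    fix y assume y: "y \<in> ext M"
    have "dec k (\<lambda>_. \<zero>) = h \<zero> \<otimes>\<^bsub>S\<^esub> dec k (\<lambda>_. \<zero>)"
      using dec_smult[OF k, of "\<lambda>_. \<zero>" \<zero>] by simp
    then have "dec k (\<lambda>_. \<zero>) = \<zero>\<^bsub>S\<^esub>" using dec_closed[OF k, of "\<lambda>_. \<zero>"] by simp
    then show "y \<in> U k" using UI[of k "\<lambda>_. \<zero>" y] y ED(7) by simp
  qed
  have stable: "\<exists>i0. \<forall>i\<ge>(i0::nat). V i = V i0"
    if "k \<le> n" "\<forall>i. submodule_above (V i)" "\<forall>i. V (Suc i) \<subseteq> V i" "\<forall>i. V i \<subseteq> U k" for V k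
    using that
  proof (induction k arbitrary: V)
    case 0
    have "V i = ext M" for i
    proof
      show "V i \<subseteq> ext M"
      proof
        fix x assume "x \<in> V i"
        then have "x \<in> U 0" using "0.prems"(4) by auto
        then show "x \<in> ext M" using UE[of x 0] ED(7) by auto
      qed
      show "ext M \<subseteq> V i" using "0.prems"(2) unfolding submodule_above_def by simp
    qed
    then show ?case by simp
  next
    case (Suc k)
    have kn: "k \<le> n" "k < n" using Suc.prems(1) by simp_all
    note VD = submodule_aboveD[OF Suc.prems(2)[rule_format]] and UD = submodule_aboveD[OF Usub[OF kn(1)]]
    have gk: "g k \<in> carrier S" using g kn by simp
    have le: "V j \<subseteq> V i" if "i \<le> j" for i j
      using that
    proof (induction rule: dec_induct)
      case (step m)
      then show ?case using Suc.prems(3)[rule_format, of m] by (rule_tac subset_trans)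
    qed simp
    have split: "\<exists>a\<in>carrier R. \<exists>u\<in>U k. x = u \<oplus>\<^bsub>S\<^esub> h a \<otimes>\<^bsub>S\<^esub> g k" if x: "x \<in> V i" for x i
    proof -
      have "x \<in> U (Suc k)" using x Suc.prems(4) by auto
      from UE[OF this] obtain c y where cy: "\<forall>i<Suc k. c i \<in> carrier R" "y \<in> ext M" "x = dec (Suc k) c \<oplus>\<^bsub>S\<^esub> y" by (elim exE conjE) (rule that)
      have cl: "dec k c \<in> carrier S" "y \<in> carrier S" "c k \<in> carrier R" using dec_closed[OF kn(1), of c] cy ED(7) by simp_all
      have "x = (dec k c \<oplus>\<^bsub>S\<^esub> y) \<oplus>\<^bsub>S\<^esub> h (c k) \<otimes>\<^bsub>S\<^esub> g k"
        unfolding cy(3) lincomb.simps(2) using cl gk by (simp add: S.a_ac)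
      moreover have "dec k c \<oplus>\<^bsub>S\<^esub> y \<in> U k" by (rule UI) (use cy in simp_all)
      ultimately show ?thesis using cl(3) by (intro bexI[of _ "c k"] bexI[of _ "dec k c \<oplus>\<^bsub>S\<^esub> y"])
    qed
    show ?case
    \<comment> \<open>Modulo \<open>U k\<close> only the coefficient of \<open>g k\<close> matters.
      Either every \<open>V i\<close> has an element with coefficient 1, and then the traces on
      \<open>U k\<close> determine the sequence, or the sequence eventually lies in
      \<open>U k\<close>.\<close>
    proof (cases "\<forall>i. \<exists>v\<in>V i. v \<ominus>\<^bsub>S\<^esub> g k \<in> U k")
      case True
      have "\<exists>i0. \<forall>i\<ge>(i0::nat). V i \<inter> U k = V i0 \<inter> U k"
      proof (rule Suc.IH[OF kn(1)]; intro allI)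
        fix i
        show "submodule_above (V i \<inter> U k)"
          using Suc.prems(2)[rule_format, of i] Usub[OF kn(1)] unfolding submodule_above_def by auto
        show "V (Suc i) \<inter> U k \<subseteq> V i \<inter> U k" using Suc.prems(3)[rule_format, of i] by auto
        show "V i \<inter> U k \<subseteq> U k" by simp
      qed
      then obtain i0 where i0: "\<And>i. i \<ge> i0 \<Longrightarrow> V i \<inter> U k = V i0 \<inter> U k" by auto
      have "V i = V i0" if i: "i \<ge> i0" for i
      proof
        show "V i \<subseteq> V i0" by (rule le[OF i])
        show "V i0 \<subseteq> V i"
        proof
          fix x assume x: "x \<in> V i0"
          obtain a u where au: "a \<in> carrier R" "u \<in> U k" "x = u \<oplus>\<^bsub>S\<^esub> h a \<otimes>\<^bsub>S\<^esub> g k" using split[OF x] by auto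
          obtain v where v: "v \<in> V i" "v \<ominus>\<^bsub>S\<^esub> g k \<in> U k" using True by auto
          have v0: "v \<in> V i0" using v(1) le[OF i] by auto
          have cl: "u \<in> carrier S" "v \<in> carrier S" "h a \<in> carrier S" "x \<in> carrier S"
            using UD(1) au VD(1) v(1) x by auto
          have "x \<ominus>\<^bsub>S\<^esub> h a \<otimes>\<^bsub>S\<^esub> v = u \<ominus>\<^bsub>S\<^esub> h a \<otimes>\<^bsub>S\<^esub> (v \<ominus>\<^bsub>S\<^esub> g k)"
            unfolding au(3) using cl gk by (simp add: a_minus_def S.r_distr S.r_minus S.minus_add S.a_ac)
          also have "\<dots> \<in> U k" by (rule UD(5)[OF au(2) UD(4)[OF au(1) v(2)]])
          finally have "x \<ominus>\<^bsub>S\<^esub> h a \<otimes>\<^bsub>S\<^esub> v \<in> V i0 \<inter> U k" using VD(5)[OF x VD(4)[OF au(1) v0]] by simp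
          then have "x \<ominus>\<^bsub>S\<^esub> h a \<otimes>\<^bsub>S\<^esub> v \<in> V i" using i0[OF i] by auto
          then have "(x \<ominus>\<^bsub>S\<^esub> h a \<otimes>\<^bsub>S\<^esub> v) \<oplus>\<^bsub>S\<^esub> h a \<otimes>\<^bsub>S\<^esub> v \<in> V i" using VD(3)[OF _ VD(4)[OF au(1) v(1)]] by simp
          then show "x \<in> V i" using cl by (simp add: a_minus_def S.a_assoc S.l_neg)
        qed
      qed
      then show ?thesis by auto
    next
      case False
      \<comment> \<open>A unit coefficient could be scaled to 1. So from \<open>i1\<close> on all
        coefficients of \<open>g k\<close> lie in \<open>M\<close>, and the corresponding terms
        belong to \<open>ext M\<close>.\<close>
      then obtain i1 where i1: "\<forall>v\<in>V i1. v \<ominus>\<^bsub>S\<^esub> g k \<notin> U k" by auto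
      have "V (i1 + i) \<subseteq> U k" for i
      proof
        fix x assume x: "x \<in> V (i1 + i)"
        then have x1: "x \<in> V i1" using le[of i1 "i1 + i"] by auto
        obtain a u where au: "a \<in> carrier R" "u \<in> U k" "x = u \<oplus>\<^bsub>S\<^esub> h a \<otimes>\<^bsub>S\<^esub> g k" using split[OF x] by auto
        have uc: "u \<in> carrier S" using UD(1) au by simp
        have "a \<in> M"
        proof (rule ccontr)
          assume "a \<notin> M"
          then have un: "a \<in> Units R" using M_units au(1) by simp
          have ic: "inv a \<in> carrier R" using un by (rule R.Units_inv_closed)
          have "h (inv a) \<otimes>\<^bsub>S\<^esub> h a = \<one>\<^bsub>S\<^esub>"
            using hom_mult[OF ic au(1)] R.Units_l_inv[OF un] by simp
          then have hh: "h (inv a) \<otimes>\<^bsub>S\<^esub> (h a \<otimes>\<^bsub>S\<^esub> g k) = g k"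
            using ic au(1) gk by (simp add: S.m_assoc[symmetric])
          have "h (inv a) \<otimes>\<^bsub>S\<^esub> x \<ominus>\<^bsub>S\<^esub> g k = h (inv a) \<otimes>\<^bsub>S\<^esub> u"
            unfolding au(3) using hh ic au(1) uc gk by (simp add: S.r_distr a_minus_def S.a_assoc S.r_neg)
          also have "\<dots> \<in> U k" by (rule UD(4)[OF ic au(2)])
          finally show False using i1 VD(4)[OF ic x1] by auto
        qed
        then have "h a \<otimes>\<^bsub>S\<^esub> g k \<in> U k" using UD(2) ext_smult[OF M_ideal _ gk] by simp
        then show "x \<in> U k" unfolding au(3) using UD(3)[OF au(2)] by simp
      qed
      then have "\<exists>i0. \<forall>i\<ge>(i0::nat). V (i1 + i) = V (i1 + i0)"
        using Suc.prems(2,3) by (intro Suc.IH[OF kn(1), of "\<lambda>i. V (i1 + i)"]) simp_all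
      then obtain i0 where i0: "\<And>i. i \<ge> i0 \<Longrightarrow> V (i1 + i) = V (i1 + i0)" by auto
      have "V i = V (i1 + i0)" if "i \<ge> i1 + i0" for i
        using i0[of "i - i1"] that by simp
      then show ?thesis by auto
    qed
  qed
  show ?thesis
  proof (rule stable[OF order_refl, of V]; intro allI V)
    fix i
    show "V i \<subseteq> U n"
    proof
      fix x assume "x \<in> V i"
      then have x: "x \<in> carrier S" using submodule_aboveD(1)[OF V(1)] by simp
      obtain c where c: "\<forall>i<n. c i \<in> carrier R" "x = dec n c" using gen[OF x] by auto
      then show "x \<in> U n" using UI[OF c(1) ED(2)] x by simp
    qed
  qed
qed

lemma ext_radical: "radical_ideal S (ext M)"
proof (intro radical_ideal.intro radical_ideal_axioms.intro)
  show "cring S" by (rule S.cring_axioms)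
  show "ideal (ext M) S" by (rule ext_ideal[OF M_ideal])
  show "W = carrier S" if "ideal W S" "carrier S \<subseteq> W <+>\<^bsub>S\<^esub> ext M" for W
    using that by (rule ext_nakayama)
  show "\<exists>i0. \<forall>i\<ge>(i0::nat). V i = V i0"
    if V: "\<And>i. ideal (V i) S" "\<And>i. ext M \<subseteq> V i" "\<And>i. V (Suc i) \<subseteq> V i" for V
  proof (rule descending_submodules_stable)
    show "submodule_above (V i)" for i
      unfolding submodule_above_def
      using S.ideal_memD[OF V(1)[of i]] V(2)[of i] by simp
  qed (rule V(3))
qed

text \<open>Functions with values in \<open>S\<close> that admit polynomial coordinates. This
  restriction of scalars turns equations in \<open>S\<close> into statements about tuples over
  \<open>R\<close>.\<close>

definition vecfun :: "nat \<Rightarrow> ('a list \<Rightarrow> 'b) \<Rightarrow> bool"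
  where "vecfun r \<Phi> \<longleftrightarrow> (\<exists>\<psi>. (\<forall>i<n. R.polyfun r (\<psi> i)) \<and> (\<forall>t\<in>tuples R r. \<Phi> t = dec n (\<lambda>i. \<psi> i t)))"

lemma vecfunE:
  assumes "vecfun r \<Phi>"
  obtains \<psi> where "\<And>i. i < n \<Longrightarrow> R.polyfun r (\<psi> i)" "\<And>t. t \<in> tuples R r \<Longrightarrow> \<Phi> t = dec n (\<lambda>i. \<psi> i t)"
  using assms unfolding vecfun_def by auto

lemma vecfunI:
  "(\<And>i. i < n \<Longrightarrow> R.polyfun r (\<psi> i)) \<Longrightarrow> (\<And>t. t \<in> tuples R r \<Longrightarrow> \<Phi> t = dec n (\<lambda>i. \<psi> i t)) \<Longrightarrow> vecfun r \<Phi>"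
  unfolding vecfun_def by auto

lemma vecfun_cong: "vecfun r \<Phi> \<Longrightarrow> (\<And>t. t \<in> tuples R r \<Longrightarrow> \<Psi> t = \<Phi> t) \<Longrightarrow> vecfun r \<Psi>"
  by (erule vecfunE) (rule vecfunI, auto)

lemma vecfun_closed:
  assumes "vecfun r \<Phi>" "t \<in> tuples R r"
  shows "\<Phi> t \<in> carrier S"
proof -
  obtain \<psi> where \<psi>: "\<And>i. i < n \<Longrightarrow> R.polyfun r (\<psi> i)" "\<And>t. t \<in> tuples R r \<Longrightarrow> \<Phi> t = dec n (\<lambda>i. \<psi> i t)"
    using assms(1) by (rule vecfunE) auto
  show ?thesis
    unfolding \<psi>(2)[OF assms(2)] by (rule dec_closed) (use R.polyfun_closed[OF \<psi>(1) assms(2)] in simp_all)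
qed

lemma vecfun_const:
  assumes "b \<in> carrier S"
  shows "vecfun r (\<lambda>_. b)"
proof -
  obtain c where c: "\<forall>i<n. c i \<in> carrier R" "b = dec n c" using gen[OF assms] by auto
  show ?thesis by (rule vecfunI[of _ "\<lambda>i _. c i"]) (use c in \<open>simp_all add: R.polyfun_const\<close>)
qed

lemma vecfun_coord: "j + n \<le> r \<Longrightarrow> vecfun r (\<lambda>t. dec n (\<lambda>i. t ! (j + i)))"
  by (rule vecfunI[of _ "\<lambda>i t. t ! (j + i)"]) (auto intro: R.polyfun_nth)

lemma vecfun_add:
  assumes "vecfun r \<Phi>" "vecfun r \<Psi>"
  shows "vecfun r (\<lambda>t. \<Phi> t \<oplus>\<^bsub>S\<^esub> \<Psi> t)"
proof -
  obtain \<phi> where \<phi>: "\<And>i. i < n \<Longrightarrow> R.polyfun r (\<phi> i)" "\<And>t. t \<in> tuples R r \<Longrightarrow> \<Phi> t = dec n (\<lambda>i. \<phi> i t)"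
    using assms(1) by (rule vecfunE) auto
  obtain \<psi> where \<psi>: "\<And>i. i < n \<Longrightarrow> R.polyfun r (\<psi> i)" "\<And>t. t \<in> tuples R r \<Longrightarrow> \<Psi> t = dec n (\<lambda>i. \<psi> i t)"
    using assms(2) by (rule vecfunE) auto
  show ?thesis
  proof (rule vecfunI[of _ "\<lambda>i t. \<phi> i t \<oplus> \<psi> i t"])
    show "R.polyfun r (\<lambda>t. \<phi> i t \<oplus> \<psi> i t)" if "i < n" for i using \<phi>(1) \<psi>(1) that by (intro R.polyfun_add) simp_all
    show "\<Phi> t \<oplus>\<^bsub>S\<^esub> \<Psi> t = dec n (\<lambda>i. \<phi> i t \<oplus> \<psi> i t)" if t: "t \<in> tuples R r" for t
      unfolding \<phi>(2)[OF t] \<psi>(2)[OF t]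
      by (rule dec_add[symmetric]) (use R.polyfun_closed[OF \<phi>(1) t] R.polyfun_closed[OF \<psi>(1) t] in simp_all)
  qed
qed

lemma vecfun_smult:
  assumes "R.polyfun r \<alpha>" "vecfun r \<Phi>"
  shows "vecfun r (\<lambda>t. h (\<alpha> t) \<otimes>\<^bsub>S\<^esub> \<Phi> t)"
proof -
  obtain \<phi> where \<phi>: "\<And>i. i < n \<Longrightarrow> R.polyfun r (\<phi> i)" "\<And>t. t \<in> tuples R r \<Longrightarrow> \<Phi> t = dec n (\<lambda>i. \<phi> i t)"
    using assms(2) by (rule vecfunE) auto
  show ?thesis
  proof (rule vecfunI[of _ "\<lambda>i t. \<alpha> t \<otimes> \<phi> i t"])
    show "R.polyfun r (\<lambda>t. \<alpha> t \<otimes> \<phi> i t)" if "i < n" for i using \<phi>(1) assms(1) that by (intro R.polyfun_mult) simp_all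
    show "h (\<alpha> t) \<otimes>\<^bsub>S\<^esub> \<Phi> t = dec n (\<lambda>i. \<alpha> t \<otimes> \<phi> i t)" if t: "t \<in> tuples R r" for t
      unfolding \<phi>(2)[OF t]
      by (rule dec_smult[symmetric]) (use R.polyfun_closed[OF \<phi>(1) t] R.polyfun_closed[OF assms(1) t] in simp_all)
  qed
qed

lemma vecfun_minus:
  assumes "vecfun r \<Phi>" "vecfun r \<Psi>"
  shows "vecfun r (\<lambda>t. \<Phi> t \<ominus>\<^bsub>S\<^esub> \<Psi> t)"
  by (rule vecfun_cong[OF vecfun_add[OF assms(1) vecfun_smult[OF R.polyfun_const[of "\<ominus> \<one>"] assms(2)]]])
    (use vecfun_closed[OF assms(2)] in \<open>simp_all add: a_minus_def S.l_minus\<close>)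

lemma vecfun_lincomb:
  assumes "\<And>i. i < k \<Longrightarrow> R.polyfun r (\<alpha> i)" "\<And>i. i < k \<Longrightarrow> vecfun r (Z i)"
  shows "vecfun r (\<lambda>t. lincomb S h (\<lambda>i. Z i t) k (\<lambda>i. \<alpha> i t))"
  using assms
proof (induction k)
  case 0
  show ?case using vecfun_const[of "\<zero>\<^bsub>S\<^esub>" r] by simp
next
  case (Suc k)
  have "vecfun r (\<lambda>t. lincomb S h (\<lambda>i. Z i t) k (\<lambda>i. \<alpha> i t))" by (rule Suc.IH) (simp_all add: Suc.prems)
  moreover have "vecfun r (\<lambda>t. h (\<alpha> k t) \<otimes>\<^bsub>S\<^esub> Z k t)" by (rule vecfun_smult) (simp_all add: Suc.prems)
  ultimately show ?case unfolding lincomb.simps by (rule vecfun_add)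
qed

text \<open>Expanding the second factor reduces the claim to products of the first with a generator.
  These are handled by the same expansion with the roles exchanged, where products of two generators
  are constants.\<close>

lemma vecfun_mult:
  assumes "vecfun r \<Phi>" "vecfun r \<Psi>"
  shows "vecfun r (\<lambda>t. \<Phi> t \<otimes>\<^bsub>S\<^esub> \<Psi> t)"
proof -
  have mult: "vecfun r (\<lambda>t. \<Phi> t \<otimes>\<^bsub>S\<^esub> \<Psi> t)"
    if a: "vecfun r \<Phi>" "vecfun r \<Psi>" "\<And>i. i < n \<Longrightarrow> vecfun r (\<lambda>t. \<Phi> t \<otimes>\<^bsub>S\<^esub> g i)" for \<Phi> \<Psi>
  proof -
    obtain \<psi> where \<psi>: "\<And>i. i < n \<Longrightarrow> R.polyfun r (\<psi> i)" "\<And>t. t \<in> tuples R r \<Longrightarrow> \<Psi> t = dec n (\<lambda>i. \<psi> i t)"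
      using a(2) by (rule vecfunE) auto
    show ?thesis
    proof (rule vecfun_cong[OF vecfun_lincomb[OF \<psi>(1) a(3)]])
      show "\<Phi> t \<otimes>\<^bsub>S\<^esub> \<Psi> t = lincomb S h (\<lambda>i. \<Phi> t \<otimes>\<^bsub>S\<^esub> g i) n (\<lambda>i. \<psi> i t)" if t: "t \<in> tuples R r" for t
        unfolding \<psi>(2)[OF t]
        by (rule lincomb_mult) (use R.polyfun_closed[OF \<psi>(1) t] g vecfun_closed[OF a(1) t] in simp_all)
    qed simp_all
  qed
  have "vecfun r (\<lambda>t. \<Phi> t \<otimes>\<^bsub>S\<^esub> g i)" if i: "i < n" for i
  proof -
    have "vecfun r (\<lambda>t. g i \<otimes>\<^bsub>S\<^esub> \<Phi> t)"
      by (rule mult) (use i g assms(1) in \<open>auto intro!: vecfun_const\<close>)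
    then show ?thesis
      by (rule vecfun_cong) (use g[OF i] vecfun_closed[OF assms(1)] in \<open>simp add: S.m_comm\<close>)
  qed
  then show ?thesis by (rule mult[OF assms])
qed

text \<open>The coordinate vectors of elements of \<open>ext I\<close> form a submodule of
  \<open>R^n\<close> that also contains the relations between the generators. This is why
  \<open>pe_submod\<close> treats submodules and not only ideals.\<close>

lemma pe_mem_ext:
  assumes I: "ideal I R" and \<Phi>: "vecfun r \<Phi>"
  shows "R.pe r (\<lambda>t. \<Phi> t \<in> ext I)"
proof -
  note ED = S.ideal_memD[OF ext_ideal[OF I]]
  let ?N = "{c \<in> tuples R n. dec n ((!) c) \<in> ext I}"
  have "R.submod n ?N"
    unfolding R.submod_def
  proof (intro conjI ballI)
    have "dec n ((!) (replicate n \<zero>)) = dec n (\<lambda>_. \<zero>)" by (rule lincomb_cong) simp_all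
    also have "\<dots> \<in> ext I" using R.ideal_memD(2)[OF I] by (intro extI) simp
    finally show "replicate n \<zero> \<in> ?N" by (auto simp: tuples_def)
    fix u v a assume uv: "u \<in> ?N" "v \<in> ?N" "a \<in> carrier R"
    have c: "u ! i \<in> carrier R" "v ! i \<in> carrier R" if "i < n" for i
      using uv(1,2) that by (auto intro: nth_tuples)
    let ?w = "map (\<lambda>j. u ! j \<oplus> a \<otimes> v ! j) [0..<n]"
    have "dec n ((!) ?w) = dec n (\<lambda>j. u ! j \<oplus> a \<otimes> v ! j)" by (rule lincomb_cong) simp_all
    also have "\<dots> = dec n ((!) u) \<oplus>\<^bsub>S\<^esub> dec n (\<lambda>j. a \<otimes> v ! j)" by (rule dec_add) (use c uv(3) in simp_all)
    also have "dec n (\<lambda>j. a \<otimes> v ! j) = h a \<otimes>\<^bsub>S\<^esub> dec n ((!) v)" by (rule dec_smult) (use c uv(3) in simp_all)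
    also have "dec n ((!) u) \<oplus>\<^bsub>S\<^esub> h a \<otimes>\<^bsub>S\<^esub> dec n ((!) v) \<in> ext I"
      by (rule ED(3)[OF _ ED(5)]) (use uv in simp_all)
    finally show "?w \<in> ?N" using c uv(3) by (auto simp: tuples_def)
  qed simp
  then have pe: "R.pe n (\<lambda>c. c \<in> ?N)" by (rule R.pe_submod)
  obtain \<psi> where \<psi>: "\<And>i. i < n \<Longrightarrow> R.polyfun r (\<psi> i)" "\<And>t. t \<in> tuples R r \<Longrightarrow> \<Phi> t = dec n (\<lambda>i. \<psi> i t)"
    using \<Phi> by (rule vecfunE) auto
  have "R.pe r (\<lambda>t. map (\<lambda>\<psi>. \<psi> t) (map \<psi> [0..<n]) \<in> ?N)"
    by (rule R.pe_subst[OF pe]) (auto simp: \<psi>(1))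
  then show ?thesis
  proof (rule R.pe_cong)
    fix t assume t: "t \<in> tuples R r"
    have "map (\<lambda>\<psi>. \<psi> t) (map \<psi> [0..<n]) \<in> tuples R n"
      using R.polyfun_closed[OF \<psi>(1) t] by (auto simp: tuples_def)
    moreover have "dec n ((!) (map (\<lambda>\<psi>. \<psi> t) (map \<psi> [0..<n]))) = \<Phi> t"
      unfolding \<psi>(2)[OF t] by (rule lincomb_cong) simp_all
    ultimately show "\<Phi> t \<in> ext I \<longleftrightarrow> map (\<lambda>\<psi>. \<psi> t) (map \<psi> [0..<n]) \<in> ?N" by simp
  qed
qed

text \<open>Since \<open>t\<close> is a variable of the formula, the extension of
  \<open>Q + (t)\<close> has to be described through the fixed ideal \<open>ext Q\<close> and a
  quantified element \<open>z\<close> of \<open>S\<close>.\<close>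

lemma mem_ext_sum_iff:
  assumes Q: "ideal Q R" and t: "t \<in> carrier R" and x: "x \<in> carrier S"
  shows "x \<in> ext (Q <+>\<^bsub>R\<^esub> PIdl t) \<longleftrightarrow> (\<exists>z\<in>carrier S. x \<ominus>\<^bsub>S\<^esub> h t \<otimes>\<^bsub>S\<^esub> z \<in> ext Q)"
proof
  assume "x \<in> ext (Q <+>\<^bsub>R\<^esub> PIdl t)"
  then obtain c where c: "\<And>i. i < n \<Longrightarrow> c i \<in> Q <+>\<^bsub>R\<^esub> PIdl t" "x = dec n c" by (rule extE) (rule that, simp_all)
  have "\<exists>p. i < n \<longrightarrow> fst p \<in> Q \<and> snd p \<in> carrier R \<and> c i = fst p \<oplus> snd p \<otimes> t" for i
  proof (cases "i < n")
    case True
    then obtain q s where "q \<in> Q" "s \<in> carrier R" "c i = q \<oplus> s \<otimes> t"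
      using c(1)[OF True] unfolding R.ideal_sum_PIdl_iff by (elim bexE)
    then show ?thesis by (intro exI[of _ "(q, s)"]) simp
  qed simp
  then have "\<exists>p. \<forall>i. i < n \<longrightarrow> fst (p i) \<in> Q \<and> snd (p i) \<in> carrier R \<and> c i = fst (p i) \<oplus> snd (p i) \<otimes> t"
    by (rule choice[OF allI])
  then obtain p where p: "\<And>i. i < n \<Longrightarrow> fst (p i) \<in> Q" "\<And>i. i < n \<Longrightarrow> snd (p i) \<in> carrier R"
    "\<And>i. i < n \<Longrightarrow> c i = fst (p i) \<oplus> snd (p i) \<otimes> t" by auto
  let ?q = "\<lambda>i. fst (p i)" and ?s = "\<lambda>i. snd (p i)"
  have qc: "?q i \<in> carrier R" if "i < n" for i using p(1)[OF that] R.ideal_memD(7)[OF Q] by simp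
  have "x = dec n (\<lambda>i. ?q i \<oplus> t \<otimes> ?s i)"
    unfolding c(2) by (rule lincomb_cong) (use p(2,3) t in \<open>simp_all add: R.m_comm\<close>)
  also have "\<dots> = dec n ?q \<oplus>\<^bsub>S\<^esub> dec n (\<lambda>i. t \<otimes> ?s i)" by (rule dec_add) (use qc p(2) t in simp_all)
  also have "dec n (\<lambda>i. t \<otimes> ?s i) = h t \<otimes>\<^bsub>S\<^esub> dec n ?s" by (rule dec_smult) (use p(2) t in simp_all)
  finally have e: "x = dec n ?q \<oplus>\<^bsub>S\<^esub> h t \<otimes>\<^bsub>S\<^esub> dec n ?s" .
  have cl: "dec n ?q \<in> carrier S" "dec n ?s \<in> carrier S" using dec_closed qc p(2) by simp_all
  have "x \<ominus>\<^bsub>S\<^esub> h t \<otimes>\<^bsub>S\<^esub> dec n ?s = dec n ?q"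
    unfolding e using cl t by (simp add: a_minus_def S.a_assoc S.r_neg)
  then show "\<exists>z\<in>carrier S. x \<ominus>\<^bsub>S\<^esub> h t \<otimes>\<^bsub>S\<^esub> z \<in> ext Q"
    using cl(2) extI[of ?q Q, OF p(1)] by (intro bexI[of _ "dec n ?s"]) simp_all
next
  assume "\<exists>z\<in>carrier S. x \<ominus>\<^bsub>S\<^esub> h t \<otimes>\<^bsub>S\<^esub> z \<in> ext Q"
  then obtain z where z: "z \<in> carrier S" "x \<ominus>\<^bsub>S\<^esub> h t \<otimes>\<^bsub>S\<^esub> z \<in> ext Q" by auto
  have I: "ideal (Q <+>\<^bsub>R\<^esub> PIdl t) R" by (rule R.add_ideals[OF Q R.cgenideal_ideal[OF t]])
  have up: "a \<in> Q <+>\<^bsub>R\<^esub> PIdl t" if "a \<in> Q" for a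
    using R.ideal_sum_upper(1)[OF Q R.cgenideal_ideal[OF t]] that by auto
  have tm: "t \<in> Q <+>\<^bsub>R\<^esub> PIdl t"
    using R.ideal_sum_upper(2)[OF Q R.cgenideal_ideal[OF t]] R.cgenideal_self[OF t] by auto
  have "x \<ominus>\<^bsub>S\<^esub> h t \<otimes>\<^bsub>S\<^esub> z \<in> ext (Q <+>\<^bsub>R\<^esub> PIdl t)"
    using z(2) by (rule extE) (simp add: extI up)
  then have "(x \<ominus>\<^bsub>S\<^esub> h t \<otimes>\<^bsub>S\<^esub> z) \<oplus>\<^bsub>S\<^esub> h t \<otimes>\<^bsub>S\<^esub> z \<in> ext (Q <+>\<^bsub>R\<^esub> PIdl t)"
    by (rule ext_add[OF I _ ext_smult[OF I tm z(1)]])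
  then show "x \<in> ext (Q <+>\<^bsub>R\<^esub> PIdl t)"
    using x z(1) t by (simp add: a_minus_def S.a_assoc S.l_neg)
qed

text \<open>An idempotent modulo \<open>ext M\<close> that does not lift is the obstruction that
  replaces the two maximal ideals. Lifts of \<open>e0\<close> and of \<open>e1 = 1 - e0\<close> are
  each closed under products, so goodness is multiplicative. The resulting prime lies in
  \<open>M\<close> and differs from it because \<open>M\<close> is good.\<close>

lemma exists_pe_prime_of_not_product:
  assumes np: "\<not> product_of_local_rings S"
  shows "\<exists>Q M. primeideal Q R \<and> R.pe 1 (\<lambda>t. t ! 0 \<notin> Q) \<and> primeideal M R \<and> Q \<subset> M"
proof -
  interpret J: radical_ideal S "ext M" by (rule ext_radical)
  note ED = J.JD
  have "\<not> (\<forall>e0. e0 \<in> carrier S \<longrightarrow> e0 \<otimes>\<^bsub>S\<^esub> e0 \<ominus>\<^bsub>S\<^esub> e0 \<in> ext M \<longrightarrow> J.lifts e0)"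
    using J.product_of_local_rings_of_lifts np by auto
  then obtain e0 where e0: "e0 \<in> carrier S" "e0 \<otimes>\<^bsub>S\<^esub> e0 \<ominus>\<^bsub>S\<^esub> e0 \<in> ext M" "\<not> J.lifts e0" by auto
  define e1 where "e1 = \<one>\<^bsub>S\<^esub> \<ominus>\<^bsub>S\<^esub> e0"
  have e1: "e1 \<in> carrier S" unfolding e1_def using e0(1) by simp
  have e01: "e0 \<otimes>\<^bsub>S\<^esub> e1 = (\<ominus>\<^bsub>S\<^esub> \<one>\<^bsub>S\<^esub>) \<otimes>\<^bsub>S\<^esub> (e0 \<otimes>\<^bsub>S\<^esub> e0 \<ominus>\<^bsub>S\<^esub> e0)"
    unfolding e1_def using e0(1) by (simp add: a_minus_def S.r_distr S.r_minus S.l_minus S.minus_add S.minus_minus S.a_comm)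
  have "e1 \<otimes>\<^bsub>S\<^esub> e1 \<ominus>\<^bsub>S\<^esub> e1 = e0 \<otimes>\<^bsub>S\<^esub> e0 \<ominus>\<^bsub>S\<^esub> e0"
  proof -
    have "e1 \<otimes>\<^bsub>S\<^esub> e1 = (\<one>\<^bsub>S\<^esub> \<ominus>\<^bsub>S\<^esub> e0) \<otimes>\<^bsub>S\<^esub> e1" unfolding e1_def ..
    also have "\<dots> = e1 \<ominus>\<^bsub>S\<^esub> e0 \<otimes>\<^bsub>S\<^esub> e1" using e0(1) e1 by (simp add: a_minus_def S.l_distr S.l_minus)
    finally have "e1 \<otimes>\<^bsub>S\<^esub> e1 \<ominus>\<^bsub>S\<^esub> e1 = \<ominus>\<^bsub>S\<^esub> (e0 \<otimes>\<^bsub>S\<^esub> e1)"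
      using e0(1) e1 by (simp add: a_minus_def S.a_ac S.r_neg2 S.r_neg1 S.r_neg)
    then show ?thesis unfolding e01 using e0(1) by (simp add: S.l_minus S.minus_minus)
  qed
  then have e11: "e1 \<otimes>\<^bsub>S\<^esub> e1 \<ominus>\<^bsub>S\<^esub> e1 \<in> ext M" using e0(2) by simp
  define good where "good I \<longleftrightarrow> (\<exists>x\<in>carrier S. \<exists>y\<in>carrier S. x \<ominus>\<^bsub>S\<^esub> e0 \<in> ext M \<and> y \<ominus>\<^bsub>S\<^esub> e1 \<in> ext M \<and> x \<otimes>\<^bsub>S\<^esub> y \<in> ext I)" for I
  have goodI: "good I" if "x \<in> carrier S" "y \<in> carrier S" "x \<ominus>\<^bsub>S\<^esub> e0 \<in> ext M" "y \<ominus>\<^bsub>S\<^esub> e1 \<in> ext M" "x \<otimes>\<^bsub>S\<^esub> y \<in> ext I" for x y I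
    using that unfolding good_def by auto
  have prod: "x \<otimes>\<^bsub>S\<^esub> x' \<ominus>\<^bsub>S\<^esub> e \<in> ext M"
    if a: "e \<in> carrier S" "e \<otimes>\<^bsub>S\<^esub> e \<ominus>\<^bsub>S\<^esub> e \<in> ext M" "x \<in> carrier S" "x' \<in> carrier S" "x \<ominus>\<^bsub>S\<^esub> e \<in> ext M" "x' \<ominus>\<^bsub>S\<^esub> e \<in> ext M" for e x x'
  proof -
    have "x \<otimes>\<^bsub>S\<^esub> (x' \<ominus>\<^bsub>S\<^esub> e) \<oplus>\<^bsub>S\<^esub> e \<otimes>\<^bsub>S\<^esub> (x \<ominus>\<^bsub>S\<^esub> e) \<oplus>\<^bsub>S\<^esub> (e \<otimes>\<^bsub>S\<^esub> e \<ominus>\<^bsub>S\<^esub> e) \<in> ext M"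
      by (rule ED(3)[OF ED(3)[OF ED(5)[OF a(6,3)] ED(5)[OF a(5,1)]] a(2)])
    also have "x \<otimes>\<^bsub>S\<^esub> (x' \<ominus>\<^bsub>S\<^esub> e) \<oplus>\<^bsub>S\<^esub> e \<otimes>\<^bsub>S\<^esub> (x \<ominus>\<^bsub>S\<^esub> e) \<oplus>\<^bsub>S\<^esub> (e \<otimes>\<^bsub>S\<^esub> e \<ominus>\<^bsub>S\<^esub> e) = x \<otimes>\<^bsub>S\<^esub> x' \<ominus>\<^bsub>S\<^esub> e"
      by (rule S.lift_mult_identity[OF a(1,3,4)])
    finally show ?thesis .
  qed
  have self: "x \<ominus>\<^bsub>S\<^esub> x \<in> ext M" if "x \<in> carrier S" for x
    using that ED(2) by (simp add: a_minus_def S.r_neg)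
  have "\<exists>Q. primeideal Q R \<and> \<not> good Q \<and> (\<forall>t\<in>carrier R. t \<notin> Q \<longleftrightarrow> good (Q <+>\<^bsub>R\<^esub> PIdl t))"
  proof (rule exists_prime_not_good)
    fix I K L assume I: "ideal I R" "ideal K R" "ideal L R" and IK: "good I" "good K" "\<And>a b. a \<in> I \<Longrightarrow> b \<in> K \<Longrightarrow> a \<otimes> b \<in> L"
    obtain x y where x: "x \<in> carrier S" "y \<in> carrier S" "x \<ominus>\<^bsub>S\<^esub> e0 \<in> ext M" "y \<ominus>\<^bsub>S\<^esub> e1 \<in> ext M" "x \<otimes>\<^bsub>S\<^esub> y \<in> ext I"
      using IK(1) unfolding good_def by auto
    obtain x' y' where x': "x' \<in> carrier S" "y' \<in> carrier S" "x' \<ominus>\<^bsub>S\<^esub> e0 \<in> ext M" "y' \<ominus>\<^bsub>S\<^esub> e1 \<in> ext M" "x' \<otimes>\<^bsub>S\<^esub> y' \<in> ext K"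
      using IK(2) unfolding good_def by auto
    have "(x \<otimes>\<^bsub>S\<^esub> x') \<otimes>\<^bsub>S\<^esub> (y \<otimes>\<^bsub>S\<^esub> y') = (x \<otimes>\<^bsub>S\<^esub> y) \<otimes>\<^bsub>S\<^esub> (x' \<otimes>\<^bsub>S\<^esub> y')" using x x' by (simp add: S.m_ac)
    also have "\<dots> \<in> ext L" by (rule ext_prod[OF I IK(3) ext_mult[OF I(2)] x(5) x'(5)])
    finally show "good L"
      by (rule goodI[OF S.m_closed[OF x(1) x'(1)] S.m_closed[OF x(2) x'(2)]
          prod[OF e0(1,2) x(1) x'(1) x(3) x'(3)] prod[OF e1 e11 x(2) x'(2) x(4) x'(4)]])
  next
    show "good (carrier R)"
      by (rule goodI[OF e0(1) e1 self[OF e0(1)] self[OF e1]]) (use e0(1) e1 in \<open>simp add: ext_carrier\<close>)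
    \<comment> \<open>As \<open>ext {0}\<close> is zero, goodness would be precisely
      \<open>lifts e0\<close>.\<close>
    show "\<not> good {\<zero>}"
      using e0(3) unfolding good_def J.lifts_def ext_zero_ideal e1_def by simp
  qed
  then obtain Q where Q: "primeideal Q R" "\<not> good Q" "\<And>t. t \<in> carrier R \<Longrightarrow> t \<notin> Q \<longleftrightarrow> good (Q <+>\<^bsub>R\<^esub> PIdl t)"
    by auto
  have Qi: "ideal Q R" by (rule primeideal.axioms(1)[OF Q(1)])
  have QM: "Q \<subset> M"
  proof
    show "Q \<subseteq> M"
    proof
      fix q assume q: "q \<in> Q"
      have qc: "q \<in> carrier R" using R.ideal_memD(7)[OF Qi q] .
      show "q \<in> M"
      proof (rule ccontr)
        assume "q \<notin> M"
        then have u: "q \<in> Units R" using M_units qc by simp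
        have "inv q \<otimes> q \<in> Q" by (rule R.ideal_memD(5)[OF Qi q R.Units_inv_closed[OF u]])
        then have "\<one> \<in> Q" by (simp only: R.Units_l_inv[OF u])
        then show False using R.primeideal_compl(1)[OF Q(1)] by simp
      qed
    qed
    \<comment> \<open>The elements \<open>e0\<close> and \<open>e1\<close> serve themselves:
      \<open>e0 e1 = -(e0^2 - e0)\<close> lies in \<open>ext M\<close>.\<close>
    have "good M"
      by (rule goodI[OF e0(1) e1 self[OF e0(1)] self[OF e1]])
        (simp only: e01, rule ED(5)[OF e0(2)], simp)
    then show "Q \<noteq> M" using Q(2) by auto
  qed
  \<comment> \<open>Entry 0 is \<open>t\<close>; three blocks of \<open>n\<close> coordinates
    follow, for \<open>x\<close>, for \<open>y\<close> and for the multiplier \<open>z\<close> of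
    \<open>t\<close>.\<close>
  let ?x = "\<lambda>u. dec n (\<lambda>i. u ! (1 + i))" and ?y = "\<lambda>u. dec n (\<lambda>i. u ! (1 + n + i))"
    and ?z = "\<lambda>u. dec n (\<lambda>i. u ! (1 + n + n + i))"
  have vx: "vecfun (1 + (n + n + n)) ?x" "vecfun (1 + (n + n + n)) ?y" "vecfun (1 + (n + n + n)) ?z"
    by (intro vecfun_coord; simp)+
  have peF: "R.pe (1 + (n + n + n)) (\<lambda>u. ?x u \<ominus>\<^bsub>S\<^esub> e0 \<in> ext M \<and> ?y u \<ominus>\<^bsub>S\<^esub> e1 \<in> ext M \<and>
      ?x u \<otimes>\<^bsub>S\<^esub> ?y u \<ominus>\<^bsub>S\<^esub> h (u ! 0) \<otimes>\<^bsub>S\<^esub> ?z u \<in> ext Q)"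
    by (intro R.pe_conj pe_mem_ext[OF M_ideal] pe_mem_ext[OF Qi] vecfun_minus vecfun_mult vecfun_smult
        vx vecfun_const e0(1) e1 R.polyfun_nth) simp
  have coord: "\<exists>c\<in>tuples R n. x = dec n ((!) c)" if x: "x \<in> carrier S" for x
  proof -
    obtain c where c: "\<forall>i<n. c i \<in> carrier R" "x = dec n c" using gen[OF x] by auto
    have "x = dec n ((!) (map c [0..<n]))" unfolding c(2) by (rule lincomb_cong) simp_all
    moreover have "map c [0..<n] \<in> tuples R n" using c(1) by (auto simp: tuples_def)
    ultimately show ?thesis by auto
  qed
  have "R.pe 1 (\<lambda>t. t ! 0 \<notin> Q)"
  proof (rule R.pe_cong[OF R.pe_ex[OF peF]])
    fix t assume "t \<in> tuples R 1"
    then obtain t0 where t: "t = [t0]" "t0 \<in> carrier R" by (auto simp: tuples_def length_Suc_conv)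
    have ev: "?x (t @ a @ b @ c) = dec n ((!) a)" "?y (t @ a @ b @ c) = dec n ((!) b)" "?z (t @ a @ b @ c) = dec n ((!) c)"
      if "a \<in> tuples R n" "b \<in> tuples R n" "c \<in> tuples R n" for a b c
      using that unfolding t(1) by (auto intro!: lincomb_cong simp: tuples_def nth_append)
    have cl: "dec n ((!) a) \<in> carrier S" if "a \<in> tuples R n" for a
      using that by (intro dec_closed) simp_all
    have "(\<exists>w\<in>tuples R (n + n + n). ?x (t @ w) \<ominus>\<^bsub>S\<^esub> e0 \<in> ext M \<and> ?y (t @ w) \<ominus>\<^bsub>S\<^esub> e1 \<in> ext M \<and>
        ?x (t @ w) \<otimes>\<^bsub>S\<^esub> ?y (t @ w) \<ominus>\<^bsub>S\<^esub> h ((t @ w) ! 0) \<otimes>\<^bsub>S\<^esub> ?z (t @ w) \<in> ext Q) \<longleftrightarrow>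
      (\<exists>a\<in>tuples R n. \<exists>b\<in>tuples R n. \<exists>c\<in>tuples R n. dec n ((!) a) \<ominus>\<^bsub>S\<^esub> e0 \<in> ext M \<and> dec n ((!) b) \<ominus>\<^bsub>S\<^esub> e1 \<in> ext M \<and>
        dec n ((!) a) \<otimes>\<^bsub>S\<^esub> dec n ((!) b) \<ominus>\<^bsub>S\<^esub> h t0 \<otimes>\<^bsub>S\<^esub> dec n ((!) c) \<in> ext Q)"
      unfolding bex_tuples_append append_assoc
      by (intro bex_cong refl) (simp only: ev, simp add: t(1))
    also have "\<dots> \<longleftrightarrow> (\<exists>x\<in>carrier S. \<exists>y\<in>carrier S. \<exists>z\<in>carrier S. x \<ominus>\<^bsub>S\<^esub> e0 \<in> ext M \<and> y \<ominus>\<^bsub>S\<^esub> e1 \<in> ext M \<and>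
        x \<otimes>\<^bsub>S\<^esub> y \<ominus>\<^bsub>S\<^esub> h t0 \<otimes>\<^bsub>S\<^esub> z \<in> ext Q)" (is "?L \<longleftrightarrow> ?R")
    proof
      assume ?L
      then obtain a b c where abc: "a \<in> tuples R n" "b \<in> tuples R n" "c \<in> tuples R n" "dec n ((!) a) \<ominus>\<^bsub>S\<^esub> e0 \<in> ext M"
        "dec n ((!) b) \<ominus>\<^bsub>S\<^esub> e1 \<in> ext M" "dec n ((!) a) \<otimes>\<^bsub>S\<^esub> dec n ((!) b) \<ominus>\<^bsub>S\<^esub> h t0 \<otimes>\<^bsub>S\<^esub> dec n ((!) c) \<in> ext Q"
        by (elim bexE conjE)
      show ?R
        by (rule bexI[of _ "dec n ((!) a)"], rule bexI[of _ "dec n ((!) b)"], rule bexI[of _ "dec n ((!) c)"])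
            (intro conjI abc(4-6) cl abc(1-3))+
    next
      assume ?R
      then obtain x y z where xyz: "x \<in> carrier S" "y \<in> carrier S" "z \<in> carrier S" "x \<ominus>\<^bsub>S\<^esub> e0 \<in> ext M" "y \<ominus>\<^bsub>S\<^esub> e1 \<in> ext M"
        "x \<otimes>\<^bsub>S\<^esub> y \<ominus>\<^bsub>S\<^esub> h t0 \<otimes>\<^bsub>S\<^esub> z \<in> ext Q" by (elim bexE conjE)
      obtain a b c where abc: "a \<in> tuples R n" "x = dec n ((!) a)" "b \<in> tuples R n" "y = dec n ((!) b)"
        "c \<in> tuples R n" "z = dec n ((!) c)"
        using coord[OF xyz(1)] coord[OF xyz(2)] coord[OF xyz(3)] by (elim bexE)
      show ?L
        by (rule bexI[of _ "a"], rule bexI[of _ "b"], rule bexI[of _ "c"])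
            (intro conjI xyz(4-6)[unfolded abc(2,4,6)] abc(1,3,5))+
    qed
    also have "\<dots> \<longleftrightarrow> good (Q <+>\<^bsub>R\<^esub> PIdl t0)"
    proof
      assume "\<exists>x\<in>carrier S. \<exists>y\<in>carrier S. \<exists>z\<in>carrier S. x \<ominus>\<^bsub>S\<^esub> e0 \<in> ext M \<and> y \<ominus>\<^bsub>S\<^esub> e1 \<in> ext M \<and>
        x \<otimes>\<^bsub>S\<^esub> y \<ominus>\<^bsub>S\<^esub> h t0 \<otimes>\<^bsub>S\<^esub> z \<in> ext Q"
      then obtain x y z where xyz: "x \<in> carrier S" "y \<in> carrier S" "z \<in> carrier S" "x \<ominus>\<^bsub>S\<^esub> e0 \<in> ext M" "y \<ominus>\<^bsub>S\<^esub> e1 \<in> ext M"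
        "x \<otimes>\<^bsub>S\<^esub> y \<ominus>\<^bsub>S\<^esub> h t0 \<otimes>\<^bsub>S\<^esub> z \<in> ext Q" by (elim bexE conjE)
      then have "x \<otimes>\<^bsub>S\<^esub> y \<in> ext (Q <+>\<^bsub>R\<^esub> PIdl t0)"
        using mem_ext_sum_iff[OF Qi t(2) S.m_closed[OF xyz(1,2)]] by auto
      then show "good (Q <+>\<^bsub>R\<^esub> PIdl t0)" by (rule goodI[OF xyz(1,2,4,5)])
    next
      assume "good (Q <+>\<^bsub>R\<^esub> PIdl t0)"
      then obtain x y where xy: "x \<in> carrier S" "y \<in> carrier S" "x \<ominus>\<^bsub>S\<^esub> e0 \<in> ext M" "y \<ominus>\<^bsub>S\<^esub> e1 \<in> ext M"
        "x \<otimes>\<^bsub>S\<^esub> y \<in> ext (Q <+>\<^bsub>R\<^esub> PIdl t0)" unfolding good_def by auto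
      then obtain z where z: "z \<in> carrier S" "x \<otimes>\<^bsub>S\<^esub> y \<ominus>\<^bsub>S\<^esub> h t0 \<otimes>\<^bsub>S\<^esub> z \<in> ext Q"
        using mem_ext_sum_iff[OF Qi t(2) S.m_closed[OF xy(1,2)]] by auto
      show "\<exists>x\<in>carrier S. \<exists>y\<in>carrier S. \<exists>z\<in>carrier S. x \<ominus>\<^bsub>S\<^esub> e0 \<in> ext M \<and> y \<ominus>\<^bsub>S\<^esub> e1 \<in> ext M \<and>
        x \<otimes>\<^bsub>S\<^esub> y \<ominus>\<^bsub>S\<^esub> h t0 \<otimes>\<^bsub>S\<^esub> z \<in> ext Q"
        by (rule bexI[of _ "x"], rule bexI[of _ "y"], rule bexI[of _ "z"])
            (intro conjI xy z)+
    qed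
    finally show "t ! 0 \<notin> Q \<longleftrightarrow> (\<exists>w\<in>tuples R (n + n + n). ?x (t @ w) \<ominus>\<^bsub>S\<^esub> e0 \<in> ext M \<and> ?y (t @ w) \<ominus>\<^bsub>S\<^esub> e1 \<in> ext M \<and>
        ?x (t @ w) \<otimes>\<^bsub>S\<^esub> ?y (t @ w) \<ominus>\<^bsub>S\<^esub> h ((t @ w) ! 0) \<otimes>\<^bsub>S\<^esub> ?z (t @ w) \<in> ext Q)"
      using Q(3)[OF t(2)] t(1) by simp
  qed
  then show ?thesis using Q(1) M_prime QM by auto
qed

end


section \<open>From modules in the sense of \<open>finite_algebra\<close> to finite
  homomorphisms\<close>

lemma (in algebra) ring_hom_smult_one: "(\<lambda>a. a \<odot>\<^bsub>M\<^esub> \<one>\<^bsub>M\<^esub>) \<in> ring_hom R M"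
proof (rule ring_hom_memI)
  fix x y assume xy: "x \<in> carrier R" "y \<in> carrier R"
  show "x \<odot>\<^bsub>M\<^esub> \<one>\<^bsub>M\<^esub> \<in> carrier M" using xy by simp
  show "(x \<oplus> y) \<odot>\<^bsub>M\<^esub> \<one>\<^bsub>M\<^esub> = x \<odot>\<^bsub>M\<^esub> \<one>\<^bsub>M\<^esub> \<oplus>\<^bsub>M\<^esub> y \<odot>\<^bsub>M\<^esub> \<one>\<^bsub>M\<^esub>" using xy by (simp add: smult_l_distr)
  show "(x \<otimes> y) \<odot>\<^bsub>M\<^esub> \<one>\<^bsub>M\<^esub> = (x \<odot>\<^bsub>M\<^esub> \<one>\<^bsub>M\<^esub>) \<otimes>\<^bsub>M\<^esub> (y \<odot>\<^bsub>M\<^esub> \<one>\<^bsub>M\<^esub>)"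
    using xy by (simp add: smult_assoc1 smult_assoc2)
qed simp

lemma (in algebra) finsum_smult_eq_lincomb:
  assumes "distinct xs" "set xs \<subseteq> carrier M" "c \<in> set xs \<rightarrow> carrier R" "k \<le> length xs"
  shows "(\<Oplus>\<^bsub>M\<^esub>s\<in>set (take k xs). c s \<odot>\<^bsub>M\<^esub> s) = lincomb M (\<lambda>a. a \<odot>\<^bsub>M\<^esub> \<one>\<^bsub>M\<^esub>) ((!) xs) k (\<lambda>i. c (xs ! i))"
  using assms(4)
proof (induction k)
  case 0
  show ?case by simp
next
  case (Suc k)
  have k: "k < length xs" using Suc.prems by simp
  have x: "xs ! k \<in> set xs" "xs ! k \<in> carrier M" "c (xs ! k) \<in> carrier R"
    using k assms(2,3) nth_mem[OF k] by auto
  have nin: "xs ! k \<notin> set (take k xs)"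
    using assms(1) k by (auto simp: in_set_conv_nth nth_eq_iff_index_eq)
  have clos: "c s \<odot>\<^bsub>M\<^esub> s \<in> carrier M" if "s \<in> set xs" for s
    using that assms(2,3) by auto
  have "(\<Oplus>\<^bsub>M\<^esub>s\<in>set (take (Suc k) xs). c s \<odot>\<^bsub>M\<^esub> s) = (\<Oplus>\<^bsub>M\<^esub>s\<in>insert (xs ! k) (set (take k xs)). c s \<odot>\<^bsub>M\<^esub> s)"
    using k by (simp add: take_Suc_conv_app_nth)
  also have "\<dots> = c (xs ! k) \<odot>\<^bsub>M\<^esub> (xs ! k) \<oplus>\<^bsub>M\<^esub> (\<Oplus>\<^bsub>M\<^esub>s\<in>set (take k xs). c s \<odot>\<^bsub>M\<^esub> s)"
    by (rule M.finsum_insert) (use nin clos in \<open>auto dest: in_set_takeD simp: x\<close>)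
  also have "\<dots> = (\<Oplus>\<^bsub>M\<^esub>s\<in>set (take k xs). c s \<odot>\<^bsub>M\<^esub> s) \<oplus>\<^bsub>M\<^esub> c (xs ! k) \<odot>\<^bsub>M\<^esub> (xs ! k)"
    by (rule M.a_comm) (use clos in \<open>auto dest: in_set_takeD intro!: M.finsum_closed simp: x\<close>)
  also have "c (xs ! k) \<odot>\<^bsub>M\<^esub> (xs ! k) = (c (xs ! k) \<odot>\<^bsub>M\<^esub> \<one>\<^bsub>M\<^esub>) \<otimes>\<^bsub>M\<^esub> (xs ! k)"
    using x by (simp add: smult_assoc2)
  finally show ?case using Suc.IH k by simp
qed

lemma (in noetherian_cring) exists_pe_prime_of_local:
  fixes B :: "('a, 'c, 'd) module_scheme"
  assumes loc: "local_ring R" and fin: "finite_algebra R B" and np: "\<not> product_of_local_rings B"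
  shows "\<exists>Q M. primeideal Q R \<and> pe 1 (\<lambda>t. t ! 0 \<notin> Q) \<and> primeideal M R \<and> Q \<subset> M"
proof -
  from loc have "\<exists>!I. maximalideal I R" unfolding local_ring_def by (rule conjunct2)
  then obtain M where M: "maximalideal M R" "\<forall>I. maximalideal I R \<longrightarrow> I = M"
    unfolding Ex1_def by (elim exE conjE)
  from fin obtain S where S: "algebra R B" "finite S" "S \<subseteq> carrier B"
    "\<forall>b\<in>carrier B. \<exists>c\<in>S \<rightarrow> carrier R. b = (\<Oplus>\<^bsub>B\<^esub>s\<in>S. c s \<odot>\<^bsub>B\<^esub> s)"
    unfolding finite_algebra_def by (elim conjE exE) (rule that)
  interpret B: algebra R B by (rule S(1))
  obtain xs where xs: "set xs = S" "distinct xs" using finite_distinct_list[OF S(2)] by (elim exE conjE) (rule that)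
  have xc: "xs ! i \<in> carrier B" if "i < length xs" for i
    using nth_mem[OF that] S(3) unfolding xs(1) by (rule rev_subsetD)
  \<comment> \<open>A nonunit lies in some maximal ideal, and \<open>M\<close> is the only
    one.\<close>
  have units: "a \<in> Units R" if a: "a \<in> carrier R" "a \<notin> M" for a
  proof (rule ccontr)
    assume na: "a \<notin> Units R"
    have "PIdl a \<noteq> carrier R"
    proof
      assume "PIdl a = carrier R"
      then have "\<one> \<in> PIdl a" by simp
      then obtain r where r: "r \<in> carrier R" "\<one> = r \<otimes> a" unfolding PIdl_iff by (elim bexE)
      then have "r \<otimes> a = \<one>" "a \<otimes> r = \<one>" using a(1) m_comm[OF r(1) a(1)] by simp_all
      then show False using na a(1) r(1) unfolding Units_def by simp
    qed
    then obtain N where N: "maximalideal N R" "PIdl a \<subseteq> N"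
      using exists_maximalideal_above[OF cgenideal_ideal[OF a(1)]] by auto
    have "a \<in> N" using N(2) cgenideal_self[OF a(1)] by (rule subsetD)
    then show False using a(2) M(2)[rule_format, OF N(1)] by simp
  qed
  have gen: "\<exists>c. (\<forall>i<length xs. c i \<in> carrier R) \<and> b = lincomb B (\<lambda>a. a \<odot>\<^bsub>B\<^esub> \<one>\<^bsub>B\<^esub>) ((!) xs) (length xs) c"
    if b: "b \<in> carrier B" for b
  proof -
    obtain c where c: "c \<in> S \<rightarrow> carrier R" "b = (\<Oplus>\<^bsub>B\<^esub>s\<in>S. c s \<odot>\<^bsub>B\<^esub> s)"
      using S(4)[rule_format, OF b] by (elim bexE)
    have "b = lincomb B (\<lambda>a. a \<odot>\<^bsub>B\<^esub> \<one>\<^bsub>B\<^esub>) ((!) xs) (length xs) (\<lambda>i. c (xs ! i))"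
      using B.finsum_smult_eq_lincomb[of xs c "length xs"] xs S(3) c by simp
    moreover have "\<forall>i<length xs. c (xs ! i) \<in> carrier R"
      using c(1) nth_mem[of _ xs] unfolding xs(1) by auto
    ultimately show ?thesis by (intro exI[of _ "\<lambda>i. c (xs ! i)"] conjI)
  qed
  have "finite_hom R B (\<lambda>a. a \<odot>\<^bsub>B\<^esub> \<one>\<^bsub>B\<^esub>) ((!) xs) (length xs) M"
  proof (intro finite_hom.intro finite_hom_axioms.intro)
    show "ring_hom_cring R B (\<lambda>a. a \<odot>\<^bsub>B\<^esub> \<one>\<^bsub>B\<^esub>)"
      by (rule ring_hom_cringI[OF cring_axioms B.M_cring B.ring_hom_smult_one])
    show "noetherian_cring R" by (rule noetherian_cring_axioms)
    show "primeideal M R" by (rule maximalideal_prime[OF M(1)])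
  qed (rule xc gen units; assumption)+
  from finite_hom.exists_pe_prime_of_not_product[OF this np] show ?thesis .
qed

lemma (in noetherian_domain) exists_pe_prime_of_not_local:
  assumes nl: "\<not> local_ring R"
  shows "\<exists>Q M. primeideal Q R \<and> pe 1 (\<lambda>t. t ! 0 \<notin> Q) \<and> primeideal M R \<and> Q \<subset> M"
proof -
  have "{\<zero>} \<noteq> carrier R" using one_not_zero one_closed by (metis singletonD)
  then obtain M where M: "maximalideal M R" using exists_maximalideal_above[OF zeroideal] by auto
  have "\<not> (\<exists>!I. maximalideal I R)" using nl cring_axioms unfolding local_ring_def by simp
  then obtain N where N: "maximalideal N R" "N \<noteq> M" using M unfolding Ex1_def by auto
  show ?thesis by (rule exists_pe_prime_two_maximal[OF M N(1)]) (use N(2) in simp)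
qed

theorem mainTheorem1:
  fixes A :: "('a, 'm) ring_scheme"
  assumes "noetherian_domain A"
    and "\<not> henselian_local_ring A"
  shows "condition_C A"
proof -
  interpret A: noetherian_domain A by (rule assms(1))
  obtain Q M where QM: "primeideal Q A" "A.pe 1 (\<lambda>t. t ! 0 \<notin> Q)" "primeideal M A" "Q \<subset> M"
  proof (cases "local_ring A")
    case True
    with assms(2) obtain B :: "('a, 'a list) module" where B: "finite_algebra A B" "\<not> product_of_local_rings B"
      unfolding henselian_local_ring_def by auto
    from A.exists_pe_prime_of_local[OF True B] show ?thesis by (elim exE conjE) (rule that)
  next
    case False
    from A.exists_pe_prime_of_not_local[OF False] show ?thesis by (elim exE conjE) (rule that)
  qed
  \<comment> \<open>The zero ideal of a domain is a prime below \<open>Q\<close>.\<close>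
  have "A.pe 1 (\<lambda>t. t ! 0 \<notin> {\<zero>\<^bsub>A\<^esub>})"
    by (rule A.pe_compl_prime_below[OF QM A.zeroprimeideal]) (use A.ideal_memD(2)[OF primeideal.axioms(1)[OF QM(1)]] in simp)
  then show ?thesis by (intro A.pe_imp_condition_C) simp
qed

end
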